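(* Let $S$ be a self-adjoint restriction of $T_{\max}$ (with separated boundary conditions if $\tau$ is in the limit-circle case at both endpoints), and suppose that there is a real entire fundamental system $\theta_z,\phi_z$ of $(\tau-z)u=0$ with $W(\theta_z,\phi_z)=1$ such that $\phi_z$ lies in $\operatorname{dom}(S)$ near $a$. Let $m:\rho(S)\to\mathbb C$ be the corresponding singular Weyl–Titchmarsh–Kodaira function, i.e. $m(z)$ is determined by requiring that $\psi_z=\theta_z+m(z)\phi_z$ lies in $\operatorname{dom}(S)$ near $b$. Then $m$ is analytic on $\rho(S)$ and satisfies $$m(z)=\overline{m(\overline z)},\quad z\in\rho(S).$$
   Context: Setting. $(a,b)\subseteq\mathbb R$ is an open interval (possibly unbounded); $p,q,r,s$ are Lebesgue measurable and real-valued a.e. on $(a,b)$, with $p^{-1},q,r,s\in L^1_{\mathrm{loc}}((a,b);dx)$, $r>0$ and $p\neq0$ a.e. For $f\in AC_{\mathrm{loc}}((a,b))$ put $f^{[1]}=p(f'+sf)$, $\mathfrak D_\tau=\{f\in AC_{\mathrm{loc}}((a,b)) : f^{[1]}\in AC_{\mathrm{loc}}((a,b))\}$, and $\tau f=\frac1r\big(-(f^{[1]})'+sf^{[1]}+qf\big)$ for $f\in\mathfrak D_\tau$. The Wronskian is $W(f,g)=fg^{[1]}-f^{[1]}g$. In $L^2((a,b);r(x)dx)$ the maximal operator is $T_{\max}f=\tau f$, $\operatorname{dom}(T_{\max})=\{g\in L^2((a,b);r\,dx): g\in\mathfrak D_\tau,\ \tau g\in L^2((a,b);r\,dx)\}$.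 A function lies in $L^2$ near $a$ (resp. $b$) if it lies in $L^2((a,c);r\,dx)$ (resp. $L^2((c,b);r\,dx)$) for each $c\in(a,b)$. Limits of $W(f,g)$ at an endpoint exist whenever $f,g\in\mathfrak D_\tau$ and $f,\tau f,g,\tau g$ lie in $L^2$ near it. $\tau$ is in the limit-circle case at an endpoint if for each $z\in\mathbb C$ all solutions of $(\tau-z)u=0$ lie in $L^2$ near that endpoint, and in the limit-point case if for each $z\in\mathbb C$ some solution does not. Form of $S$. $S$ is $\tau$ restricted to those $g\in\operatorname{dom}(T_{\max})$ which satisfy, at each limit-circle endpoint $c$, the boundary condition $W(g,\overline{v_c})(c)=0$, where $v_c\in\operatorname{dom}(T_{\max})$ is fixed with $W(v_c,\overline{v_c})(c)=0$ and $W(h,\overline{v_c})(c)\neq0$ for some $h\in\operatorname{dom}(T_{\max})$; no condition at limit-point endpoints. A solution $u$ of $(\tau-z)u=0$ lies in $\operatorname{dom}(S)$ near an endpoint $c$ if it lies in $L^2$ near $c$ and, when $\tau$ is limit-circle at $c$, satisfies the boundary condition of $S$ at $c$. Real entire fundamental system: for each $z\in\mathbb C$, $\theta_z,\phi_z$ are linearly independent solutions of $(\tau-z)u=0$ such that for each $x\in(a,b)$ the functions $z\mapsto\theta_z(x),\theta_z^{[1]}(x),\phi_z(x),\phi_z^{[1]}(x)$ are entire and real for $z\in\mathbb R$. For $z\in\rho(S)$ the number $m(z)$ is well defined. *)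

theory Defs
  imports "HOL-Analysis.Analysis"
begin

definition abs_cont_on :: "(real \<Rightarrow> complex) \<Rightarrow> real \<Rightarrow> real \<Rightarrow> bool" where
  "abs_cont_on f c d \<longleftrightarrow>
     (\<forall>\<epsilon>>0. \<exists>\<delta>>0. \<forall>(n::nat) u v.
        (\<forall>i<n. c \<le> u i \<and> u i \<le> v i \<and> v i \<le> d) \<and>
        disjoint_family_on (\<lambda>i. {u i<..<v i}) {..<n} \<and>
        (\<Sum>i<n. v i - u i) < \<delta>
        \<longrightarrow> (\<Sum>i<n. cmod (f (v i) - f (u i))) < \<epsilon>)"

definition AC_loc :: "real set \<Rightarrow> (real \<Rightarrow> complex) set" where
  "AC_loc I = {f. \<forall>c d. c \<le> d \<and> {c..d} \<subseteq> I \<longrightarrow> abs_cont_on f c d}"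

definition L1_loc :: "real set \<Rightarrow> (real \<Rightarrow> real) set" where
  "L1_loc I = {f. \<forall>K. compact K \<and> K \<subseteq> I \<longrightarrow> f absolutely_integrable_on K}"

text \<open>
  Elements of the Hilbert space are represented by functions, to be identified when they agree
  almost everywhere. An operator is represented by a set of pairs (argument, value) of such
  functions, which need not contain all representatives of its arguments and values.
\<close>

definition L2 :: "'a measure \<Rightarrow> ('a \<Rightarrow> complex) set" where
  "L2 M = {f \<in> borel_measurable M. integrable M (\<lambda>x. (cmod (f x))\<^sup>2)}"

definition L2_inner :: "'a measure \<Rightarrow> ('a \<Rightarrow> complex) \<Rightarrow> ('a \<Rightarrow> complex) \<Rightarrow> complex" where
  "L2_inner M f g = (\<integral>x. f x * cnj (g x) \<partial>M)"

definition L2_norm :: "'a measure \<Rightarrow> ('a \<Rightarrow> complex) \<Rightarrow> real" where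
  "L2_norm M f = sqrt (\<integral>x. (cmod (f x))\<^sup>2 \<partial>M)"

type_synonym 'a op_graph = "(('a \<Rightarrow> complex) \<times> ('a \<Rightarrow> complex)) set"

definition ae_saturation :: "'a measure \<Rightarrow> 'a op_graph \<Rightarrow> 'a op_graph" where
  "ae_saturation M T = {(f, u) \<in> L2 M \<times> L2 M.
     \<exists>(f', u')\<in>T. (AE x in M. f x = f' x) \<and> (AE x in M. u x = u' x)}"

definition densely_defined :: "'a measure \<Rightarrow> 'a op_graph \<Rightarrow> bool" where
  "densely_defined M T \<longleftrightarrow>
     (\<forall>g\<in>L2 M. \<forall>\<epsilon>>0. \<exists>f\<in>Domain T. L2_norm M (\<lambda>x. f x - g x) < \<epsilon>)"

definition adjoint_graph :: "'a measure \<Rightarrow> 'a op_graph \<Rightarrow> 'a op_graph" where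
  "adjoint_graph M T = {(g, h) \<in> L2 M \<times> L2 M.
     \<forall>(f, u)\<in>T. L2_inner M u g = L2_inner M f h}"

definition self_adjoint :: "'a measure \<Rightarrow> 'a op_graph \<Rightarrow> bool" where
  "self_adjoint M T \<longleftrightarrow>
     T \<subseteq> L2 M \<times> L2 M \<and> densely_defined M T \<and> adjoint_graph M T = ae_saturation M T"

text \<open>The three conditions say that $T - z$ is injective, is onto, and has a bounded inverse.\<close>

definition resolvent_set :: "'a measure \<Rightarrow> 'a op_graph \<Rightarrow> complex set" where
  "resolvent_set M T = {z.
     (\<forall>(f, u)\<in>T. (AE x in M. u x - z * f x = 0) \<longrightarrow> (AE x in M. f x = 0)) \<and>
     (\<forall>h\<in>L2 M. \<exists>(f, u)\<in>T. AE x in M. u x - z * f x = h x) \<and>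
     (\<exists>C. \<forall>(f, u)\<in>T. L2_norm M f \<le> C * L2_norm M (\<lambda>x. u x - z * f x))}"

record sl_data =
  lend :: ereal
  rend :: ereal
  pc :: "real \<Rightarrow> real"
  qc :: "real \<Rightarrow> real"
  rc :: "real \<Rightarrow> real"
  sc :: "real \<Rightarrow> real"

definition ival :: "sl_data \<Rightarrow> real set" where
  "ival \<tau> = einterval (lend \<tau>) (rend \<tau>)"

definition sl_expression :: "sl_data \<Rightarrow> bool" where
  "sl_expression \<tau> \<longleftrightarrow>
     lend \<tau> < rend \<tau> \<and>
     {pc \<tau>, qc \<tau>, rc \<tau>, sc \<tau>} \<subseteq> borel_measurable (lebesgue_on (ival \<tau>)) \<and>
     {\<lambda>x. inverse (pc \<tau> x), qc \<tau>, rc \<tau>, sc \<tau>} \<subseteq> L1_loc (ival \<tau>) \<and>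
     (AE x in lebesgue_on (ival \<tau>). 0 < rc \<tau> x) \<and>
     (AE x in lebesgue_on (ival \<tau>). pc \<tau> x \<noteq> 0)"

text \<open>
  The expression $p(f' + sf)$ is defined only almost everywhere. That it belongs to the class of
  locally absolutely continuous functions means that it has a representative there; this
  representative is unique on the interval and its pointwise values are those of the
  quasi-derivative.
\<close>

definition is_quasi_deriv :: "sl_data \<Rightarrow> (real \<Rightarrow> complex) \<Rightarrow> (real \<Rightarrow> complex) \<Rightarrow> bool" where
  "is_quasi_deriv \<tau> f g \<longleftrightarrow> g \<in> AC_loc (ival \<tau>) \<and>
     (AE x in lebesgue_on (ival \<tau>).
        g x = of_real (pc \<tau> x) * (vector_derivative f (at x) + of_real (sc \<tau> x) * f x))"

definition quasi_deriv :: "sl_data \<Rightarrow> (real \<Rightarrow> complex) \<Rightarrow> real \<Rightarrow> complex" where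
  "quasi_deriv \<tau> f = (SOME g. is_quasi_deriv \<tau> f g)"

definition D_tau :: "sl_data \<Rightarrow> (real \<Rightarrow> complex) set" where
  "D_tau \<tau> = {f \<in> AC_loc (ival \<tau>). \<exists>g. is_quasi_deriv \<tau> f g}"

definition tau :: "sl_data \<Rightarrow> (real \<Rightarrow> complex) \<Rightarrow> real \<Rightarrow> complex" where
  "tau \<tau> f x =
     (- vector_derivative (quasi_deriv \<tau> f) (at x) + of_real (sc \<tau> x) * quasi_deriv \<tau> f x
        + of_real (qc \<tau> x) * f x) / of_real (rc \<tau> x)"

definition wronskian ::
    "sl_data \<Rightarrow> (real \<Rightarrow> complex) \<Rightarrow> (real \<Rightarrow> complex) \<Rightarrow> real \<Rightarrow> complex" where
  "wronskian \<tau> f g x = f x * quasi_deriv \<tau> g x - quasi_deriv \<tau> f x * g x"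

definition solution :: "sl_data \<Rightarrow> complex \<Rightarrow> (real \<Rightarrow> complex) \<Rightarrow> bool" where
  "solution \<tau> z u \<longleftrightarrow>
     u \<in> D_tau \<tau> \<and> (AE x in lebesgue_on (ival \<tau>). tau \<tau> u x - z * u x = 0)"

datatype endpoint = LeftEnd | RightEnd

fun end_filter :: "sl_data \<Rightarrow> endpoint \<Rightarrow> real filter" where
  "end_filter \<tau> LeftEnd = filtercomap ereal (at_right (lend \<tau>))"
| "end_filter \<tau> RightEnd = filtercomap ereal (at_left (rend \<tau>))"

fun end_part :: "sl_data \<Rightarrow> endpoint \<Rightarrow> real \<Rightarrow> real set" where
  "end_part \<tau> LeftEnd x = einterval (lend \<tau>) (ereal x)"
| "end_part \<tau> RightEnd x = einterval (ereal x) (rend \<tau>)"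

definition weight_measure :: "sl_data \<Rightarrow> real set \<Rightarrow> real measure" where
  "weight_measure \<tau> A = density (lebesgue_on A) (\<lambda>x. ennreal (rc \<tau> x))"

definition L2_near :: "sl_data \<Rightarrow> endpoint \<Rightarrow> (real \<Rightarrow> complex) \<Rightarrow> bool" where
  "L2_near \<tau> c f \<longleftrightarrow> (\<forall>x\<in>ival \<tau>. f \<in> L2 (weight_measure \<tau> (end_part \<tau> c x)))"

definition limit_circle :: "sl_data \<Rightarrow> endpoint \<Rightarrow> bool" where
  "limit_circle \<tau> c \<longleftrightarrow> (\<forall>z u. solution \<tau> z u \<longrightarrow> L2_near \<tau> c u)"

text \<open>The assertion $W(f,g)(c) = w$, including the existence of the limit.\<close>

definition wronskian_at ::
    "sl_data \<Rightarrow> endpoint \<Rightarrow> (real \<Rightarrow> complex) \<Rightarrow> (real \<Rightarrow> complex) \<Rightarrow> complex \<Rightarrow> bool" where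
  "wronskian_at \<tau> c f g w \<longleftrightarrow> (wronskian \<tau> f g \<longlongrightarrow> w) (end_filter \<tau> c)"

abbreviation sl_measure :: "sl_data \<Rightarrow> real measure" where
  "sl_measure \<tau> \<equiv> weight_measure \<tau> (ival \<tau>)"

definition dom_max :: "sl_data \<Rightarrow> (real \<Rightarrow> complex) set" where
  "dom_max \<tau> = {g \<in> L2 (sl_measure \<tau>). g \<in> D_tau \<tau> \<and> tau \<tau> g \<in> L2 (sl_measure \<tau>)}"

definition T_max :: "sl_data \<Rightarrow> real op_graph" where
  "T_max \<tau> = {(g, tau \<tau> g) | g. g \<in> dom_max \<tau>}"

definition boundary_function :: "sl_data \<Rightarrow> endpoint \<Rightarrow> (real \<Rightarrow> complex) \<Rightarrow> bool" where
  "boundary_function \<tau> c v \<longleftrightarrow>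
     v \<in> dom_max \<tau> \<and>
     wronskian_at \<tau> c v (\<lambda>x. cnj (v x)) 0 \<and>
     (\<exists>h\<in>dom_max \<tau>. \<exists>w. w \<noteq> 0 \<and> wronskian_at \<tau> c h (\<lambda>x. cnj (v x)) w)"

text \<open>An endpoint that is not limit-circle is limit-point (Weyl's alternative).\<close>

definition boundary_cond ::
    "sl_data \<Rightarrow> (endpoint \<Rightarrow> real \<Rightarrow> complex) \<Rightarrow> endpoint \<Rightarrow> (real \<Rightarrow> complex) \<Rightarrow> bool" where
  "boundary_cond \<tau> v c g \<longleftrightarrow>
     (limit_circle \<tau> c \<longrightarrow> wronskian_at \<tau> c g (\<lambda>x. cnj (v c x)) 0)"

definition separated_restriction ::
    "sl_data \<Rightarrow> (endpoint \<Rightarrow> real \<Rightarrow> complex) \<Rightarrow> real op_graph" where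
  "separated_restriction \<tau> v = {(g, u) \<in> T_max \<tau>. \<forall>c. boundary_cond \<tau> v c g}"

definition in_dom_near ::
    "sl_data \<Rightarrow> (endpoint \<Rightarrow> real \<Rightarrow> complex) \<Rightarrow> endpoint \<Rightarrow> (real \<Rightarrow> complex) \<Rightarrow> bool" where
  "in_dom_near \<tau> v c u \<longleftrightarrow> L2_near \<tau> c u \<and> boundary_cond \<tau> v c u"

definition real_entire :: "(complex \<Rightarrow> complex) \<Rightarrow> bool" where
  "real_entire F \<longleftrightarrow> F holomorphic_on UNIV \<and> (\<forall>z\<in>\<real>. F z \<in> \<real>)"

definition real_entire_fundamental_system ::
    "sl_data \<Rightarrow> (complex \<Rightarrow> real \<Rightarrow> complex) \<Rightarrow> (complex \<Rightarrow> real \<Rightarrow> complex) \<Rightarrow> bool" where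
  "real_entire_fundamental_system \<tau> \<theta> \<phi> \<longleftrightarrow>
     (\<forall>z. solution \<tau> z (\<theta> z) \<and> solution \<tau> z (\<phi> z) \<and>
        (\<forall>c d. (\<forall>x\<in>ival \<tau>. c * \<theta> z x + d * \<phi> z x = 0) \<longrightarrow> c = 0 \<and> d = 0)) \<and>
     (\<forall>x\<in>ival \<tau>.
        real_entire (\<lambda>z. \<theta> z x) \<and> real_entire (\<lambda>z. quasi_deriv \<tau> (\<theta> z) x) \<and>
        real_entire (\<lambda>z. \<phi> z x) \<and> real_entire (\<lambda>z. quasi_deriv \<tau> (\<phi> z) x))"

end

theory Submission
  imports Defs "HOL-Complex_Analysis.Complex_Analysis"
begin

text \<open>
  Let \<open>z\<^sub>0\<close> lie in the resolvent set and choose \<open>w \<noteq> z\<^sub>0\<close> close to \<open>z\<^sub>0\<close>. Applying the resolvent at \<open>z\<close> to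
  \<open>\<phi>\<^sub>w\<close> cut off to the right of a point \<open>c\<close> gives a multiple of \<open>\<psi>\<^sub>z\<close> on the right of \<open>c\<close>, the factor
  being \<open>W(\<phi>\<^sub>z, \<phi>\<^sub>w)(c) / (z - w)\<close>. Testing it against \<open>\<phi>\<^sub>w\<close> on \<open>(c, d]\<close> and using the
  Lagrange identity, one gets
  \<open>W(\<phi>\<^sub>z, \<phi>\<^sub>w)(c) (W(\<psi>\<^sub>z, \<phi>\<^sub>w)(d) - W(\<psi>\<^sub>z, \<phi>\<^sub>w)(c)) / (z - w)\<^sup>2\<close>. This is holomorphic in \<open>z\<close> because
  the resolvent is, it is affine in \<open>m z\<close>, and all other quantities in it are entire in \<open>z\<close>; so \<open>m\<close> is
  holomorphic near \<open>z\<^sub>0\<close> as soon as \<open>W(\<phi>\<^sub>z, \<phi>\<^sub>w)\<close> neither vanishes at \<open>c\<close> nor takes the same value at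
  \<open>c\<close> and \<open>d\<close> for \<open>z = z\<^sub>0\<close>. Taking \<open>w \<noteq> z\<^sub>0\<close> avoids parameter integrals and hence any
  estimate of solutions that is uniform in \<open>z\<close>.

  The symmetry of \<open>m\<close> holds because the boundary conditions are invariant under conjugation: otherwise
  the difference of \<open>\<psi>\<^sub>z\<close> and its reflection would be a non-zero multiple of \<open>\<phi>\<^sub>z\<close> in the domain near
  both endpoints, that is, an eigenfunction.
\<close>

subsection \<open>Absolutely continuous functions\<close>

text \<open>Why two cuts: \<open>\<phi> w\<close> is square integrable near the left end for every
  \<open>w\<close>, but need not be so near the right end. The function fed to the resolvent is
  therefore cut at \<open>c\<close>, and the function it is paired with is also cut at
  \<open>d\<close>. Neither cut-off function depends on \<open>z\<close>, so weak holomorphy of the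
  resolvent suffices. Why \<open>c\<close> and \<open>d\<close> exist: the derivative of
  \<open>W(\<phi> z, \<phi> w)\<close> is \<open>r (z - w) \<phi> z \<phi> w\<close> almost
  everywhere. The Wronskian is thus non-constant once \<open>z \<noteq> w\<close> and both solutions
  are non-zero at a common point, which continuity of \<open>\<phi>\<close> in the spectral
  parameter provides for \<open>w\<close> near \<open>z\<^sub>0\<close>. The analytic obstacle is
  that absolute continuity is given by an epsilon-delta condition, whereas the Lagrange identity
  needs an almost everywhere derivative whose integral recovers the function. Total variation
  reduces this to monotone functions, and for those the derivative is the Radon-Nikodym density of
  the Lebesgue-Stieltjes measure.\<close>

definition int_family :: "real \<Rightarrow> real \<Rightarrow> 'i set \<Rightarrow> ('i \<Rightarrow> real) \<Rightarrow> ('i \<Rightarrow> real) \<Rightarrow> bool" where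
  "int_family c d K u v \<longleftrightarrow> finite K \<and> (\<forall>i\<in>K. c \<le> u i \<and> u i \<le> v i \<and> v i \<le> d) \<and>
     disjoint_family_on (\<lambda>i. {u i<..<v i}) K"

definition ac_modulus :: "(real \<Rightarrow> complex) \<Rightarrow> real \<Rightarrow> real \<Rightarrow> real \<Rightarrow> real \<Rightarrow> bool" where
  "ac_modulus f c d \<epsilon> \<delta> \<longleftrightarrow> (\<forall>(n::nat) u v. int_family c d {..<n} u v \<and> (\<Sum>i<n. v i - u i) < \<delta>
      \<longrightarrow> (\<Sum>i<n. cmod (f (v i) - f (u i))) < \<epsilon>)"

lemma abs_cont_on_iff_modulus: "abs_cont_on f c d \<longleftrightarrow> (\<forall>\<epsilon>>0. \<exists>\<delta>>0. ac_modulus f c d \<epsilon> \<delta>)"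
  by (simp add: abs_cont_on_def ac_modulus_def int_family_def Ball_def)

text \<open>An enumeration of the finite index set reduces this to the definition. Later families
  are indexed by pairs or by the intervals themselves, and need not be renumbered each time.\<close>

lemma ac_modulusD:
  assumes m: "ac_modulus f c d \<epsilon> \<delta>" and fam: "int_family c d K u v" and s: "(\<Sum>i\<in>K. v i - u i) < \<delta>"
  shows "(\<Sum>i\<in>K. cmod (f (v i) - f (u i))) < \<epsilon>"
proof -
  have "finite K" using fam by (simp add: int_family_def)
  then obtain h where h: "bij_betw h {..<card K} K"
    using ex_bij_betw_nat_finite[of K] by (auto simp: lessThan_atLeast0)
  have hK: "h i \<in> K" if "i < card K" for i using h that by (auto simp: bij_betw_def)
  have inj: "inj_on h {..<card K}" using h by (auto simp: bij_betw_def)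
  have "int_family c d {..<card K} (u \<circ> h) (v \<circ> h)"
  proof -
    have "{u (h i)<..<v (h i)} \<inter> {u (h j)<..<v (h j)} = {}" if "i < card K" "j < card K" "i \<noteq> j" for i j
    proof -
      have "h i \<noteq> h j" using inj that by (auto simp: inj_on_def)
      then show ?thesis using fam hK[OF that(1)] hK[OF that(2)]
        by (auto simp: int_family_def disjoint_family_on_def)
    qed
    then show ?thesis using fam hK unfolding int_family_def disjoint_family_on_def by auto
  qed
  moreover have "(\<Sum>i<card K. (v \<circ> h) i - (u \<circ> h) i) = (\<Sum>i\<in>K. v i - u i)"
    using sum.reindex_bij_betw[OF h, of "\<lambda>i. v i - u i"] by simp
  moreover have "(\<Sum>i<card K. cmod (f ((v \<circ> h) i) - f ((u \<circ> h) i))) = (\<Sum>i\<in>K. cmod (f (v i) - f (u i)))"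
    using sum.reindex_bij_betw[OF h, of "\<lambda>i. cmod (f (v i) - f (u i))"] by simp
  ultimately show ?thesis
    using m s unfolding ac_modulus_def by metis
qed

lemma int_family_shrink:
  assumes fam: "int_family c d K u v"
    and "\<And>i. i \<in> K \<Longrightarrow> c' \<le> u' i \<and> u' i \<le> v' i \<and> v' i \<le> d'"
    and "\<And>i. i \<in> K \<Longrightarrow> {u' i<..<v' i} \<subseteq> {u i<..<v i}"
  shows "int_family c' d' K u' v'"
  using assms unfolding int_family_def disjoint_family_on_def by (meson disjoint_iff subset_iff)

lemma abs_cont_on_subset:
  assumes "abs_cont_on f c d" "c \<le> c'" "d' \<le> d"
  shows "abs_cont_on f c' d'"
proof -
  have "ac_modulus f c d \<epsilon> \<delta> \<Longrightarrow> ac_modulus f c' d' \<epsilon> \<delta>" for \<epsilon> \<delta>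
    unfolding ac_modulus_def int_family_def by (meson assms(2,3) order_trans)
  then show ?thesis using assms(1) unfolding abs_cont_on_iff_modulus by meson
qed

lemma abs_cont_on_imp_continuous_on:
  assumes "abs_cont_on f c d"
  shows "continuous_on {c..d} f"
  unfolding continuous_on_iff
proof (intro ballI allI impI)
  fix x e :: real assume x: "x \<in> {c..d}" and e: "0 < e"
  obtain \<delta> where d: "\<delta> > 0" and m: "ac_modulus f c d e \<delta>"
    using assms e unfolding abs_cont_on_iff_modulus by blast
  have "cmod (f (max x y) - f (min x y)) < e" if "y \<in> {c..d}" "dist y x < \<delta>" for y
  proof -
    have "int_family c d {()} (\<lambda>_. min x y) (\<lambda>_. max x y)"
      using x that by (auto simp: int_family_def disjoint_family_on_def)
    from ac_modulusD[OF m this] that(2) show ?thesis by (auto simp: dist_real_def)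
  qed
  then have "\<forall>x'\<in>{c..d}. dist x' x < \<delta> \<longrightarrow> dist (f x') (f x) < e"
    by (smt (verit, best) dist_commute dist_norm)
  with d show "\<exists>d'>0. \<forall>x'\<in>{c..d}. dist x' x < d' \<longrightarrow> dist (f x') (f x) < e" by blast
qed

text \<open>The common source of the closure properties: sums, products, conjugates, real and
  imaginary parts all have increments bounded linearly by increments of the given functions.\<close>

lemma abs_cont_on_dominated:
  assumes f: "abs_cont_on f c d" and g: "abs_cont_on g c d"
    and AB: "0 \<le> A" "0 \<le> B"
    and le: "\<And>u v. c \<le> u \<Longrightarrow> u \<le> v \<Longrightarrow> v \<le> d \<Longrightarrow>
       cmod (h v - h u) \<le> A * cmod (f v - f u) + B * cmod (g v - g u)"
  shows "abs_cont_on h c d"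
  unfolding abs_cont_on_iff_modulus
proof (intro allI impI)
  fix \<epsilon> :: real assume e: "\<epsilon> > 0"
  \<comment> \<open>The extra 1 keeps the denominator positive and makes the final estimate
    strict.\<close>
  define \<eta> where "\<eta> = \<epsilon> / (A + B + 1)"
  have eta: "\<eta> > 0" using e AB by (simp add: \<eta>_def)
  obtain \<delta>1 where d1: "\<delta>1 > 0" "ac_modulus f c d \<eta> \<delta>1"
    using f eta unfolding abs_cont_on_iff_modulus by blast
  obtain \<delta>2 where d2: "\<delta>2 > 0" "ac_modulus g c d \<eta> \<delta>2"
    using g eta unfolding abs_cont_on_iff_modulus by blast
  have "ac_modulus h c d \<epsilon> (min \<delta>1 \<delta>2)"
    unfolding ac_modulus_def
  proof (intro allI impI, elim conjE)
    fix n :: nat and u v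
    assume fam: "int_family c d {..<n} u v" and s: "(\<Sum>i<n. v i - u i) < min \<delta>1 \<delta>2"
    have "(\<Sum>i<n. cmod (h (v i) - h (u i)))
        \<le> (\<Sum>i<n. A * cmod (f (v i) - f (u i)) + B * cmod (g (v i) - g (u i)))"
      using fam by (intro sum_mono le) (auto simp: int_family_def)
    also have "\<dots> = A * (\<Sum>i<n. cmod (f (v i) - f (u i))) + B * (\<Sum>i<n. cmod (g (v i) - g (u i)))"
      by (simp add: sum.distrib sum_distrib_left)
    also have "\<dots> \<le> A * \<eta> + B * \<eta>"
      using ac_modulusD[OF d1(2) fam] ac_modulusD[OF d2(2) fam] s AB
      by (intro add_mono mult_left_mono) auto
    also have "\<dots> < (A + B + 1) * \<eta>" using eta by (simp add: algebra_simps)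
    also have "\<dots> = \<epsilon>" using AB by (simp add: \<eta>_def)
    finally show "(\<Sum>i<n. cmod (h (v i) - h (u i))) < \<epsilon>" .
  qed
  then show "\<exists>\<delta>>0. ac_modulus h c d \<epsilon> \<delta>" using d1(1) d2(1) by (intro exI[of _ "min \<delta>1 \<delta>2"]) auto
qed

lemma abs_cont_on_add:
  assumes "abs_cont_on f c d" "abs_cont_on g c d"
  shows "abs_cont_on (\<lambda>x. f x + g x) c d"
  by (rule abs_cont_on_dominated[OF assms, of 1 1])
     (simp_all add: add_diff_add norm_triangle_ineq)

lemma abs_cont_on_mult:
  assumes f: "abs_cont_on f c d" and g: "abs_cont_on g c d"
  shows "abs_cont_on (\<lambda>x. f x * g x) c d"
proof -
  have "bounded (f ` {c..d})"
    using compact_continuous_image[OF abs_cont_on_imp_continuous_on[OF f] compact_Icc]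
    by (rule compact_imp_bounded)
  then obtain A where A: "\<And>x. x \<in> {c..d} \<Longrightarrow> cmod (f x) \<le> A"
    unfolding bounded_iff by blast
  have "bounded (g ` {c..d})"
    using compact_continuous_image[OF abs_cont_on_imp_continuous_on[OF g] compact_Icc]
    by (rule compact_imp_bounded)
  then obtain B where B: "\<And>x. x \<in> {c..d} \<Longrightarrow> cmod (g x) \<le> B"
    unfolding bounded_iff by blast
  show ?thesis
  proof (rule abs_cont_on_dominated[OF f g, of "max 0 B" "max 0 A"])
    fix u v assume uv: "c \<le> u" "u \<le> v" "v \<le> d"
    have "f v * g v - f u * g u = (f v - f u) * g u + f v * (g v - g u)"
      by (simp add: algebra_simps)
    then have "cmod (f v * g v - f u * g u) \<le> cmod (g u) * cmod (f v - f u) + cmod (f v) * cmod (g v - g u)"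
      by (metis mult.commute norm_mult norm_triangle_ineq)
    also have "\<dots> \<le> max 0 B * cmod (f v - f u) + max 0 A * cmod (g v - g u)"
      using A[of v] B[of u] uv by (intro add_mono mult_right_mono) auto
    finally show "cmod (f v * g v - f u * g u) \<le> max 0 B * cmod (f v - f u) + max 0 A * cmod (g v - g u)" .
  qed auto
qed

lemma abs_cont_on_const: "abs_cont_on (\<lambda>_. k) c d"
  unfolding abs_cont_on_def by (intro allI impI exI[of _ 1]) auto

lemma abs_cont_on_diff:
  assumes "abs_cont_on f c d" "abs_cont_on g c d"
  shows "abs_cont_on (\<lambda>x. f x - g x) c d"
  using abs_cont_on_add[OF assms(1) abs_cont_on_mult[OF abs_cont_on_const[of "-1"] assms(2)]]
  by simp

lemma abs_cont_on_cnj: "abs_cont_on f c d \<Longrightarrow> abs_cont_on (\<lambda>x. cnj (f x)) c d"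
  by (rule abs_cont_on_dominated[of f c d f 1 0]) (auto simp flip: complex_cnj_diff)

lemma abs_cont_on_Re: "abs_cont_on f c d \<Longrightarrow> abs_cont_on (\<lambda>x. complex_of_real (Re (f x))) c d"
  by (rule abs_cont_on_dominated[of f c d f 1 0])
     (simp_all flip: of_real_diff minus_complex.sel add: abs_Re_le_cmod)

lemma abs_cont_on_Im: "abs_cont_on f c d \<Longrightarrow> abs_cont_on (\<lambda>x. complex_of_real (Im (f x))) c d"
  by (rule abs_cont_on_dominated[of f c d f 1 0])
     (simp_all flip: of_real_diff minus_complex.sel add: abs_Im_le_cmod)

text \<open>Meant for clamping maps built from \<open>min\<close> and \<open>max\<close>, which
  extend a function by constants and glue two functions at a point. A nondecreasing contraction
  sends disjoint intervals to disjoint intervals without lengthening them.\<close>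

lemma abs_cont_on_compose_contraction:
  assumes f: "abs_cont_on f c d"
    and mono: "\<And>u v. u \<le> v \<Longrightarrow> \<pi> u \<le> \<pi> v" and lip: "\<And>u v. u \<le> v \<Longrightarrow> \<pi> v - \<pi> u \<le> v - u"
    and im: "c \<le> \<pi> c'" "\<pi> d' \<le> d"
  shows "abs_cont_on (\<lambda>x. f (\<pi> x)) c' d'"
proof -
  have "ac_modulus (\<lambda>x. f (\<pi> x)) c' d' \<epsilon> \<delta>" if m: "ac_modulus f c d \<epsilon> \<delta>" for \<epsilon> \<delta>
    unfolding ac_modulus_def
  proof (intro allI impI, elim conjE)
    fix n :: nat and u v
    assume fam: "int_family c' d' {..<n} u v" and s: "(\<Sum>i<n. v i - u i) < \<delta>"
    have "{\<pi> (u i)<..<\<pi> (v i)} \<inter> {\<pi> (u j)<..<\<pi> (v j)} = {}" if "i < n" "j < n" "i \<noteq> j" for i j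
    proof -
      have "{u i<..<v i} \<inter> {u j<..<v j} = {}" "u i \<le> v i" "u j \<le> v j"
        using fam that by (auto simp: int_family_def disjoint_family_on_def)
      then have "v i \<le> u i \<or> v j \<le> u j \<or> v i \<le> u j \<or> v j \<le> u i"
        by (auto simp: disjoint_iff)
      then show ?thesis using mono by fastforce
    qed
    then have "int_family c d {..<n} (\<pi> \<circ> u) (\<pi> \<circ> v)"
      using fam im(1) order_trans[OF mono im(2)] order_trans[OF im(1) mono] mono
      unfolding int_family_def disjoint_family_on_def by simp
    moreover have "(\<Sum>i<n. (\<pi> \<circ> v) i - (\<pi> \<circ> u) i) \<le> (\<Sum>i<n. v i - u i)"
      using fam by (intro sum_mono) (auto simp: int_family_def intro: lip)
    ultimately show "(\<Sum>i<n. cmod (f (\<pi> (v i)) - f (\<pi> (u i)))) < \<epsilon>"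
      using ac_modulusD[OF m, of "{..<n}" "\<pi> \<circ> u" "\<pi> \<circ> v"] s by simp
  qed
  then show ?thesis using f unfolding abs_cont_on_iff_modulus by meson
qed

lemma int_family_length_le:
  assumes fam: "int_family c d K u v" and sub: "\<And>i. i \<in> K \<Longrightarrow> {u i<..<v i} \<subseteq> U" and U: "U \<in> lmeasurable"
  shows "(\<Sum>i\<in>K. v i - u i) \<le> measure lebesgue U"
proof -
  have "(\<Sum>i\<in>K. v i - u i) = (\<Sum>i\<in>K. measure lebesgue {u i<..<v i})"
    using fam by (intro sum.cong) (auto simp: int_family_def)
  also have "\<dots> = measure lebesgue (\<Union>i\<in>K. {u i<..<v i})"
    using fam by (intro measure_finite_Union[symmetric]) (auto simp: int_family_def)
  also have "\<dots> \<le> measure lebesgue U"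
    using sub U by (intro measure_mono_fmeasurable) (auto intro!: sets.finite_UN fam[unfolded int_family_def, THEN conjunct1])
  finally show ?thesis .
qed

subsection \<open>Total variation\<close>

definition variation_sums :: "(real \<Rightarrow> complex) \<Rightarrow> real \<Rightarrow> real \<Rightarrow> real set" where
  "variation_sums f c d = {(\<Sum>i<n. cmod (f (v i) - f (u i))) | n u v. int_family c d {..<(n::nat)} u v}"

definition variation :: "(real \<Rightarrow> complex) \<Rightarrow> real \<Rightarrow> real \<Rightarrow> real" where
  "variation f c d = Sup (variation_sums f c d)"

lemma variation_sumsI:
  "int_family c d {..<n::nat} u v \<Longrightarrow> (\<Sum>i<n. cmod (f (v i) - f (u i))) \<in> variation_sums f c d"
  unfolding variation_sums_def by (rule CollectI) (intro exI[of _ n] exI[of _ u] exI[of _ v] conjI refl)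

lemma zero_in_variation_sums: "0 \<in> variation_sums f c d"
proof -
  have "int_family c d {..<0::nat} (\<lambda>_. 0) (\<lambda>_. 0)" by (simp add: int_family_def disjoint_family_on_def)
  from variation_sumsI[OF this] show ?thesis by simp
qed

text \<open>Clamping every interval at \<open>e\<close> splits those that straddle \<open>e\<close>,
  and turns an interval on the wrong side into a degenerate one, which families admit and which
  contributes zero.\<close>

lemma variation_sums_cut:
  assumes t: "t \<in> variation_sums f c d" and e: "c \<le> e" "e \<le> d"
  obtains t1 t2 where "t1 \<in> variation_sums f c e" "t2 \<in> variation_sums f e d" "t \<le> t1 + t2"
proof -
  obtain n :: nat and u v where fam: "int_family c d {..<n} u v"
    and t: "t = (\<Sum>i<n. cmod (f (v i) - f (u i)))"
    using t by (auto simp: variation_sums_def)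
  define t1 where "t1 = (\<Sum>i<n. cmod (f (min (v i) e) - f (min (u i) e)))"
  define t2 where "t2 = (\<Sum>i<n. cmod (f (max (v i) e) - f (max (u i) e)))"
  have b: "c \<le> u i" "u i \<le> v i" "v i \<le> d" if "i < n" for i
    using fam that by (auto simp: int_family_def)
  have "int_family c e {..<n} (\<lambda>i. min (u i) e) (\<lambda>i. min (v i) e)"
  proof (rule int_family_shrink[OF fam])
    fix i assume "i \<in> {..<n}"
    then show "c \<le> min (u i) e \<and> min (u i) e \<le> min (v i) e \<and> min (v i) e \<le> e"
      using b[of i] e by (simp add: min_def)
  qed auto
  moreover have "int_family e d {..<n} (\<lambda>i. max (u i) e) (\<lambda>i. max (v i) e)"
  proof (rule int_family_shrink[OF fam])
    fix i assume "i \<in> {..<n}"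
    then show "e \<le> max (u i) e \<and> max (u i) e \<le> max (v i) e \<and> max (v i) e \<le> d"
      using b[of i] e by (simp add: max_def)
  qed auto
  ultimately have "t1 \<in> variation_sums f c e" "t2 \<in> variation_sums f e d"
    unfolding t1_def t2_def using variation_sumsI by blast+
  moreover have "t \<le> t1 + t2"
    unfolding t t1_def t2_def sum.distrib[symmetric]
  proof (rule sum_mono)
    fix i assume "i \<in> {..<n}"
    then have "u i \<le> v i" using fam by (auto simp: int_family_def)
    then consider "v i \<le> e" | "e \<le> u i" | "u i \<le> e" "e \<le> v i" by linarith
    then show "cmod (f (v i) - f (u i))
        \<le> cmod (f (min (v i) e) - f (min (u i) e)) + cmod (f (max (v i) e) - f (max (u i) e))"
    proof cases
      case 3
      then show ?thesis
        using norm_triangle_ineq[of "f e - f (u i)" "f (v i) - f e"] by (simp add: min_def max_def)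
    qed (use \<open>u i \<le> v i\<close> in \<open>auto simp: min_def max_def\<close>)
  qed
  ultimately show ?thesis using that by blast
qed

lemma variation_sums_append:
  assumes t: "t \<in> variation_sums f c x" and xy: "c \<le> x" "x \<le> y"
  shows "t + cmod (f y - f x) \<in> variation_sums f c y"
proof -
  obtain n :: nat and u v where fam: "int_family c x {..<n} u v"
    and t: "t = (\<Sum>i<n. cmod (f (v i) - f (u i)))"
    using t by (auto simp: variation_sums_def)
  define u' where "u' = u(n := x)"
  define v' where "v' = v(n := y)"
  have b: "c \<le> u i \<and> u i \<le> v i \<and> v i \<le> x" if "i < n" for i using fam that by (auto simp: int_family_def)
  have "{u' i<..<v' i} \<inter> {u' j<..<v' j} = {}" if ij: "i < Suc n" "j < Suc n" "i \<noteq> j" for i j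
  proof -
    consider "i < n \<and> j < n" | "i < n \<and> j = n" | "i = n \<and> j < n" using ij by linarith
    then show ?thesis
    proof cases
      case 1
      then show ?thesis using fam ij(3) by (auto simp: int_family_def disjoint_family_on_def u'_def v'_def)
    next
      case 2
      then show ?thesis using b[of i] ij(3) by (auto simp: u'_def v'_def)
    next
      case 3
      then show ?thesis using b[of j] ij(3) by (auto simp: u'_def v'_def)
    qed
  qed
  moreover have "c \<le> u' i \<and> u' i \<le> v' i \<and> v' i \<le> y" if "i < Suc n" for i
    using b[of i] that xy by (cases "i = n") (auto simp: u'_def v'_def)
  ultimately have "int_family c y {..<Suc n} u' v'"
    unfolding int_family_def disjoint_family_on_def by auto
  moreover have "(\<Sum>i<Suc n. cmod (f (v' i) - f (u' i))) = t + cmod (f y - f x)"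
    unfolding t by (simp add: u'_def v'_def)
  ultimately show ?thesis by (metis variation_sumsI)
qed


lemma variation_sums_trivial:
  assumes "t \<in> variation_sums f c d" "d \<le> c"
  shows "t = 0"
proof -
  obtain n :: nat and u v where fam: "int_family c d {..<n} u v"
    and t: "t = (\<Sum>i<n. cmod (f (v i) - f (u i)))"
    using assms by (auto simp: variation_sums_def)
  have "v i = u i" if "i < n" for i
  proof -
    have "c \<le> u i" "u i \<le> v i" "v i \<le> d" using fam that by (auto simp: int_family_def)
    then show ?thesis using assms(2) by linarith
  qed
  then show ?thesis using t by simp
qed

text \<open>For the \<delta> that belongs to the tolerance 1, a stretch shorter than \<delta>
  contributes less than 1. The induction advances by \<delta>/2, so each stretch is strictly shorter
  than \<delta>.\<close>

lemma bdd_above_variation_sums: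
  assumes ac: "abs_cont_on f c d"
  shows "bdd_above (variation_sums f c d)"
proof -
  obtain \<delta> where d: "\<delta> > 0" and m: "ac_modulus f c d 1 \<delta>"
    using ac unfolding abs_cont_on_iff_modulus by (meson zero_less_one)
  have "\<forall>y. c \<le> y \<and> y \<le> d \<and> y \<le> c + k * (\<delta> / 2) \<longrightarrow> bdd_above (variation_sums f c y)" for k :: nat
  proof (induction k)
    case 0
    have "bdd_above (variation_sums f c c)"
      by (intro bdd_aboveI[of _ 0]) (use variation_sums_trivial in force)
    then show ?case by (metis add.right_neutral mult_zero_left of_nat_0 order_antisym)
  next
    case (Suc k)
    show ?case
    proof (intro allI impI)
      fix y assume y: "c \<le> y \<and> y \<le> d \<and> y \<le> c + (Suc k) * (\<delta> / 2)"
      define e where "e = max c (y - \<delta> / 2)"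
      have e: "c \<le> e" "e \<le> y" "y - e < \<delta>" "e \<le> c + k * (\<delta> / 2)" "e \<le> d"
        using y d by (auto simp: e_def algebra_simps add_divide_distrib)
      then obtain B where B: "\<And>t. t \<in> variation_sums f c e \<Longrightarrow> t \<le> B"
        using Suc.IH by (meson bdd_above.E)
      have "t \<le> B + 1" if t: "t \<in> variation_sums f c y" for t
      proof -
        obtain t1 t2 where tt: "t1 \<in> variation_sums f c e" "t2 \<in> variation_sums f e y" "t \<le> t1 + t2"
          using variation_sums_cut[OF t e(1,2)] by metis
        obtain n :: nat and u v where fam: "int_family e y {..<n} u v"
          and t2: "t2 = (\<Sum>i<n. cmod (f (v i) - f (u i)))"
          using tt(2) by (auto simp: variation_sums_def)
        have "(\<Sum>i<n. v i - u i) \<le> measure lebesgue {e..y}"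
        proof (rule int_family_length_le[OF fam])
          fix i assume "i \<in> {..<n}"
          then have "e \<le> u i" "v i \<le> y" using fam by (auto simp: int_family_def)
          then show "{u i<..<v i} \<subseteq> {e..y}" by auto
        qed simp
        then have "(\<Sum>i<n. v i - u i) < \<delta>" using e by simp
        moreover have "int_family c d {..<n} u v"
        proof (rule int_family_shrink[OF fam])
          fix i assume "i \<in> {..<n}"
          then have "e \<le> u i" "u i \<le> v i" "v i \<le> y" using fam by (auto simp: int_family_def)
          then show "c \<le> u i \<and> u i \<le> v i \<and> v i \<le> d" using e y by linarith
        qed simp
        ultimately have "t2 < 1" using ac_modulusD[OF m] t2 by auto
        then show ?thesis using tt B by fastforce
      qed
      then show "bdd_above (variation_sums f c y)" by (rule bdd_aboveI)
    qed
  qed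
  then have *: "c \<le> d \<Longrightarrow> d \<le> c + k * (\<delta> / 2) \<Longrightarrow> bdd_above (variation_sums f c d)" for k :: nat
    by simp
  show ?thesis
  proof (cases "c \<le> d")
    case True
    obtain k :: nat where "(d - c) / (\<delta> / 2) \<le> k" using real_arch_simple by blast
    then have "d \<le> c + k * (\<delta> / 2)" using d by (simp add: field_simps)
    then show ?thesis by (rule *[OF True])
  next
    case False
    have "t \<le> 0" if "t \<in> variation_sums f c d" for t
      using variation_sums_trivial[OF that] False by simp
    then show ?thesis by (rule bdd_aboveI)
  qed
qed

lemma variation_upper:
  assumes "abs_cont_on f c d" "t \<in> variation_sums f c d"
  shows "t \<le> variation f c d"
  unfolding variation_def by (intro cSup_upper assms bdd_above_variation_sums)

text \<open>This is what makes the variation, and the variation minus the real or imaginary part of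
  \<open>f\<close>, monotone.\<close>

lemma variation_diff_ge:
  assumes ac: "abs_cont_on f c d" and xy: "c \<le> x" "x \<le> y" "y \<le> d"
  shows "cmod (f y - f x) \<le> variation f c y - variation f c x"
proof -
  have "t \<le> variation f c y - cmod (f y - f x)" if "t \<in> variation_sums f c x" for t
    using variation_upper[OF abs_cont_on_subset[OF ac _ xy(3)] variation_sums_append[OF that xy(1,2)]]
    by simp
  then have "variation f c x \<le> variation f c y - cmod (f y - f x)"
    unfolding variation_def[of f c x] using zero_in_variation_sums[of f c x] by (intro cSup_least) auto
  then show ?thesis by simp
qed

lemma variation_diff_le:
  assumes ac: "abs_cont_on f c d" and xy: "c \<le> x" "x \<le> y" "y \<le> d"
  shows "variation f c y - variation f c x \<le> variation f x y"
proof -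
  have "t \<le> variation f c x + variation f x y" if t: "t \<in> variation_sums f c y" for t
  proof -
    obtain t1 t2 where *: "t1 \<in> variation_sums f c x" "t2 \<in> variation_sums f x y" "t \<le> t1 + t2"
      using variation_sums_cut[OF t xy(1,2)] by metis
    have "t1 \<le> variation f c x" "t2 \<le> variation f x y"
      using xy by (auto intro!: variation_upper abs_cont_on_subset[OF ac] *)
    then show ?thesis using * by linarith
  qed
  then have "variation f c y \<le> variation f c x + variation f x y"
    unfolding variation_def[of f c y] using zero_in_variation_sums[of f c y] by (intro cSup_least) auto
  then show ?thesis by simp
qed

lemma variation_approx:
  assumes ac: "abs_cont_on f c d" and e: "\<epsilon> > 0"
  obtains n :: nat and u v where "int_family c d {..<n} u v"
    "variation f c d - \<epsilon> < (\<Sum>i<n. cmod (f (v i) - f (u i)))"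
proof -
  have "variation f c d - \<epsilon> < Sup (variation_sums f c d)" using e by (simp add: variation_def)
  then obtain t where "t \<in> variation_sums f c d" "variation f c d - \<epsilon> < t"
    using zero_in_variation_sums[of f c d] less_cSup_iff[OF _ bdd_above_variation_sums[OF ac]] by blast
  then show ?thesis using that by (auto simp: variation_sums_def)
qed

text \<open>Each interval of a short family is refined by subintervals that almost attain the
  variation of \<open>f\<close> on it. All the subintervals together form one family whose total
  length is still below \<delta>, so the modulus of \<open>f\<close> applies to them at
  once.\<close>

lemma abs_cont_on_variation:
  assumes ac: "abs_cont_on f c d"
  shows "abs_cont_on (\<lambda>x. complex_of_real (variation f c x)) c d"
  unfolding abs_cont_on_iff_modulus
proof (intro allI impI)
  fix \<epsilon> :: real assume e: "\<epsilon> > 0"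
  then obtain \<delta> where d: "\<delta> > 0" and m: "ac_modulus f c d (\<epsilon> / 2) \<delta>"
    using ac unfolding abs_cont_on_iff_modulus by (meson half_gt_zero)
  have "ac_modulus (\<lambda>x. complex_of_real (variation f c x)) c d \<epsilon> \<delta>"
    unfolding ac_modulus_def
  proof (intro allI impI, elim conjE)
    fix n :: nat and u v
    assume fam: "int_family c d {..<n} u v" and s: "(\<Sum>i<n. v i - u i) < \<delta>"
    have b: "c \<le> u i" "u i \<le> v i" "v i \<le> d" if "i < n" for i
      using fam that by (auto simp: int_family_def)
    \<comment> \<open>The \<open>n\<close> approximation errors then add up to at most \<epsilon>/2,
      also for \<open>n = 0\<close>.\<close>
    define \<eta> where "\<eta> = \<epsilon> / (2 * (n + 1))"
    have eta: "\<eta> > 0" using e by (simp add: \<eta>_def)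
    have "\<exists>N a b. int_family (u i) (v i) {..<N::nat} a b \<and>
        variation f (u i) (v i) - \<eta> < (\<Sum>j<N. cmod (f (b j) - f (a j)))" if "i < n" for i
      by (rule variation_approx[OF abs_cont_on_subset[OF ac b(1)[OF that] b(3)[OF that]] eta]) blast
    then obtain N a b' where N: "\<And>i. i < n \<Longrightarrow> int_family (u i) (v i) {..<N i::nat} (a i) (b' i)"
      and approx: "\<And>i. i < n \<Longrightarrow> variation f (u i) (v i) - \<eta> < (\<Sum>j<N i. cmod (f (b' i j) - f (a i j)))"
      by metis
    define K where "K = Sigma {..<n} (\<lambda>i. {..<N i})"
    have b2: "u i \<le> a i j" "a i j \<le> b' i j" "b' i j \<le> v i" if "i < n" "j < N i" for i j
      using N[OF that(1)] that(2) by (auto simp: int_family_def)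
    have famK: "int_family c d K (\<lambda>(i, j). a i j) (\<lambda>(i, j). b' i j)"
      unfolding int_family_def
    proof (intro conjI ballI)
      show "finite K" by (simp add: K_def)
      fix p assume p: "p \<in> K"
      obtain i j where "p = (i, j)" by (cases p)
      then show "c \<le> (case p of (i, j) \<Rightarrow> a i j)" "(case p of (i, j) \<Rightarrow> a i j) \<le> (case p of (i, j) \<Rightarrow> b' i j)"
        "(case p of (i, j) \<Rightarrow> b' i j) \<le> d"
        using p b[of i] b2[of i j] by (auto simp: K_def)
    next
      have "{a i j<..<b' i j} \<inter> {a k l<..<b' k l} = {}"
        if *: "i < n" "j < N i" "k < n" "l < N k" "(i, j) \<noteq> (k, l)" for i j k l
      proof (cases "i = k")
        case True
        then show ?thesis using N[of i] * by (auto simp: int_family_def disjoint_family_on_def)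
      next
        case False
        have "{a i j<..<b' i j} \<subseteq> {u i<..<v i}" "{a k l<..<b' k l} \<subseteq> {u k<..<v k}"
          using b2[OF *(1,2)] b2[OF *(3,4)] by auto
        moreover have "{u i<..<v i} \<inter> {u k<..<v k} = {}"
          using fam * False unfolding int_family_def disjoint_family_on_def by blast
        ultimately show ?thesis by blast
      qed
      then show "disjoint_family_on (\<lambda>p. {(case p of (i, j) \<Rightarrow> a i j)<..<(case p of (i, j) \<Rightarrow> b' i j)}) K"
        unfolding disjoint_family_on_def K_def by (auto split: prod.splits)
    qed
    have len: "(\<Sum>j<N i. b' i j - a i j) \<le> v i - u i" if "i < n" for i
    proof -
      have "(\<Sum>j<N i. b' i j - a i j) \<le> measure lebesgue {u i..v i}"
      proof (rule int_family_length_le[OF N[OF that]])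
        fix j assume "j \<in> {..<N i}"
        then show "{a i j<..<b' i j} \<subseteq> {u i..v i}" using b2[OF that, of j] by auto
      qed simp
      then show ?thesis using b[OF that] by simp
    qed
    have "(\<Sum>p\<in>K. (case p of (i, j) \<Rightarrow> b' i j) - (case p of (i, j) \<Rightarrow> a i j)) = (\<Sum>i<n. \<Sum>j<N i. b' i j - a i j)"
      unfolding K_def by (subst sum.Sigma) (auto intro!: sum.cong)
    also have "\<dots> \<le> (\<Sum>i<n. v i - u i)" using len by (intro sum_mono) auto
    finally have "(\<Sum>p\<in>K. (case p of (i, j) \<Rightarrow> b' i j) - (case p of (i, j) \<Rightarrow> a i j)) < \<delta>" using s by simp
    from ac_modulusD[OF m famK this]
    have "(\<Sum>p\<in>K. cmod (f (case p of (i, j) \<Rightarrow> b' i j) - f (case p of (i, j) \<Rightarrow> a i j))) < \<epsilon> / 2" .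
    also have "(\<Sum>p\<in>K. cmod (f (case p of (i, j) \<Rightarrow> b' i j) - f (case p of (i, j) \<Rightarrow> a i j)))
        = (\<Sum>i<n. \<Sum>j<N i. cmod (f (b' i j) - f (a i j)))"
      unfolding K_def by (subst sum.Sigma) (auto intro!: sum.cong)
    finally have half: "(\<Sum>i<n. \<Sum>j<N i. cmod (f (b' i j) - f (a i j))) < \<epsilon> / 2" .
    have "(\<Sum>i<n. cmod (complex_of_real (variation f c (v i)) - complex_of_real (variation f c (u i))))
        \<le> (\<Sum>i<n. (\<Sum>j<N i. cmod (f (b' i j) - f (a i j))) + \<eta>)"
    proof (rule sum_mono)
      fix i assume "i \<in> {..<n}"
      then have i: "i < n" by simp
      have "0 \<le> variation f c (v i) - variation f c (u i)"
        using variation_diff_ge[OF ac b[OF i]] norm_ge_zero order_trans by blast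
      moreover have "variation f c (v i) - variation f c (u i) \<le> variation f (u i) (v i)"
        by (rule variation_diff_le[OF ac b[OF i]])
      ultimately show "cmod (complex_of_real (variation f c (v i)) - complex_of_real (variation f c (u i)))
          \<le> (\<Sum>j<N i. cmod (f (b' i j) - f (a i j))) + \<eta>"
        using approx[OF i] by (simp flip: of_real_diff)
    qed
    also have "\<dots> = (\<Sum>i<n. \<Sum>j<N i. cmod (f (b' i j) - f (a i j))) + n * \<eta>"
      by (simp add: sum.distrib)
    also have "n * \<eta> \<le> \<epsilon> / 2" using e by (simp add: \<eta>_def field_simps)
    also have "(\<Sum>i<n. \<Sum>j<N i. cmod (f (b' i j) - f (a i j))) + \<epsilon> / 2 < \<epsilon>" using half by simp
    finally show "(\<Sum>i<n. cmod (complex_of_real (variation f c (v i)) - complex_of_real (variation f c (u i)))) < \<epsilon>"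
      by simp
  qed
  then show "\<exists>\<delta>>0. ac_modulus (\<lambda>x. complex_of_real (variation f c x)) c d \<epsilon> \<delta>" using d by blast
qed

subsection \<open>The fundamental theorem of calculus for absolutely continuous functions\<close>

text \<open>A bounded null set lies in an open set of length below \<delta>. Countably many
  non-overlapping closed intervals inside that open set cover the null set, and the modulus of
  \<open>G\<close> bounds their total Stieltjes measure.\<close>

lemma abs_cont_mono_absolutely_continuous:
  fixes G :: "real \<Rightarrow> real"
  assumes mono: "\<And>x y. x \<le> y \<Longrightarrow> G x \<le> G y"
    and ac: "\<And>k. abs_cont_on (\<lambda>x. complex_of_real (G x)) (-k) k"
  shows "continuous_on UNIV G" "absolutely_continuous lborel (interval_measure G)"
proof -
  have "isCont G x" for x
  proof -
    have "continuous_on {- (\<bar>x\<bar> + 1)..\<bar>x\<bar> + 1} (\<lambda>x. Re (complex_of_real (G x)))"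
      by (intro continuous_on_Re abs_cont_on_imp_continuous_on[OF ac])
    then have "continuous_on {- (\<bar>x\<bar> + 1)..\<bar>x\<bar> + 1} G" by simp
    then show ?thesis by (rule continuous_on_interior) auto
  qed
  then show cont: "continuous_on UNIV G" by (simp add: continuous_at_imp_continuous_on)
  define N where "N = interval_measure G"
  have N_Icc: "emeasure N {a..b} = ennreal (G b - G a)" if "a \<le> b" for a b
    unfolding N_def by (rule emeasure_interval_measure_Icc[OF that mono cont])
  have setsN: "sets N = sets borel" by (simp add: N_def)
  have local: "emeasure N (A \<inter> {-k..k}) \<le> ennreal \<epsilon>"
    if A: "A \<in> null_sets lborel" and k: "0 < k" and e: "0 < \<epsilon>" for A k \<epsilon>
  proof -
    obtain \<delta> where d: "\<delta> > 0" and m: "ac_modulus (\<lambda>x. complex_of_real (G x)) (-k) k \<epsilon> \<delta>"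
      using ac[of k] e unfolding abs_cont_on_iff_modulus by blast
    define S where "S = A \<inter> {-k..k}"
    have "S \<in> null_sets lborel" unfolding S_def using A by (intro null_set_Int2) auto
    then have S: "S \<in> null_sets lebesgue" by (rule null_sets_completionI)
    then have "S \<in> sets lebesgue" by auto
    from sets_lebesgue_outer_open[OF this d]
    obtain U where U: "open U" "S \<subseteq> U" "U - S \<in> lmeasurable" "emeasure lebesgue (U - S) < ennreal \<delta>"
      by blast
    have "emeasure lebesgue U = emeasure lebesgue (U - S)"
      using S U(1) by (intro emeasure_Diff_null_set[symmetric]) auto
    then have Ul: "U \<in> lmeasurable" and Um: "measure lebesgue U < \<delta>"
      using U d by (auto simp: fmeasurable_def measure_def intro!: fmeasurableI enn2real_less_iff[THEN iffD2])
    have box: "box (-k) k \<noteq> {}" using k by simp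
    \<comment> \<open>Each interval of the covering contains a point of \<open>S\<close> at which it
      is subordinate to this gauge, so it lies inside \<open>U\<close>.\<close>
    have gauge: "gauge (\<lambda>x. if x \<in> S then U else UNIV)"
      using U by (auto simp: gauge_def)
    have "S \<subseteq> cbox (-k) k" by (auto simp: S_def)
    from covering_lemma[OF this box gauge]
    obtain D where D: "countable D" "\<Union>D \<subseteq> cbox (-k) k"
      "\<And>K. K \<in> D \<Longrightarrow> interior K \<noteq> {} \<and> (\<exists>c d. K = cbox c d)"
      "pairwise (\<lambda>A B. interior A \<inter> interior B = {}) D"
      "\<And>K. K \<in> D \<Longrightarrow> \<exists>x\<in>S \<inter> K. K \<subseteq> (if x \<in> S then U else UNIV)" "S \<subseteq> \<Union>D"
      by metis
    have K: "K = {Inf K..Sup K} \<and> Inf K < Sup K \<and> - k \<le> Inf K \<and> Sup K \<le> k \<and> K \<subseteq> U \<and> interior K = {Inf K<..<Sup K}"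
      if KD: "K \<in> D" for K
    proof -
      obtain c d where cd: "K = {c..d}" "{c<..<d} \<noteq> {}" using D(3)[OF KD] by auto
      then have "c < d" by simp
      moreover have "Inf K = c" "Sup K = d" using cd \<open>c < d\<close> by auto
      moreover have "{c..d} \<subseteq> {-k..k}" using D(2) KD cd(1) by (metis Sup_upper cbox_interval subset_trans)
      then have "- k \<le> c" "d \<le> k" using \<open>c < d\<close> by auto
      moreover have "K \<subseteq> U" using D(5)[OF KD] by auto
      ultimately show ?thesis using cd by simp
    qed
    \<comment> \<open>The modulus speaks about finite families only; the countable union follows by
      continuity of the measure from below.\<close>
    have fin: "emeasure N (\<Union>F) \<le> ennreal \<epsilon>" if F: "F \<subseteq> D" "finite F" for F
    proof -
      note K' = K[OF subsetD[OF F(1)]]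
      have NX: "emeasure N X = ennreal (G (Sup X) - G (Inf X))" "X \<in> sets N" if "X \<in> F" for X
      proof -
        have X: "X = {Inf X..Sup X}" "Inf X \<le> Sup X" using K'[OF that] by auto
        show "emeasure N X = ennreal (G (Sup X) - G (Inf X))" by (subst X(1)) (rule N_Icc[OF X(2)])
        show "X \<in> sets N" unfolding setsN by (subst X(1)) simp
      qed
      have fam: "int_family (-k) k F Inf Sup"
        unfolding int_family_def disjoint_family_on_def
      proof (intro conjI ballI impI)
        fix X Y assume XY: "X \<in> F" "Y \<in> F" "X \<noteq> Y"
        then have "interior X \<inter> interior Y = {}" using D(4) F by (auto simp: pairwise_def)
        then show "{Inf X<..<Sup X} \<inter> {Inf Y<..<Sup Y} = {}" using K'[OF XY(1)] K'[OF XY(2)] by metis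
      qed (use K' F in \<open>auto intro: less_imp_le\<close>)
      have "(\<Sum>K\<in>F. Sup K - Inf K) \<le> measure lebesgue U"
      proof (rule int_family_length_le[OF fam _ Ul])
        fix X assume "X \<in> F"
        then show "{Inf X<..<Sup X} \<subseteq> U" using K'[of X] interior_subset by (metis subset_trans)
      qed
      then have less: "(\<Sum>X\<in>F. cmod (complex_of_real (G (Sup X)) - complex_of_real (G (Inf X)))) < \<epsilon>"
        using ac_modulusD[OF m fam] Um by linarith
      have "emeasure N (\<Union>F) \<le> (\<Sum>X\<in>F. emeasure N X)"
      proof -
        have "emeasure N (\<Union>X\<in>F. X) \<le> (\<Sum>X\<in>F. emeasure N X)"
          using F NX by (intro emeasure_subadditive_finite) auto
        then show ?thesis by simp
      qed
      also have "\<dots> = (\<Sum>X\<in>F. ennreal (G (Sup X) - G (Inf X)))"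
        using NX by simp
      also have "\<dots> = ennreal (\<Sum>X\<in>F. G (Sup X) - G (Inf X))"
        using K' mono by (intro sum_ennreal) (simp add: less_imp_le)
      also have "\<dots> \<le> ennreal \<epsilon>"
      proof (rule ennreal_leI)
        have "(\<Sum>X\<in>F. G (Sup X) - G (Inf X)) \<le> (\<Sum>X\<in>F. cmod (complex_of_real (G (Sup X)) - complex_of_real (G (Inf X))))"
          by (intro sum_mono) (simp flip: of_real_diff)
        then show "(\<Sum>X\<in>F. G (Sup X) - G (Inf X)) \<le> \<epsilon>" using less by linarith
      qed
      finally show ?thesis .
    qed
    have "emeasure N (\<Union>D) \<le> ennreal \<epsilon>"
    proof (cases "D = {}")
      case False
      define A where "A n = \<Union>(from_nat_into D ` {..<n})" for n
      have sub: "from_nat_into D ` {..<n} \<subseteq> D" for n using from_nat_into[OF False] by auto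
      have "\<Union>D = (\<Union>n. A n)"
      proof -
        have "D = (\<Union>n. from_nat_into D ` {..<n})"
        proof (intro equalityI subsetI)
          fix X assume "X \<in> D"
          then obtain n where "X = from_nat_into D n" using range_from_nat_into[OF False D(1)] by blast
          then show "X \<in> (\<Union>n. from_nat_into D ` {..<n})" by (intro UN_I[of "Suc n"]) auto
        qed (use sub in blast)
        then show ?thesis unfolding A_def by blast
      qed
      moreover have "range A \<subseteq> sets N"
      proof -
        have "X \<in> sets N" if "X \<in> D" for X using K[OF that] setsN by (metis atLeastAtMost_borel)
        then have "A n \<in> sets N" for n using sub[of n] unfolding A_def by (intro sets.finite_Union) auto
        then show ?thesis by blast
      qed
      moreover have "incseq A" unfolding A_def incseq_def by (intro allI impI Union_mono image_mono) auto
      ultimately have "emeasure N (\<Union>D) = (SUP n. emeasure N (A n))"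
        by (simp add: SUP_emeasure_incseq)
      also have "\<dots> \<le> ennreal \<epsilon>"
        by (intro SUP_least) (auto simp: A_def intro!: fin[OF sub])
      finally show ?thesis .
    qed simp
    moreover have "\<Union>D \<in> sets N"
    proof (rule sets.countable_Union)
      show "D \<subseteq> sets N" using K setsN by (metis atLeastAtMost_borel subsetI)
    qed (rule D(1))
    ultimately show ?thesis
      using D(6) unfolding S_def by (meson emeasure_mono order_trans)
  qed
  have "A \<in> null_sets N" if A: "A \<in> null_sets lborel" for A
  proof -
    have "A \<inter> {- real (Suc n)..real (Suc n)} \<in> null_sets N" for n
    proof -
      have small: "emeasure N (A \<inter> {- real (Suc n)..real (Suc n)}) \<le> 0 + ennreal e" if "e > 0" for e
        using local[OF A _ that, of "real (Suc n)"] by simp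
      then have "emeasure N (A \<inter> {- real (Suc n)..real (Suc n)}) \<le> 0"
        using small by (metis ennreal_le_epsilon)
      then show ?thesis using A by (intro null_setsI) (auto simp: setsN)
    qed
    then have "(\<Union>n. A \<inter> {- real (Suc n)..real (Suc n)}) \<in> null_sets N" by (intro null_sets_UN) auto
    moreover have "x \<in> (\<Union>n. A \<inter> {- real (Suc n)..real (Suc n)})" if "x \<in> A" for x
    proof -
      obtain n where "\<bar>x\<bar> \<le> real n" using real_arch_simple by blast
      then show ?thesis using that by (intro UN_I[of n]) auto
    qed
    then have "(\<Union>n. A \<inter> {- real (Suc n)..real (Suc n)}) = A" by blast
    ultimately show ?thesis by simp
  qed
  then show "absolutely_continuous lborel (interval_measure G)"
    unfolding absolutely_continuous_def N_def by blast
qed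

lemma abs_cont_mono_density:
  fixes F :: "real \<Rightarrow> real"
  assumes cd: "c < d" and mono: "\<And>x y. c \<le> x \<Longrightarrow> x \<le> y \<Longrightarrow> y \<le> d \<Longrightarrow> F x \<le> F y"
    and ac: "abs_cont_on (\<lambda>x. complex_of_real (F x)) c d"
  obtains g :: "real \<Rightarrow> real" where "g absolutely_integrable_on UNIV"
    "\<And>x. c \<le> x \<Longrightarrow> x \<le> d \<Longrightarrow> F x - F c = integral {c..x} g"
proof -
  \<comment> \<open>Extension by constants: it is monotone on the whole line, as a Stieltjes measure
    requires, and the contraction lemma keeps it absolutely continuous.\<close>
  define G where "G x = F (max c (min d x))" for x
  have Gmono: "G x \<le> G y" if "x \<le> y" for x y
    unfolding G_def using that cd by (intro mono) auto
  have Gac: "abs_cont_on (\<lambda>x. complex_of_real (G x)) (-k) k" for k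
    unfolding G_def using cd
    by (intro abs_cont_on_compose_contraction[OF ac, where \<pi> = "\<lambda>x. max c (min d x)"]) auto
  note * = abs_cont_mono_absolutely_continuous[OF Gmono Gac]
  have right: "continuous (at_right a) G" for a
    using *(1) by (simp add: continuous_on_eq_continuous_within continuous_within_subset[of _ UNIV])
  obtain f where f: "f \<in> borel_measurable lborel" "density lborel f = interval_measure G"
    using sigma_finite_measure.Radon_Nikodym[OF lborel.sigma_finite_measure_axioms *(2)] by auto
  have eq: "(\<integral>\<^sup>+ y. f y * indicator {c<..x} y \<partial>lborel) = ennreal (F x - F c)" if "c \<le> x" "x \<le> d" for x
  proof -
    have "(\<integral>\<^sup>+ y. f y * indicator {c<..x} y \<partial>lborel) = emeasure (interval_measure G) {c<..x}"
      unfolding f(2)[symmetric] by (rule emeasure_density[symmetric]) (use f in auto)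
    also have "\<dots> = ennreal (G x - G c)"
      by (rule emeasure_interval_measure_Ioc[OF that(1) Gmono right])
    finally show ?thesis using that cd by (simp add: G_def min_absorb2 max_absorb2)
  qed
  \<comment> \<open>On \<open>{c<..d}\<close> the density has the finite integral
    \<open>F d - F c\<close>, so passing to real values with \<open>enn2real\<close> changes it on a
    null set only.\<close>
  define f' where "f' y = f y * indicator {c<..d} y" for y
  have f'[measurable]: "f' \<in> borel_measurable lborel" unfolding f'_def using f(1) by measurable
  have "(\<integral>\<^sup>+ y. f' y \<partial>lborel) \<noteq> \<infinity>" unfolding f'_def using eq[of d] cd by simp
  then have "AE y in lborel. f' y \<noteq> \<infinity>" by (intro nn_integral_PInf_AE) auto
  then have ae: "AE y in lborel. ennreal (enn2real (f' y)) = f' y"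
    by eventually_elim (simp add: ennreal_enn2real_if)
  define g where "g y = enn2real (f' y)" for y
  have g[measurable]: "g \<in> borel_measurable lborel" unfolding g_def by measurable
  have g0: "0 \<le> g y" for y by (simp add: g_def)
  have "(\<integral>\<^sup>+ y. ennreal (g y) \<partial>lborel) = (\<integral>\<^sup>+ y. f' y \<partial>lborel)"
    using ae unfolding g_def by (rule nn_integral_cong_AE)
  then have int: "integrable lborel g"
    using \<open>(\<integral>\<^sup>+ y. f' y \<partial>lborel) \<noteq> \<infinity>\<close> g0
    by (intro integrableI_nonneg) (auto simp: top.not_eq_extremum)
  then have abs: "g absolutely_integrable_on UNIV"
    by (simp add: set_integrable_def integrable_completion)
  have "F x - F c = integral {c..x} g" if x: "c \<le> x" "x \<le> d" for x
  proof -
    have ai: "g absolutely_integrable_on {c<..x}"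
      using abs by (rule set_integrable_subset) auto
    have "ennreal (F x - F c) = (\<integral>\<^sup>+ y. f y * indicator {c<..x} y \<partial>lborel)" using eq[OF x] by simp
    also have "\<dots> = (\<integral>\<^sup>+ y. ennreal (indicator {c<..x} y * g y) \<partial>lborel)"
    proof (rule nn_integral_cong_AE)
      show "AE y in lborel. f y * indicator {c<..x} y = ennreal (indicator {c<..x} y * g y)"
        using ae by eventually_elim (use x in \<open>auto simp: g_def f'_def indicator_def split: if_splits\<close>)
    qed
    also have "\<dots> = ennreal (\<integral>y. indicator {c<..x} y * g y \<partial>lborel)"
      using integrable_real_mult_indicator[OF _ int, of "{c<..x}"] g0
      by (intro nn_integral_eq_integral) (auto simp: mult.commute)
    finally have "F x - F c = (\<integral>y. indicator {c<..x} y * g y \<partial>lborel)"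
      using mono[of c x] x g0 by (subst (asm) ennreal_inj) (auto intro!: integral_nonneg_AE)
    also have "\<dots> = (\<integral>y. indicator {c<..x} y * g y \<partial>lebesgue)"
      by (intro integral_completion[symmetric]) measurable
    also have "\<dots> = integral {c<..x} g"
      using set_lebesgue_integral_eq_integral(2)[OF ai] by (simp add: set_lebesgue_integral_def)
    also have "\<dots> = integral {c..x} g"
    proof (rule integral_spike_set)
      show "negligible {y \<in> {c<..x} - {c..x}. g y \<noteq> 0}" by (rule negligible_subset[of "{}"]) auto
      show "negligible {y \<in> {c..x} - {c<..x}. g y \<noteq> 0}" by (rule negligible_subset[of "{c}"]) auto
    qed
    finally show ?thesis .
  qed
  with abs show ?thesis by (rule that)
qed

text \<open>\<open>integrable_ccontinuous_explicit\<close> controls difference quotients to the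
  right; those to the left come from applying it to the reflected function. The exceptional set does
  not depend on the base point \<open>c\<close>.\<close>

lemma indefinite_integral_has_vector_derivative_AE:
  fixes g :: "real \<Rightarrow> 'b::euclidean_space"
  assumes int: "\<And>a b. g integrable_on {a..b}"
  obtains N where "negligible N"
    "\<And>c x. x \<notin> N \<Longrightarrow> c < x \<Longrightarrow> ((\<lambda>y. integral {c..y} g) has_vector_derivative g x) (at x)"
proof -
  obtain N1 where N1: "negligible N1"
    "\<And>x e. x \<notin> N1 \<Longrightarrow> 0 < e \<Longrightarrow> \<exists>d>0. \<forall>h. 0 < h \<and> h < d \<longrightarrow> norm (integral {x..x + h} g /\<^sub>R h - g x) < e"
    using integrable_ccontinuous_explicit[of g] int by auto
  have int': "(\<lambda>x. g (- x)) integrable_on cbox a b" for a b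
  proof -
    have "(\<lambda>x. g (- x)) integrable_on {- (- a).. - (- b)}"
      by (rule iffD2[OF Henstock_Kurzweil_Integration.integrable_reflect_real]) (rule int)
    then show ?thesis by simp
  qed
  obtain N2 where N2: "negligible N2"
    "\<And>x e. x \<notin> N2 \<Longrightarrow> 0 < e \<Longrightarrow> \<exists>d>0. \<forall>h. 0 < h \<and> h < d \<longrightarrow> norm (integral {x..x + h} (\<lambda>x. g (- x)) /\<^sub>R h - g (- x)) < e"
    using integrable_ccontinuous_explicit[of "\<lambda>x. g (- x)"] int' by auto
  have "negligible (uminus ` N2)"
    using N2(1) by (intro negligible_differentiable_image_negligible) (auto intro!: derivative_intros)
  then have neg: "negligible (N1 \<union> uminus ` N2)" using N1(1) by (simp add: negligible_Un)
  have "((\<lambda>y. integral {c..y} g) has_vector_derivative g x) (at x)"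
    if x: "x \<notin> N1 \<union> uminus ` N2" and c: "c < x" for c x
    unfolding has_vector_derivative_def has_derivative_at_alt
  proof (intro conjI allI impI)
    show "bounded_linear (\<lambda>y. y *\<^sub>R g x)" by (rule bounded_linear_scaleR_left)
    fix e :: real assume e: "0 < e"
    have "- x \<notin> N2" using x by force
    then obtain d1 d2 where d: "d1 > 0" "d2 > 0"
      and d1: "\<And>h. 0 < h \<Longrightarrow> h < d1 \<Longrightarrow> norm (integral {x..x + h} g /\<^sub>R h - g x) < e"
      and d2: "\<And>h. 0 < h \<Longrightarrow> h < d2 \<Longrightarrow> norm (integral {- x..- x + h} (\<lambda>x. g (- x)) /\<^sub>R h - g x) < e"
      using N1(2)[of x e] N2(2)[of "-x" e] x e by force
    have scale: "norm (A - h *\<^sub>R g x) \<le> e * h" if "0 < h" "norm (A /\<^sub>R h - g x) < e" for A h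
    proof -
      have "A - h *\<^sub>R g x = h *\<^sub>R (A /\<^sub>R h - g x)" using that(1) by (simp add: scaleR_diff_right)
      then have "norm (A - h *\<^sub>R g x) = h * norm (A /\<^sub>R h - g x)" using that(1) by simp
      also have "\<dots> \<le> h * e" using that by (intro mult_left_mono) auto
      finally show ?thesis by (simp add: mult.commute)
    qed
    have "norm (integral {c..y} g - integral {c..x} g - (y - x) *\<^sub>R g x) \<le> e * norm (y - x)"
      if y: "norm (y - x) < min (min d1 d2) (x - c)" for y
    proof -
      consider "y = x" | "x < y" | "y < x" by linarith
      then show ?thesis
      proof cases
        case 2
        have "integral {c..x} g + integral {x..y} g = integral {c..y} g"
          using 2 c int by (intro Henstock_Kurzweil_Integration.integral_combine) auto
        then have "integral {c..y} g - integral {c..x} g = integral {x..x + (y - x)} g"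
          by (simp add: algebra_simps)
        moreover have "norm (integral {x..x + (y - x)} g - (y - x) *\<^sub>R g x) \<le> e * (y - x)"
          using 2 y by (intro scale d1) auto
        ultimately show ?thesis using 2 by simp
      next
        case 3
        have "integral {c..y} g + integral {y..x} g = integral {c..x} g"
          using 3 c y int by (intro Henstock_Kurzweil_Integration.integral_combine) auto
        moreover have "integral {- x..- x + (x - y)} (\<lambda>x. g (- x)) = integral {y..x} g"
          using Henstock_Kurzweil_Integration.integral_reflect_real[of x y g] by (simp del: Henstock_Kurzweil_Integration.integral_reflect_real)
        ultimately have "integral {c..y} g - integral {c..x} g - (y - x) *\<^sub>R g x
            = - (integral {- x..- x + (x - y)} (\<lambda>x. g (- x)) - (x - y) *\<^sub>R g x)"
          by (simp add: algebra_simps)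
        moreover have "norm (integral {- x..- x + (x - y)} (\<lambda>x. g (- x)) - (x - y) *\<^sub>R g x) \<le> e * (x - y)"
          using 3 y by (intro scale d2) auto
        ultimately show ?thesis using 3 by (metis abs_minus_commute abs_of_pos diff_gt_0_iff_gt norm_minus_cancel real_norm_def)
      qed simp
    qed
    then show "\<exists>d>0. \<forall>y. norm (y - x) < d \<longrightarrow>
        norm (integral {c..y} g - integral {c..x} g - (y - x) *\<^sub>R g x) \<le> e * norm (y - x)"
      using d c by (intro exI[of _ "min (min d1 d2) (x - c)"]) auto
  qed
  with neg show ?thesis by (rule that)
qed

text \<open>With \<open>V\<close> the variation, the real part is \<open>V - (V - Re f)\<close> and
  the imaginary part \<open>V - (V - Im f)\<close>. All three functions \<open>V\<close>,
  \<open>V - Re f\<close>, \<open>V - Im f\<close> are monotone and absolutely continuous, hence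
  integrals of densities.\<close>

proposition abs_cont_on_FTC:
  assumes ac: "abs_cont_on f c d" and cd: "c < d"
  obtains g N where "g absolutely_integrable_on UNIV"
    "\<And>x. c \<le> x \<Longrightarrow> x \<le> d \<Longrightarrow> f x - f c = integral {c..x} g" "negligible N"
    "\<And>x. c < x \<Longrightarrow> x < d \<Longrightarrow> x \<notin> N \<Longrightarrow> (f has_vector_derivative g x) (at x)"
proof -
  define V where "V = variation f c"
  have V: "cmod (f y - f x) \<le> V y - V x" if "c \<le> x" "x \<le> y" "y \<le> d" for x y
    unfolding V_def using variation_diff_ge[OF ac that] .
  have acV: "abs_cont_on (\<lambda>x. complex_of_real (V x)) c d"
    unfolding V_def by (rule abs_cont_on_variation[OF ac])
  obtain g1 where g1: "g1 absolutely_integrable_on UNIV"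
    "\<And>x. c \<le> x \<Longrightarrow> x \<le> d \<Longrightarrow> V x - V c = integral {c..x} g1"
  proof (rule abs_cont_mono_density[OF cd _ acV])
    show "V x \<le> V y" if "c \<le> x" "x \<le> y" "y \<le> d" for x y
      using V[OF that] norm_ge_zero[of "f y - f x"] by linarith
  qed blast
  obtain g2 where g2: "g2 absolutely_integrable_on UNIV"
    "\<And>x. c \<le> x \<Longrightarrow> x \<le> d \<Longrightarrow> (V x - Re (f x)) - (V c - Re (f c)) = integral {c..x} g2"
  proof (rule abs_cont_mono_density[OF cd, of "\<lambda>x. V x - Re (f x)"])
    show "V x - Re (f x) \<le> V y - Re (f y)" if "c \<le> x" "x \<le> y" "y \<le> d" for x y
      using V[OF that] complex_Re_le_cmod[of "f y - f x"] by simp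
    show "abs_cont_on (\<lambda>x. complex_of_real (V x - Re (f x))) c d"
      using abs_cont_on_diff[OF acV abs_cont_on_Re[OF ac]] by simp
  qed blast
  obtain g3 where g3: "g3 absolutely_integrable_on UNIV"
    "\<And>x. c \<le> x \<Longrightarrow> x \<le> d \<Longrightarrow> (V x - Im (f x)) - (V c - Im (f c)) = integral {c..x} g3"
  proof (rule abs_cont_mono_density[OF cd, of "\<lambda>x. V x - Im (f x)"])
    show "V x - Im (f x) \<le> V y - Im (f y)" if "c \<le> x" "x \<le> y" "y \<le> d" for x y
      using V[OF that] abs_Im_le_cmod[of "f y - f x"] by simp
    show "abs_cont_on (\<lambda>x. complex_of_real (V x - Im (f x))) c d"
      using abs_cont_on_diff[OF acV abs_cont_on_Im[OF ac]] by simp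
  qed blast
  define gr where "gr x = g1 x - g2 x" for x
  define gi where "gi x = g1 x - g3 x" for x
  define g where "g x = complex_of_real (gr x) + \<i> * complex_of_real (gi x)" for x
  have gr: "gr absolutely_integrable_on UNIV" and gi: "gi absolutely_integrable_on UNIV"
    unfolding gr_def gi_def using g1(1) g2(1) g3(1) by (auto intro: set_integral_diff(1))
  have g: "g absolutely_integrable_on UNIV"
    unfolding g_def using gr gi
    by (intro set_integral_add(1) set_integrable_mult_right)
       (simp_all add: set_integrable_def complex_of_real_integrable_eq flip: scaleR_conv_of_real of_real_mult)
  have ints: "h integrable_on {a..b}" if "h absolutely_integrable_on (UNIV :: real set)" for h :: "real \<Rightarrow> 'x::euclidean_space" and a b
    using set_integrable_subset[OF that, of "{a..b}"] by (simp add: set_lebesgue_integral_eq_integral(1))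
  have eq: "f x - f c = integral {c..x} g" if x: "c \<le> x" "x \<le> d" for x
  proof -
    have "Re (f x - f c) = integral {c..x} gr"
      unfolding gr_def using g1(2)[OF x] g2(2)[OF x] ints[OF g1(1)] ints[OF g2(1)]
      by (subst Henstock_Kurzweil_Integration.integral_diff) auto
    moreover have "Im (f x - f c) = integral {c..x} gi"
      unfolding gi_def using g1(2)[OF x] g3(2)[OF x] ints[OF g1(1)] ints[OF g3(1)]
      by (subst Henstock_Kurzweil_Integration.integral_diff) auto
    moreover have "(g has_integral (complex_of_real (integral {c..x} gr) + \<i> * complex_of_real (integral {c..x} gi))) {c..x}"
      unfolding g_def
      by (intro has_integral_add has_integral_mult_right has_integral_of_real integrable_integral ints gr gi)
    ultimately show ?thesis
      by (simp add: integral_unique complex_eq_iff)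
  qed
  obtain N where N: "negligible N"
    "\<And>c x. x \<notin> N \<Longrightarrow> c < x \<Longrightarrow> ((\<lambda>y. integral {c..y} g) has_vector_derivative g x) (at x)"
    using indefinite_integral_has_vector_derivative_AE[OF ints[OF g]] by metis
  have "(f has_vector_derivative g x) (at x)" if x: "c < x" "x < d" "x \<notin> N" for x
  proof -
    have "((\<lambda>y. f c + integral {c..y} g) has_vector_derivative 0 + g x) (at x)"
      by (intro has_vector_derivative_add has_vector_derivative_const N(2) x)
    then have "((\<lambda>y. f c + integral {c..y} g) has_vector_derivative g x) (at x)" by simp
    then show ?thesis
      by (rule has_vector_derivative_transform_within_open[where S = "{c<..<d}"])
         (use x in \<open>auto simp: eq[symmetric] less_imp_le\<close>)
  qed
  with g eq N(1) show ?thesis by (rule that)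
qed

subsection \<open>Locally absolutely continuous functions\<close>

lemma AC_locI: "(\<And>c d. c \<le> d \<Longrightarrow> {c..d} \<subseteq> I \<Longrightarrow> abs_cont_on f c d) \<Longrightarrow> f \<in> AC_loc I"
  by (simp add: AC_loc_def)

lemma AC_locD: "f \<in> AC_loc I \<Longrightarrow> c \<le> d \<Longrightarrow> {c..d} \<subseteq> I \<Longrightarrow> abs_cont_on f c d"
  by (simp add: AC_loc_def)

lemma AC_loc_add: "f \<in> AC_loc I \<Longrightarrow> g \<in> AC_loc I \<Longrightarrow> (\<lambda>x. f x + g x) \<in> AC_loc I"
  by (simp add: AC_loc_def abs_cont_on_add)

lemma AC_loc_diff: "f \<in> AC_loc I \<Longrightarrow> g \<in> AC_loc I \<Longrightarrow> (\<lambda>x. f x - g x) \<in> AC_loc I"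
  by (simp add: AC_loc_def abs_cont_on_diff)

lemma AC_loc_mult: "f \<in> AC_loc I \<Longrightarrow> g \<in> AC_loc I \<Longrightarrow> (\<lambda>x. f x * g x) \<in> AC_loc I"
  by (simp add: AC_loc_def abs_cont_on_mult)

lemma AC_loc_const: "(\<lambda>_. k) \<in> AC_loc I"
  by (intro AC_locI abs_cont_on_const)

lemma AC_loc_cnj: "f \<in> AC_loc I \<Longrightarrow> (\<lambda>x. cnj (f x)) \<in> AC_loc I"
  by (simp add: AC_loc_def abs_cont_on_cnj)

lemma AC_loc_cong:
  assumes "f \<in> AC_loc I" "\<And>x. x \<in> I \<Longrightarrow> f x = g x"
  shows "g \<in> AC_loc I"
proof (rule AC_locI)
  fix c d :: real assume cd: "c \<le> d" "{c..d} \<subseteq> I"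
  show "abs_cont_on g c d"
  proof (rule abs_cont_on_dominated[of f c d f 1 0])
    fix u v assume "c \<le> u" "u \<le> v" "v \<le> d"
    then have "u \<in> I" "v \<in> I" using cd by auto
    then show "cmod (g v - g u) \<le> 1 * cmod (f v - f u) + 0 * cmod (f v - f u)"
      using assms(2) by simp
  qed (use AC_locD[OF assms(1) cd] in auto)
qed

lemma AC_loc_continuous_on:
  assumes f: "f \<in> AC_loc I" and I: "open I"
  shows "continuous_on I f"
proof -
  have "isCont f x" if x: "x \<in> I" for x
  proof -
    obtain e where e: "e > 0" "cball x e \<subseteq> I" using I x open_contains_cball by blast
    then have "abs_cont_on f (x - e) (x + e)" by (intro AC_locD[OF f]) (auto simp: cball_eq_atLeastAtMost)
    then have "continuous_on {x - e..x + e} f" by (rule abs_cont_on_imp_continuous_on)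
    then show ?thesis by (rule continuous_on_interior) (use e in simp)
  qed
  then show ?thesis by (simp add: continuous_at_imp_continuous_on)
qed

text \<open>Bridge between the \<open>AE\<close> quantifier of the definitions and the negligible
  exceptional sets of the gauge integral, in which the fundamental theorem and the Lagrange identity
  are stated.\<close>

lemma AE_lebesgue_on_iff_negligible:
  assumes "S \<in> sets lebesgue"
  shows "(AE x in lebesgue_on S. P x) \<longleftrightarrow> negligible {x \<in> S. \<not> P x}"
proof -
  have "(AE x in lebesgue_on S. P x) \<longleftrightarrow> (AE x in lebesgue. x \<in> S \<longrightarrow> P x)"
    using assms by (simp add: AE_restrict_space_iff)
  also have "\<dots> \<longleftrightarrow> {x. \<not> (x \<in> S \<longrightarrow> P x)} \<in> null_sets lebesgue"
    by (simp add: completion.AE_iff_null_sets)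
  also have "{x. \<not> (x \<in> S \<longrightarrow> P x)} = {x \<in> S. \<not> P x}" by auto
  finally show ?thesis by (simp add: negligible_iff_null_sets)
qed

lemma AC_loc_AE_has_vector_derivative:
  assumes f: "f \<in> AC_loc I" and I: "open I"
  shows "AE x in lebesgue_on I. (f has_vector_derivative vector_derivative f (at x)) (at x)"
proof -
  define D where "D x \<longleftrightarrow> (f has_vector_derivative vector_derivative f (at x)) (at x)" for x
  have ex: "\<exists>N. negligible N \<and> (\<forall>x. c < x \<and> x < d \<and> x \<notin> N \<longrightarrow> D x)"
    if cd: "c < d" "{c..d} \<subseteq> I" for c d
  proof -
    obtain g N where *: "negligible N"
      "\<And>x. c < x \<Longrightarrow> x < d \<Longrightarrow> x \<notin> N \<Longrightarrow> (f has_vector_derivative g x) (at x)"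
      using abs_cont_on_FTC[OF AC_locD[OF f less_imp_le[OF cd(1)] cd(2)] cd(1)] by metis
    have "D x" if "c < x" "x < d" "x \<notin> N" for x
      unfolding D_def using *(2)[OF that] vector_derivative_at by metis
    then show ?thesis using *(1) by blast
  qed
  \<comment> \<open>Countably many rational intervals exhaust \<open>I\<close>, so their exceptional
    sets still have a negligible union.\<close>
  define P where "P = {p :: real \<times> real. fst p \<in> \<rat> \<and> snd p \<in> \<rat> \<and> fst p < snd p \<and> {fst p..snd p} \<subseteq> I}"
  have "\<forall>p\<in>P. \<exists>N. negligible N \<and> (\<forall>x. fst p < x \<and> x < snd p \<and> x \<notin> N \<longrightarrow> D x)"
    using ex by (simp add: P_def)
  then obtain N where N: "\<forall>p\<in>P. negligible (N p) \<and> (\<forall>x. fst p < x \<and> x < snd p \<and> x \<notin> N p \<longrightarrow> D x)"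
    by (rule bchoice[THEN exE])
  have "P \<subseteq> \<rat> \<times> \<rat>" by (auto simp: P_def)
  then have "countable P" by (rule countable_subset) (simp add: countable_rat)
  then have neg: "negligible (\<Union>(N ` P))"
    using N by (intro negligible_countable_Union) auto
  have "{x \<in> I. \<not> D x} \<subseteq> \<Union>(N ` P)"
  proof safe
    fix x assume x: "x \<in> I" "\<not> D x"
    obtain e where e: "e > 0" "cball x e \<subseteq> I" using I x open_contains_cball by blast
    obtain c where c: "c \<in> \<rat>" "x - e < c" "c < x" using Rats_dense_in_real[of "x - e" x] e by auto
    obtain d where d: "d \<in> \<rat>" "x < d" "d < x + e" using Rats_dense_in_real[of x "x + e"] e by auto
    have sub: "{c..d} \<subseteq> I" using e(2) c d by (auto simp: cball_eq_atLeastAtMost)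
    then have P: "(c, d) \<in> P" using c d by (simp add: P_def)
    have "x \<in> N (c, d)" using bspec[OF N P] c d x by auto
    then show "x \<in> \<Union>(N ` P)" using P by blast
  qed
  then show ?thesis
    using negligible_subset[OF neg] I by (subst AE_lebesgue_on_iff_negligible) (auto simp: D_def)
qed

text \<open>\<open>vector_derivative\<close> is an arbitrary value where \<open>f\<close> is not
  differentiable; such points form a null set and do not affect the integral.\<close>

proposition AC_loc_FTC:
  assumes f: "f \<in> AC_loc I" and cd: "c \<le> d" "{c..d} \<subseteq> I"
  shows "((\<lambda>x. vector_derivative f (at x)) has_integral (f d - f c)) {c..d}"
proof (cases "c = d")
  case False
  then have "c < d" using cd by simp
  obtain g N where *: "g absolutely_integrable_on UNIV" "negligible N"
      "\<And>x. c \<le> x \<Longrightarrow> x \<le> d \<Longrightarrow> f x - f c = integral {c..x} g"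
      "\<And>x. c < x \<Longrightarrow> x < d \<Longrightarrow> x \<notin> N \<Longrightarrow> (f has_vector_derivative g x) (at x)"
    using abs_cont_on_FTC[OF AC_locD[OF f cd] \<open>c < d\<close>] by metis
  have "g absolutely_integrable_on {c..d}" using *(1) by (rule set_integrable_subset) auto
  then have "g integrable_on {c..d}" by (simp add: set_lebesgue_integral_eq_integral(1))
  then have "(g has_integral (f d - f c)) {c..d}" using *(3)[of d] cd by (simp add: has_integral_integral)
  then show ?thesis
  proof (rule has_integral_spike[of "N \<union> {c, d}", rotated 2])
    show "negligible (N \<union> {c, d})" using *(2) by simp
    fix x assume "x \<in> {c..d} - (N \<union> {c, d})"
    then show "vector_derivative f (at x) = g x" by (intro vector_derivative_at *(4)) auto
  qed
qed (simp add: has_integral_refl)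

text \<open>The glued function equals \<open>f (min x c) + g (max x c) - f c\<close>, a combination
  of two functions composed with clamping maps.\<close>

lemma AC_loc_glue:
  assumes I: "is_interval I" "c \<in> I" and f: "f \<in> AC_loc I" and g: "g \<in> AC_loc I" and eq: "f c = g c"
  shows "(\<lambda>x. if x \<le> c then f x else g x) \<in> AC_loc I"
proof (rule AC_locI)
  fix A B :: real assume AB: "A \<le> B" "{A..B} \<subseteq> I"
  define A' where "A' = min A c"
  define B' where "B' = max B c"
  have "A' \<in> I" "B' \<in> I" using AB I(2) by (auto simp: A'_def B'_def min_def max_def)
  then have sub: "{A'..B'} \<subseteq> I" using I(1) by (meson atLeastAtMost_iff mem_is_interval_1_I subsetI)
  have "A' \<le> B'" by (auto simp: A'_def B'_def)
  note ac = AC_locD[OF f this sub] AC_locD[OF g this sub]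
  have "abs_cont_on (\<lambda>x. f (min x c)) A B"
    by (rule abs_cont_on_compose_contraction[OF ac(1), where \<pi> = "\<lambda>x. min x c"]) (auto simp: A'_def B'_def min_def max_def)
  moreover have "abs_cont_on (\<lambda>x. g (max x c)) A B"
    by (rule abs_cont_on_compose_contraction[OF ac(2), where \<pi> = "\<lambda>x. max x c"]) (auto simp: A'_def B'_def min_def max_def)
  ultimately have "abs_cont_on (\<lambda>x. f (min x c) + g (max x c) - f c) A B"
    by (rule abs_cont_on_diff[OF abs_cont_on_add abs_cont_on_const])
  moreover have "(\<lambda>x. f (min x c) + g (max x c) - f c) = (\<lambda>x. if x \<le> c then f x else g x)"
    using eq by (auto simp: fun_eq_iff min_def max_def)
  ultimately show "abs_cont_on (\<lambda>x. if x \<le> c then f x else g x) A B" by simp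
qed

subsection \<open>The differential expression as a first-order system\<close>

lemma negligible_open_subset_imp_empty:
  fixes S :: "real set"
  assumes "negligible N" "S \<subseteq> N" "open S"
  shows "S = {}"
  using assms negligible_subset open_not_negligible by blast

lemma AE_eq_imp_eq_on_open:
  fixes f g :: "real \<Rightarrow> complex"
  assumes I: "open I" and f: "continuous_on I f" and g: "continuous_on I g"
    and ae: "AE x in lebesgue_on I. f x = g x" and x: "x \<in> I"
  shows "f x = g x"
proof -
  have "open ((\<lambda>x. f x - g x) -` (- {0}) \<inter> I)"
    using continuous_on_diff[OF f g] I continuous_on_open_vimage by blast
  moreover have "(\<lambda>x. f x - g x) -` (- {0}) \<inter> I = {x \<in> I. f x \<noteq> g x}" by auto
  ultimately have "open {x \<in> I. f x \<noteq> g x}" by simp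
  moreover have "negligible {x \<in> I. f x \<noteq> g x}"
    using ae I by (simp add: AE_lebesgue_on_iff_negligible)
  ultimately have "{x \<in> I. f x \<noteq> g x} = {}" by (intro negligible_open_subset_imp_empty) auto
  then show ?thesis using x by blast
qed

locale sturm_liouville =
  fixes \<tau> :: sl_data
  assumes sl: "sl_expression \<tau>"
begin

abbreviation "I \<equiv> ival \<tau>"

abbreviation ae_I :: "(real \<Rightarrow> bool) \<Rightarrow> bool" where
  "ae_I P \<equiv> AE x in lebesgue_on I. P x"

lemma open_ival [simp]: "open I"
  by (simp add: ival_def)

lemma sets_ival [simp]: "I \<in> sets lebesgue"
  using open_ival by auto

lemma is_interval_ival: "is_interval I"
  unfolding ival_def einterval_def is_interval_1
  by (auto intro: less_le_trans le_less_trans simp flip: ereal_less_eq(3))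

lemma Icc_subset_ival: "x \<in> I \<Longrightarrow> y \<in> I \<Longrightarrow> {x..y} \<subseteq> I"
  using is_interval_ival by (meson atLeastAtMost_iff mem_is_interval_1_I subsetI)

lemma ae_r_pos: "ae_I (\<lambda>x. 0 < rc \<tau> x)" and ae_p_nz: "ae_I (\<lambda>x. pc \<tau> x \<noteq> 0)"
  using sl by (auto simp: sl_expression_def)

lemma ae_in_ival: "ae_I (\<lambda>x. x \<in> I)"
  by (rule AE_I2) simp

text \<open>The expression \<open>\<tau>f = h\<close> with quasi-derivative \<open>g\<close>, solved for the derivatives of \<open>f\<close> and \<open>g\<close>.\<close>

definition sys :: "(real \<Rightarrow> complex) \<Rightarrow> (real \<Rightarrow> complex) \<Rightarrow> (real \<Rightarrow> complex) \<Rightarrow> bool" where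
  "sys f g h \<longleftrightarrow> f \<in> AC_loc I \<and> g \<in> AC_loc I \<and>
     ae_I (\<lambda>x. (f has_vector_derivative g x / of_real (pc \<tau> x) - of_real (sc \<tau> x) * f x) (at x)) \<and>
     ae_I (\<lambda>x. (g has_vector_derivative
        of_real (sc \<tau> x) * g x + of_real (qc \<tau> x) * f x - of_real (rc \<tau> x) * h x) (at x))"

lemma sys_of_D_tau:
  assumes "f \<in> D_tau \<tau>"
  shows "sys f (quasi_deriv \<tau> f) (tau \<tau> f)"
proof -
  have f: "f \<in> AC_loc I" and "\<exists>g. is_quasi_deriv \<tau> f g" using assms by (auto simp: D_tau_def)
  then have "is_quasi_deriv \<tau> f (quasi_deriv \<tau> f)" unfolding quasi_deriv_def by (metis someI_ex)
  then have g: "quasi_deriv \<tau> f \<in> AC_loc I" and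
    eq: "ae_I (\<lambda>x. quasi_deriv \<tau> f x = of_real (pc \<tau> x) * (vector_derivative f (at x) + of_real (sc \<tau> x) * f x))"
    by (auto simp: is_quasi_deriv_def)
  have "ae_I (\<lambda>x. (f has_vector_derivative quasi_deriv \<tau> f x / of_real (pc \<tau> x) - of_real (sc \<tau> x) * f x) (at x))"
    using AC_loc_AE_has_vector_derivative[OF f open_ival] eq ae_p_nz by eventually_elim simp
  moreover have "ae_I (\<lambda>x. (quasi_deriv \<tau> f has_vector_derivative
        of_real (sc \<tau> x) * quasi_deriv \<tau> f x + of_real (qc \<tau> x) * f x - of_real (rc \<tau> x) * tau \<tau> f x) (at x))"
    using AC_loc_AE_has_vector_derivative[OF g open_ival] ae_r_pos
    by eventually_elim (simp add: tau_def)
  ultimately show ?thesis using f g by (simp add: sys_def)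
qed

text \<open>The derivative of \<open>f\<close> fixes \<open>g / p\<close> almost everywhere, hence
  \<open>g\<close> everywhere by continuity. The derivative of \<open>g\<close> then fixes
  \<open>r h\<close> almost everywhere, and no more than that can be said about
  \<open>h\<close>.\<close>

lemma sys_unique:
  assumes s: "sys f g h" and s': "sys f g' h'"
  shows "\<And>x. x \<in> I \<Longrightarrow> g x = g' x" "ae_I (\<lambda>x. h x = h' x)"
proof -
  have ae: "ae_I (\<lambda>x. g x = g' x)"
  proof -
    have "ae_I (\<lambda>x. (f has_vector_derivative g x / of_real (pc \<tau> x) - of_real (sc \<tau> x) * f x) (at x))"
      "ae_I (\<lambda>x. (f has_vector_derivative g' x / of_real (pc \<tau> x) - of_real (sc \<tau> x) * f x) (at x))"
      using s s' by (auto simp: sys_def)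
    with ae_p_nz show ?thesis
    proof eventually_elim
      case (elim x)
      from vector_derivative_unique_at[OF elim(2,3)] elim(1) show ?case by simp
    qed
  qed
  show eq: "g x = g' x" if "x \<in> I" for x
    using s s' AC_loc_continuous_on[OF _ open_ival] that
    by (intro AE_eq_imp_eq_on_open[OF open_ival _ _ ae]) (auto simp: sys_def)
  have "ae_I (\<lambda>x. (g has_vector_derivative
        of_real (sc \<tau> x) * g x + of_real (qc \<tau> x) * f x - of_real (rc \<tau> x) * h x) (at x))"
    "ae_I (\<lambda>x. (g' has_vector_derivative
        of_real (sc \<tau> x) * g' x + of_real (qc \<tau> x) * f x - of_real (rc \<tau> x) * h' x) (at x))"
    using s s' by (auto simp: sys_def)
  with ae_r_pos ae_in_ival show "ae_I (\<lambda>x. h x = h' x)"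
  proof eventually_elim
    case (elim x)
    have "(g' has_vector_derivative
        of_real (sc \<tau> x) * g x + of_real (qc \<tau> x) * f x - of_real (rc \<tau> x) * h x) (at x)"
      using elim(3) open_ival elim(2) eq by (rule has_vector_derivative_transform_within_open)
    from vector_derivative_unique_at[OF this elim(4)] elim(1) eq[OF elim(2)] show ?case by simp
  qed
qed

text \<open>The way back from the first-order system: it identifies the \<open>SOME\<close>-defined
  \<open>quasi_deriv\<close> with an explicitly computed one, for instance that of a linear
  combination, a conjugate or a glued function. The identification holds on \<open>I\<close>
  only.\<close>

lemma sys_imp_D_tau:
  assumes s: "sys f g h"
  shows "f \<in> D_tau \<tau>" "\<And>x. x \<in> I \<Longrightarrow> quasi_deriv \<tau> f x = g x" "ae_I (\<lambda>x. tau \<tau> f x = h x)"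
proof -
  have "ae_I (\<lambda>x. (f has_vector_derivative g x / of_real (pc \<tau> x) - of_real (sc \<tau> x) * f x) (at x))"
    using s by (auto simp: sys_def)
  then have "ae_I (\<lambda>x. g x = of_real (pc \<tau> x) * (vector_derivative f (at x) + of_real (sc \<tau> x) * f x))"
    using ae_p_nz by eventually_elim (simp add: vector_derivative_at)
  then have "is_quasi_deriv \<tau> f g" using s by (auto simp: is_quasi_deriv_def sys_def)
  then show D: "f \<in> D_tau \<tau>" using s by (auto simp: D_tau_def sys_def)
  show "\<And>x. x \<in> I \<Longrightarrow> quasi_deriv \<tau> f x = g x" "ae_I (\<lambda>x. tau \<tau> f x = h x)"
    using sys_unique[OF sys_of_D_tau[OF D] s] by auto
qed

lemma sys_cong_ae:
  assumes "sys f g h" "ae_I (\<lambda>x. h x = h' x)"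
  shows "sys f g h'"
proof -
  have "ae_I (\<lambda>x. (g has_vector_derivative
        of_real (sc \<tau> x) * g x + of_real (qc \<tau> x) * f x - of_real (rc \<tau> x) * h x) (at x))"
    using assms by (auto simp: sys_def)
  then have "ae_I (\<lambda>x. (g has_vector_derivative
        of_real (sc \<tau> x) * g x + of_real (qc \<tau> x) * f x - of_real (rc \<tau> x) * h' x) (at x))"
    using assms(2) by eventually_elim simp
  then show ?thesis using assms(1) by (simp add: sys_def)
qed

lemma sys_cong:
  assumes s: "sys f g h" and eq: "\<And>x. x \<in> I \<Longrightarrow> f x = f' x"
  shows "sys f' g h"
proof -
  have ae: "ae_I (\<lambda>x. (f has_vector_derivative g x / of_real (pc \<tau> x) - of_real (sc \<tau> x) * f x) (at x))"
     "ae_I (\<lambda>x. (g has_vector_derivative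
        of_real (sc \<tau> x) * g x + of_real (qc \<tau> x) * f x - of_real (rc \<tau> x) * h x) (at x))"
    using s by (auto simp: sys_def)
  have "ae_I (\<lambda>x. (f' has_vector_derivative g x / of_real (pc \<tau> x) - of_real (sc \<tau> x) * f' x) (at x))"
    using ae(1) ae_in_ival
  proof eventually_elim
    case (elim x)
    show ?case
      using has_vector_derivative_transform_within_open[OF elim(1) open_ival elim(2) eq] eq[OF elim(2)] by simp
  qed
  moreover have "ae_I (\<lambda>x. (g has_vector_derivative
        of_real (sc \<tau> x) * g x + of_real (qc \<tau> x) * f' x - of_real (rc \<tau> x) * h x) (at x))"
    using ae(2) ae_in_ival by eventually_elim (simp add: eq)
  ultimately show ?thesis using s AC_loc_cong[OF _ eq] by (auto simp: sys_def)
qed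

lemma sys_lincomb:
  assumes s: "sys f g h" and s': "sys f' g' h'"
  shows "sys (\<lambda>x. a * f x + b * f' x) (\<lambda>x. a * g x + b * g' x) (\<lambda>x. a * h x + b * h' x)"
proof -
  have ae: "ae_I (\<lambda>x. (f has_vector_derivative g x / of_real (pc \<tau> x) - of_real (sc \<tau> x) * f x) (at x))"
     "ae_I (\<lambda>x. (g has_vector_derivative
        of_real (sc \<tau> x) * g x + of_real (qc \<tau> x) * f x - of_real (rc \<tau> x) * h x) (at x))"
     "ae_I (\<lambda>x. (f' has_vector_derivative g' x / of_real (pc \<tau> x) - of_real (sc \<tau> x) * f' x) (at x))"
     "ae_I (\<lambda>x. (g' has_vector_derivative
        of_real (sc \<tau> x) * g' x + of_real (qc \<tau> x) * f' x - of_real (rc \<tau> x) * h' x) (at x))"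
    using s s' by (auto simp: sys_def)
  have lin: "((\<lambda>x. a * u x + b * v x) has_vector_derivative a * u' + b * v') (at x)"
    if "(u has_vector_derivative u') (at x)" "(v has_vector_derivative v') (at x)" for u v :: "real \<Rightarrow> complex" and u' v' x
    using that by (intro has_vector_derivative_add has_vector_derivative_mult_right)
  have "ae_I (\<lambda>x. ((\<lambda>x. a * f x + b * f' x) has_vector_derivative
      (a * g x + b * g' x) / of_real (pc \<tau> x) - of_real (sc \<tau> x) * (a * f x + b * f' x)) (at x))"
    using ae(1,3)
  proof eventually_elim
    case (elim x)
    from lin[OF elim] show ?case by (simp add: algebra_simps add_divide_distrib)
  qed
  moreover have "ae_I (\<lambda>x. ((\<lambda>x. a * g x + b * g' x) has_vector_derivative
      of_real (sc \<tau> x) * (a * g x + b * g' x) + of_real (qc \<tau> x) * (a * f x + b * f' x)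
        - of_real (rc \<tau> x) * (a * h x + b * h' x)) (at x))"
    using ae(2,4)
  proof eventually_elim
    case (elim x)
    from lin[OF elim] show ?case by (simp add: algebra_simps)
  qed
  ultimately show ?thesis
    using s s' unfolding sys_def by (auto intro!: AC_loc_add AC_loc_mult AC_loc_const)
qed

lemma sys_cnj:
  assumes s: "sys f g h"
  shows "sys (\<lambda>x. cnj (f x)) (\<lambda>x. cnj (g x)) (\<lambda>x. cnj (h x))"
proof -
  have ae: "ae_I (\<lambda>x. (f has_vector_derivative g x / of_real (pc \<tau> x) - of_real (sc \<tau> x) * f x) (at x))"
     "ae_I (\<lambda>x. (g has_vector_derivative
        of_real (sc \<tau> x) * g x + of_real (qc \<tau> x) * f x - of_real (rc \<tau> x) * h x) (at x))"
    using s by (auto simp: sys_def)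
  have "ae_I (\<lambda>x. ((\<lambda>x. cnj (f x)) has_vector_derivative
      cnj (g x) / of_real (pc \<tau> x) - of_real (sc \<tau> x) * cnj (f x)) (at x))"
    using ae(1)
  proof eventually_elim
    case (elim x)
    from has_vector_derivative_cnj[OF elim] show ?case by simp
  qed
  moreover have "ae_I (\<lambda>x. ((\<lambda>x. cnj (g x)) has_vector_derivative
      of_real (sc \<tau> x) * cnj (g x) + of_real (qc \<tau> x) * cnj (f x) - of_real (rc \<tau> x) * cnj (h x)) (at x))"
    using ae(2)
  proof eventually_elim
    case (elim x)
    from has_vector_derivative_cnj[OF elim] show ?case by simp
  qed
  ultimately show ?thesis using s unfolding sys_def by (auto intro!: AC_loc_cnj)
qed

text \<open>For a first-order system only the values of the two components have to match at
  \<open>c\<close>; the derivative there is irrelevant because a single point is null.\<close>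

lemma sys_glue:
  assumes s: "sys f g h" and s': "sys f' g' h'" and c: "c \<in> I" "f c = f' c" "g c = g' c"
  shows "sys (\<lambda>x. if x \<le> c then f x else f' x) (\<lambda>x. if x \<le> c then g x else g' x) (\<lambda>x. if x \<le> c then h x else h' x)"
proof -
  have nc: "ae_I (\<lambda>x. x \<noteq> c)"
  proof -
    have "negligible {x \<in> I. \<not> x \<noteq> c}" by (rule negligible_subset[of "{c}"]) auto
    then show ?thesis by (simp add: AE_lebesgue_on_iff_negligible)
  qed
  have glue: "((\<lambda>x. if x \<le> c then u x else v x) has_vector_derivative (if x \<le> c then u' else v')) (at x)"
    if "x \<noteq> c" "(u has_vector_derivative u') (at x)" "(v has_vector_derivative v') (at x)" for u v :: "real \<Rightarrow> complex" and u' v' x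
  proof (cases "x < c")
    case True
    then show ?thesis
      using has_vector_derivative_transform_within_open[OF that(2), of "{..<c}"] by simp
  next
    case False
    then show ?thesis
      using has_vector_derivative_transform_within_open[OF that(3), of "{c<..}"] that(1) by simp
  qed
  have ae: "ae_I (\<lambda>x. (f has_vector_derivative g x / of_real (pc \<tau> x) - of_real (sc \<tau> x) * f x) (at x))"
     "ae_I (\<lambda>x. (g has_vector_derivative
        of_real (sc \<tau> x) * g x + of_real (qc \<tau> x) * f x - of_real (rc \<tau> x) * h x) (at x))"
     "ae_I (\<lambda>x. (f' has_vector_derivative g' x / of_real (pc \<tau> x) - of_real (sc \<tau> x) * f' x) (at x))"
     "ae_I (\<lambda>x. (g' has_vector_derivative
        of_real (sc \<tau> x) * g' x + of_real (qc \<tau> x) * f' x - of_real (rc \<tau> x) * h' x) (at x))"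
    using s s' by (auto simp: sys_def)
  have "ae_I (\<lambda>x. ((\<lambda>x. if x \<le> c then f x else f' x) has_vector_derivative
      (if x \<le> c then g x else g' x) / of_real (pc \<tau> x) - of_real (sc \<tau> x) * (if x \<le> c then f x else f' x)) (at x))"
    using nc ae(1,3)
  proof eventually_elim
    case (elim x)
    from glue[OF elim] show ?case by (simp split: if_splits)
  qed
  moreover have "ae_I (\<lambda>x. ((\<lambda>x. if x \<le> c then g x else g' x) has_vector_derivative
      of_real (sc \<tau> x) * (if x \<le> c then g x else g' x) + of_real (qc \<tau> x) * (if x \<le> c then f x else f' x)
        - of_real (rc \<tau> x) * (if x \<le> c then h x else h' x)) (at x))"
    using nc ae(2,4)
  proof eventually_elim
    case (elim x)
    from glue[OF elim] show ?case by (simp split: if_splits)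
  qed
  ultimately show ?thesis
    using s s' c unfolding sys_def by (auto intro!: AC_loc_glue is_interval_ival)
qed

lemma sys_wronskian:
  assumes s: "sys f g h" and s': "sys f' g' h'"
  shows "(\<lambda>x. f x * g' x - g x * f' x) \<in> AC_loc I"
    and "ae_I (\<lambda>x. vector_derivative (\<lambda>x. f x * g' x - g x * f' x) (at x) = of_real (rc \<tau> x) * (f' x * h x - f x * h' x))"
proof -
  show "(\<lambda>x. f x * g' x - g x * f' x) \<in> AC_loc I"
    using s s' by (intro AC_loc_diff AC_loc_mult) (auto simp: sys_def)
  have "ae_I (\<lambda>x. (f has_vector_derivative g x / of_real (pc \<tau> x) - of_real (sc \<tau> x) * f x) (at x))"
     "ae_I (\<lambda>x. (g has_vector_derivative
        of_real (sc \<tau> x) * g x + of_real (qc \<tau> x) * f x - of_real (rc \<tau> x) * h x) (at x))"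
     "ae_I (\<lambda>x. (f' has_vector_derivative g' x / of_real (pc \<tau> x) - of_real (sc \<tau> x) * f' x) (at x))"
     "ae_I (\<lambda>x. (g' has_vector_derivative
        of_real (sc \<tau> x) * g' x + of_real (qc \<tau> x) * f' x - of_real (rc \<tau> x) * h' x) (at x))"
    using s s' by (auto simp: sys_def)
  then show "ae_I (\<lambda>x. vector_derivative (\<lambda>x. f x * g' x - g x * f' x) (at x) = of_real (rc \<tau> x) * (f' x * h x - f x * h' x))"
  proof eventually_elim
    case (elim x)
    from has_vector_derivative_diff[OF has_vector_derivative_mult[OF elim(1,4)] has_vector_derivative_mult[OF elim(2,3)]]
    have "vector_derivative (\<lambda>x. f x * g' x - g x * f' x) (at x) =
      f x * (of_real (sc \<tau> x) * g' x + of_real (qc \<tau> x) * f' x - of_real (rc \<tau> x) * h' x)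
        + (g x / of_real (pc \<tau> x) - of_real (sc \<tau> x) * f x) * g' x
      - (g x * (g' x / of_real (pc \<tau> x) - of_real (sc \<tau> x) * f' x)
        + (of_real (sc \<tau> x) * g x + of_real (qc \<tau> x) * f x - of_real (rc \<tau> x) * h x) * f' x)"
      by (rule vector_derivative_at)
    then show ?case by (simp add: algebra_simps)
  qed
qed

text \<open>In the derivative of the Wronskian the terms with \<open>p\<close>, \<open>q\<close> and
  \<open>s\<close> cancel. The form is bilinear, without conjugation: for solutions at
  \<open>z\<close> and \<open>w\<close> the integrand is \<open>(z - w) r f f'\<close>, which
  depends holomorphically on the parameters.\<close>

lemma sys_lagrange:
  assumes s: "sys f g h" and s': "sys f' g' h'" and cd: "c \<le> d" "{c..d} \<subseteq> I"
  shows "((\<lambda>x. of_real (rc \<tau> x) * (f' x * h x - f x * h' x)) has_integral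
    ((f d * g' d - g d * f' d) - (f c * g' c - g c * f' c))) {c..d}"
proof (rule has_integral_spike[OF _ _ AC_loc_FTC[OF sys_wronskian(1)[OF s s'] cd]])
  show "negligible {x \<in> I. \<not> vector_derivative (\<lambda>x. f x * g' x - g x * f' x) (at x) = of_real (rc \<tau> x) * (f' x * h x - f x * h' x)}"
    using sys_wronskian(2)[OF s s'] by (subst (asm) AE_lebesgue_on_iff_negligible) simp_all
qed (use cd in auto)

end

subsection \<open>Square-integrable functions\<close>

lemma L2_measurable: "f \<in> L2 M \<Longrightarrow> f \<in> borel_measurable M"
  and L2_integrable: "f \<in> L2 M \<Longrightarrow> integrable M (\<lambda>x. (cmod (f x))\<^sup>2)"
  by (auto simp: L2_def)

lemma L2_I: "f \<in> borel_measurable M \<Longrightarrow> integrable M (\<lambda>x. (cmod (f x))\<^sup>2) \<Longrightarrow> f \<in> L2 M"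
  by (auto simp: L2_def)

lemma L2_dominated:
  assumes "f \<in> borel_measurable M" "integrable M G" "AE x in M. (cmod (f x))\<^sup>2 \<le> G x"
  shows "f \<in> L2 M"
proof (rule L2_I[OF assms(1)], rule Bochner_Integration.integrable_bound[OF assms(2)])
  show "(\<lambda>x. (cmod (f x))\<^sup>2) \<in> borel_measurable M" using assms(1) by measurable
  show "AE x in M. norm ((cmod (f x))\<^sup>2) \<le> norm (G x)" using assms(3) by eventually_elim auto
qed

lemma L2_mult_integrable:
  assumes f: "f \<in> L2 M" and g: "g \<in> L2 M"
  shows "integrable M (\<lambda>x. f x * g x)"
proof (rule Bochner_Integration.integrable_bound)
  show "integrable M (\<lambda>x. (cmod (f x))\<^sup>2 + (cmod (g x))\<^sup>2)"
    using f g by (auto simp: L2_def)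
  show "(\<lambda>x. f x * g x) \<in> borel_measurable M"
    using f g by (auto simp: L2_def)
  have "a * b \<le> a\<^sup>2 + b\<^sup>2" for a b :: real
    using sum_squares_bound[of a b] zero_le_power2[of a] zero_le_power2[of b] by linarith
  then show "AE x in M. norm (f x * g x) \<le> norm ((cmod (f x))\<^sup>2 + (cmod (g x))\<^sup>2)"
    by (auto simp: norm_mult)
qed

lemma L2_lincomb:
  assumes f: "f \<in> L2 M" and g: "g \<in> L2 M"
  shows "(\<lambda>x. a * f x + b * g x) \<in> L2 M"
proof (rule L2_dominated)
  show "(\<lambda>x. a * f x + b * g x) \<in> borel_measurable M" using f g by (auto simp: L2_def)
  show "integrable M (\<lambda>x. 2 * (cmod a)\<^sup>2 * (cmod (f x))\<^sup>2 + 2 * (cmod b)\<^sup>2 * (cmod (g x))\<^sup>2)"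
    using f g by (auto simp: L2_def)
  have *: "(cmod (u + v))\<^sup>2 \<le> 2 * (cmod u)\<^sup>2 + 2 * (cmod v)\<^sup>2" for u v
  proof -
    have "(cmod (u + v))\<^sup>2 \<le> (cmod u + cmod v)\<^sup>2" by (intro power_mono norm_triangle_ineq) auto
    also have "\<dots> \<le> 2 * (cmod u)\<^sup>2 + 2 * (cmod v)\<^sup>2"
      using sum_squares_bound[of "cmod u" "cmod v"] by (simp add: power2_sum)
    finally show ?thesis .
  qed
  show "AE x in M. (cmod (a * f x + b * g x))\<^sup>2 \<le> 2 * (cmod a)\<^sup>2 * (cmod (f x))\<^sup>2 + 2 * (cmod b)\<^sup>2 * (cmod (g x))\<^sup>2"
    using *[of "a * f _" "b * g _"] by (auto simp: norm_mult power_mult_distrib mult.assoc)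
qed

lemma L2_add: "f \<in> L2 M \<Longrightarrow> g \<in> L2 M \<Longrightarrow> (\<lambda>x. f x + g x) \<in> L2 M"
  using L2_lincomb[of f M g 1 1] by simp

lemma L2_diff: "f \<in> L2 M \<Longrightarrow> g \<in> L2 M \<Longrightarrow> (\<lambda>x. f x - g x) \<in> L2 M"
  using L2_lincomb[of f M g 1 "-1"] by simp

lemma L2_scale: "f \<in> L2 M \<Longrightarrow> (\<lambda>x. a * f x) \<in> L2 M"
  using L2_lincomb[of f M f a 0] by simp

lemma borel_measurable_cnj: "f \<in> borel_measurable M \<Longrightarrow> (\<lambda>x. cnj (f x)) \<in> borel_measurable M"
  by (rule measurable_compose[where g = cnj]) (auto intro!: borel_measurable_continuous_onI continuous_intros)

lemma L2_cnj: "f \<in> L2 M \<Longrightarrow> (\<lambda>x. cnj (f x)) \<in> L2 M"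
  by (auto simp: L2_def intro: borel_measurable_cnj)

lemma L2_cong_AE:
  assumes "f \<in> L2 M" "g \<in> borel_measurable M" "AE x in M. f x = g x"
  shows "g \<in> L2 M"
  by (rule L2_dominated[OF assms(2) L2_integrable[OF assms(1)]]) (use assms(3) in eventually_elim, simp)

lemma L2_norm_nonneg [simp]: "0 \<le> L2_norm M f"
  by (simp add: L2_norm_def)

lemma L2_norm_power2: "(L2_norm M f)\<^sup>2 = (\<integral>x. (cmod (f x))\<^sup>2 \<partial>M)"
  by (simp add: L2_norm_def)

lemma L2_norm_scale: "L2_norm M (\<lambda>x. a * f x) = cmod a * L2_norm M f"
  by (simp add: L2_norm_def norm_mult power_mult_distrib real_sqrt_mult)

lemma L2_norm_minus_commute: "L2_norm M (\<lambda>x. f x - g x) = L2_norm M (\<lambda>x. g x - f x)"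
  by (simp add: L2_norm_def norm_minus_commute)

lemma L2_norm_cong_AE:
  assumes f: "f \<in> borel_measurable M" and g: "g \<in> borel_measurable M" and ae: "AE x in M. f x = g x"
  shows "L2_norm M f = L2_norm M g"
proof -
  have "(\<integral>x. (cmod (f x))\<^sup>2 \<partial>M) = (\<integral>x. (cmod (g x))\<^sup>2 \<partial>M)"
    using f g ae by (intro integral_cong_AE) (auto intro: borel_measurable_power)
  then show ?thesis by (simp add: L2_norm_def)
qed

lemma L2_norm_eq_0_AE:
  assumes f: "f \<in> L2 M" and 0: "L2_norm M f = 0"
  shows "AE x in M. f x = 0"
proof -
  have "(\<integral>x. (cmod (f x))\<^sup>2 \<partial>M) = 0" using L2_norm_power2[of M f] 0 by simp
  then have "AE x in M. (cmod (f x))\<^sup>2 = 0"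
    by (subst (asm) integral_nonneg_eq_0_iff_AE[OF L2_integrable[OF f]]) auto
  then show ?thesis by eventually_elim simp
qed

lemma L2_Cauchy_Schwarz:
  assumes f: "f \<in> L2 M" and g: "g \<in> L2 M"
  shows "(\<integral>x. cmod (f x) * cmod (g x) \<partial>M) \<le> L2_norm M f * L2_norm M g"
proof -
  consider "L2_norm M f = 0" | "L2_norm M g = 0" | "L2_norm M f > 0" "L2_norm M g > 0"
    using L2_norm_nonneg[of M f] L2_norm_nonneg[of M g] by linarith
  then show ?thesis
  proof cases
    case 1
    have "AE x in M. cmod (f x) * cmod (g x) = 0" using L2_norm_eq_0_AE[OF f 1] by eventually_elim simp
    then show ?thesis using 1 by (simp add: integral_eq_zero_AE)
  next
    case 2
    have "AE x in M. cmod (f x) * cmod (g x) = 0" using L2_norm_eq_0_AE[OF g 2] by eventually_elim simp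
    then show ?thesis using 2 by (simp add: integral_eq_zero_AE)
  next
    case 3
    define a where "a = L2_norm M f"
    define b where "b = L2_norm M g"
    have ab: "a > 0" "b > 0" using 3 by (auto simp: a_def b_def)
    have int: "integrable M (\<lambda>x. cmod (f x) * cmod (g x))"
      using integrable_norm[OF L2_mult_integrable[OF f g]] by (simp add: norm_mult)
    \<comment> \<open>Weighted inequality of means, with weights chosen so that both terms on the
      right integrate to \<open>a * b\<close>.\<close>
    have "u * v \<le> (b / a * u\<^sup>2 + a / b * v\<^sup>2) / 2" for u v :: real
    proof -
      have "0 \<le> (b * u - a * v)\<^sup>2 / (2 * a * b)" using ab by simp
      also have "\<dots> = (b / a * u\<^sup>2 + a / b * v\<^sup>2) / 2 - u * v"
        using ab by (simp add: power2_eq_square field_simps)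
      finally show ?thesis by simp
    qed
    then have "(\<integral>x. cmod (f x) * cmod (g x) \<partial>M) \<le> (\<integral>x. (b / a * (cmod (f x))\<^sup>2 + a / b * (cmod (g x))\<^sup>2) / 2 \<partial>M)"
      using int L2_integrable[OF f] L2_integrable[OF g] by (intro integral_mono) auto
    also have "\<dots> = (b / a * a\<^sup>2 + a / b * b\<^sup>2) / 2"
      using L2_integrable[OF f] L2_integrable[OF g] unfolding a_def b_def L2_norm_power2 by simp
    also have "\<dots> = a * b" using ab by (simp add: power2_eq_square)
    finally show ?thesis by (simp add: a_def b_def)
  qed
qed

lemma L2_norm_integral_mult_le:
  assumes f: "f \<in> L2 M" and g: "g \<in> L2 M"
  shows "cmod (\<integral>x. f x * g x \<partial>M) \<le> L2_norm M f * L2_norm M g"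
proof -
  have "cmod (\<integral>x. f x * g x \<partial>M) \<le> (\<integral>x. cmod (f x * g x) \<partial>M)" by (rule integral_norm_bound)
  also have "\<dots> \<le> L2_norm M f * L2_norm M g" using L2_Cauchy_Schwarz[OF f g] by (simp add: norm_mult)
  finally show ?thesis .
qed

lemma L2_norm_triangle:
  assumes f: "f \<in> L2 M" and g: "g \<in> L2 M"
  shows "L2_norm M (\<lambda>x. f x + g x) \<le> L2_norm M f + L2_norm M g"
proof (rule power2_le_imp_le)
  have int: "integrable M (\<lambda>x. cmod (f x) * cmod (g x))"
    using integrable_norm[OF L2_mult_integrable[OF f g]] by (simp add: norm_mult)
  have "(L2_norm M (\<lambda>x. f x + g x))\<^sup>2 \<le> (\<integral>x. (cmod (f x))\<^sup>2 + (cmod (g x))\<^sup>2 + 2 * (cmod (f x) * cmod (g x)) \<partial>M)"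
    unfolding L2_norm_power2
  proof (rule integral_mono)
    show "(cmod (f x + g x))\<^sup>2 \<le> (cmod (f x))\<^sup>2 + (cmod (g x))\<^sup>2 + 2 * (cmod (f x) * cmod (g x))" for x
      using power_mono[OF norm_triangle_ineq[of "f x" "g x"], of 2] by (simp add: power2_sum mult.assoc)
  qed (use int L2_integrable[OF f] L2_integrable[OF g] L2_integrable[OF L2_add[OF f g]] in auto)
  also have "\<dots> = (L2_norm M f)\<^sup>2 + (L2_norm M g)\<^sup>2 + 2 * (\<integral>x. cmod (f x) * cmod (g x) \<partial>M)"
    using int L2_integrable[OF f] L2_integrable[OF g] by (simp add: L2_norm_power2)
  also have "\<dots> \<le> (L2_norm M f + L2_norm M g)\<^sup>2"
    using L2_Cauchy_Schwarz[OF f g] by (simp add: power2_sum)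
  finally show "(L2_norm M (\<lambda>x. f x + g x))\<^sup>2 \<le> (L2_norm M f + L2_norm M g)\<^sup>2" .
qed simp

text \<open>The instance of completeness of the space that the Neumann series requires.\<close>

lemma L2_geometric_series:
  assumes h: "\<And>n. h n \<in> L2 M" and \<rho>: "0 < \<rho>" "\<rho> < 1"
    and le: "\<And>n. L2_norm M (h n) \<le> A * \<rho> ^ n"
  obtains g where "g \<in> L2 M" "(\<lambda>N. L2_norm M (\<lambda>x. g x - (\<Sum>n<N. h n x))) \<longlonglongrightarrow> 0"
proof -
  \<comment> \<open>Weighting by \<open>\<rho>\<^sup>-\<^sup>n\<close> turns the Cauchy--Schwarz inequality for series into a pointwise
     majorant of the tails by one integrable function.\<close>
  define k where "k n x = (cmod (h n x))\<^sup>2 / \<rho> ^ n" for n x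
  have k0: "0 \<le> k n x" for n x using \<rho> by (simp add: k_def)
  have kint: "integrable M (k n)" for n
    unfolding k_def using L2_integrable[OF h] by (intro integrable_divide) auto
  have k_le: "(\<integral>x. k n x \<partial>M) \<le> A\<^sup>2 * \<rho> ^ n" for n
  proof -
    have "(\<integral>x. k n x \<partial>M) = (L2_norm M (h n))\<^sup>2 / \<rho> ^ n" by (simp add: k_def L2_norm_power2)
    also have "\<dots> \<le> (A * \<rho> ^ n)\<^sup>2 / \<rho> ^ n"
      using \<rho> le by (intro divide_right_mono power_mono) auto
    also have "\<dots> = A\<^sup>2 * \<rho> ^ n" using \<rho> by (simp add: power2_eq_square)
    finally show ?thesis .
  qed
  have sumint: "summable (\<lambda>n. \<integral>x. norm (k n x) \<partial>M)"
  proof (rule summable_comparison_test')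
    show "summable (\<lambda>n. A\<^sup>2 * \<rho> ^ n)" using \<rho> by (intro summable_mult summable_geometric) auto
    show "norm (\<integral>x. norm (k n x) \<partial>M) \<le> A\<^sup>2 * \<rho> ^ n" for n
      using k_le[of n] k0 by (simp add: integral_nonneg)
  qed
  have ae: "AE x in M. summable (\<lambda>n. k n x)"
  proof -
    have [measurable]: "k n \<in> borel_measurable M" for n
      by (rule borel_measurable_integrable[OF kint])
    have "(\<integral>\<^sup>+x. (\<Sum>n. ennreal (k n x)) \<partial>M) = (\<Sum>n. \<integral>\<^sup>+x. ennreal (k n x) \<partial>M)"
      by (intro nn_integral_suminf) measurable
    also have "\<dots> = (\<Sum>n. ennreal (\<integral>x. k n x \<partial>M))"
      using kint k0 by (simp add: nn_integral_eq_integral)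
    also have "\<dots> = ennreal (\<Sum>n. \<integral>x. k n x \<partial>M)"
      using sumint k0 by (intro suminf_ennreal2) auto
    finally have "(\<integral>\<^sup>+x. (\<Sum>n. ennreal (k n x)) \<partial>M) \<noteq> \<infinity>" by simp
    then have "AE x in M. (\<Sum>n. ennreal (k n x)) \<noteq> \<infinity>"
      by (intro nn_integral_PInf_AE) measurable
    then show ?thesis
      by eventually_elim (use k0 in \<open>auto intro: summable_suminf_not_top\<close>)
  qed
  define H where "H x = (\<Sum>n. k n x)" for x
  have Hint: "integrable M H"
    unfolding H_def using ae k0 by (intro integrable_suminf kint sumint) simp
  define g where "g x = (\<Sum>n. h n x)" for x
  have gm: "g \<in> borel_measurable M"
    unfolding g_def using L2_measurable[OF h] by measurable
  have tail: "AE x in M. (cmod (g x - (\<Sum>n<N. h n x)))\<^sup>2 \<le> \<rho> ^ N / (1 - \<rho>) * H x" for N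
    using ae
  proof eventually_elim
    case (elim x)
    have fin: "(\<Sum>n\<in>F. cmod (h n x))\<^sup>2 \<le> (\<Sum>n\<in>F. \<rho> ^ n) * H x" if "finite F" for F
    proof -
      have "(\<Sum>n\<in>F. cmod (h n x))\<^sup>2 = (\<Sum>n\<in>F. sqrt (\<rho> ^ n) * (cmod (h n x) / sqrt (\<rho> ^ n)))\<^sup>2"
        using \<rho> by simp
      also have "\<dots> \<le> (\<Sum>n\<in>F. (sqrt (\<rho> ^ n))\<^sup>2) * (\<Sum>n\<in>F. (cmod (h n x) / sqrt (\<rho> ^ n))\<^sup>2)"
        by (rule Cauchy_Schwarz_ineq_sum)
      also have "\<dots> = (\<Sum>n\<in>F. \<rho> ^ n) * (\<Sum>n\<in>F. k n x)"
        using \<rho> by (simp add: k_def power_divide)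
      also have "\<dots> \<le> (\<Sum>n\<in>F. \<rho> ^ n) * H x"
        unfolding H_def using \<rho> k0 elim that by (intro mult_left_mono sum_le_suminf sum_nonneg) auto
      finally show ?thesis .
    qed
    have H0: "0 \<le> H x" unfolding H_def using elim k0 by (intro suminf_nonneg)
    have summ: "summable (\<lambda>n. h n x)"
    proof (rule summable_comparison_test')
      show "summable (\<lambda>n. \<rho> ^ n + k n x)" using elim \<rho> by (intro summable_add summable_geometric) auto
      fix n
      have "2 * (cmod (h n x) / sqrt (\<rho> ^ n)) * sqrt (\<rho> ^ n) \<le> (cmod (h n x) / sqrt (\<rho> ^ n))\<^sup>2 + (sqrt (\<rho> ^ n))\<^sup>2"
        by (rule sum_squares_bound)
      then have "2 * cmod (h n x) \<le> k n x + \<rho> ^ n" using \<rho> by (simp add: k_def power_divide)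
      then show "norm (h n x) \<le> \<rho> ^ n + k n x" using norm_ge_zero[of "h n x"] by linarith
    qed
    have "cmod ((\<Sum>n<m + N. h n x) - (\<Sum>n<N. h n x)) \<le> sqrt (\<rho> ^ N / (1 - \<rho>) * H x)" for m
    proof -
      have "(\<Sum>n<m + N. h n x) - (\<Sum>n<N. h n x) = (\<Sum>n\<in>{N..<m + N}. h n x)"
        using sum_diff[of "{..<m + N}" "{..<N}" "\<lambda>n. h n x"] by (simp add: lessThan_minus_lessThan)
      then have "cmod ((\<Sum>n<m + N. h n x) - (\<Sum>n<N. h n x)) \<le> (\<Sum>n\<in>{N..<m + N}. cmod (h n x))"
        by (simp add: norm_sum)
      moreover have "(\<Sum>n\<in>{N..<m + N}. cmod (h n x))\<^sup>2 \<le> \<rho> ^ N / (1 - \<rho>) * H x"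
      proof -
        have "(\<Sum>n\<in>{N..<m + N}. \<rho> ^ n) = \<rho> ^ N * (\<Sum>n<m. \<rho> ^ n)"
          using sum.shift_bounds_nat_ivl[of "\<lambda>n. \<rho> ^ n" 0 N m] by (simp add: lessThan_atLeast0 power_add sum_distrib_left mult.commute)
        also have "\<dots> \<le> \<rho> ^ N * (1 / (1 - \<rho>))"
        proof (rule mult_left_mono)
          show "(\<Sum>n<m. \<rho> ^ n) \<le> 1 / (1 - \<rho>)"
            using \<rho> sum_le_suminf[of "\<lambda>n. \<rho> ^ n" "{..<m}"] by (simp add: suminf_geometric summable_geometric)
        qed (use \<rho> in auto)
        finally show ?thesis using fin[of "{N..<m + N}"] mult_right_mono[OF _ H0] by fastforce
      qed
      ultimately show ?thesis using real_le_rsqrt by fastforce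
    qed
    moreover have "(\<lambda>m. (\<Sum>n<m + N. h n x) - (\<Sum>n<N. h n x)) \<longlonglongrightarrow> g x - (\<Sum>n<N. h n x)"
      unfolding g_def using summ by (intro tendsto_diff tendsto_const LIMSEQ_ignore_initial_segment summable_LIMSEQ)
    ultimately have "cmod (g x - (\<Sum>n<N. h n x)) \<le> sqrt (\<rho> ^ N / (1 - \<rho>) * H x)"
      by (intro Lim_norm_ubound[of sequentially]) (auto simp del: real_sqrt_le_iff)
    then have "(cmod (g x - (\<Sum>n<N. h n x)))\<^sup>2 \<le> (sqrt (\<rho> ^ N / (1 - \<rho>) * H x))\<^sup>2"
      by (intro power_mono) auto
    also have "\<dots> = \<rho> ^ N / (1 - \<rho>) * H x" using \<rho> H0 by (intro real_sqrt_pow2) auto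
    finally show ?case .
  qed
  have gL2: "g \<in> L2 M"
    by (rule L2_dominated[OF gm, of "\<lambda>x. \<rho> ^ 0 / (1 - \<rho>) * H x"]) (use tail[of 0] Hint in auto)
  have "(\<lambda>N. L2_norm M (\<lambda>x. g x - (\<Sum>n<N. h n x))) \<longlonglongrightarrow> 0"
  proof (rule tendsto_sandwich[of "\<lambda>_. 0"])
    have "L2_norm M (\<lambda>x. g x - (\<Sum>n<N. h n x)) \<le> sqrt (\<rho> ^ N / (1 - \<rho>) * (\<integral>x. H x \<partial>M))" for N
    proof -
      have "(\<integral>x. (cmod (g x - (\<Sum>n<N. h n x)))\<^sup>2 \<partial>M) \<le> (\<integral>x. \<rho> ^ N / (1 - \<rho>) * H x \<partial>M)"
      proof (rule integral_mono_AE[OF _ _ tail])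
        have "(\<lambda>x. g x - (\<Sum>n<N. h n x)) \<in> L2 M"
          by (rule L2_dominated[OF _ _ tail]) (use gm L2_measurable[OF h] Hint in \<open>auto intro!: borel_measurable_diff borel_measurable_sum\<close>)
        then show "integrable M (\<lambda>x. (cmod (g x - (\<Sum>n<N. h n x)))\<^sup>2)" by (rule L2_integrable)
      qed (use Hint in auto)
      then show ?thesis by (simp add: L2_norm_def)
    qed
    then show "\<forall>\<^sub>F N in sequentially. L2_norm M (\<lambda>x. g x - (\<Sum>n<N. h n x)) \<le> sqrt (\<rho> ^ N / (1 - \<rho>) * (\<integral>x. H x \<partial>M))"
      by simp
    have "(\<lambda>N. sqrt (\<rho> ^ N / (1 - \<rho>) * (\<integral>x. H x \<partial>M))) \<longlonglongrightarrow> sqrt (0 / (1 - \<rho>) * (\<integral>x. H x \<partial>M))"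
      using \<rho> by (intro tendsto_intros LIMSEQ_power_zero) auto
    then show "(\<lambda>N. sqrt (\<rho> ^ N / (1 - \<rho>) * (\<integral>x. H x \<partial>M))) \<longlonglongrightarrow> 0" by simp
  qed auto
  with gL2 show ?thesis by (rule that)
qed

subsection \<open>Resolvents\<close>

text \<open>Linearity is required only up to null sets because the values \<open>u\<close> in an operator graph are
  arbitrary representatives.\<close>

definition ae_linear :: "'a measure \<Rightarrow> 'a op_graph \<Rightarrow> bool" where
  "ae_linear M T \<longleftrightarrow> T \<subseteq> L2 M \<times> L2 M \<and>
     (\<forall>(f, u)\<in>T. \<forall>(g, w)\<in>T. \<forall>a. \<exists>v. ((\<lambda>x. f x + a * g x), v) \<in> T \<and> (AE x in M. v x = u x + a * w x))"

text \<open>A relation in place of a resolvent map: the solution is a function determined at best up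
  to null sets, and at a general \<open>z\<close> it need not exist.\<close>

definition solves :: "'a measure \<Rightarrow> 'a op_graph \<Rightarrow> complex \<Rightarrow> ('a \<Rightarrow> complex) \<Rightarrow> ('a \<Rightarrow> complex) \<Rightarrow> bool" where
  "solves M T z f h \<longleftrightarrow> (\<exists>u. (f, u) \<in> T \<and> (AE x in M. u x - z * f x = h x))"

lemma resolvent_set_iff:
  "z \<in> resolvent_set M T \<longleftrightarrow>
     (\<forall>(f, u)\<in>T. (AE x in M. u x - z * f x = 0) \<longrightarrow> (AE x in M. f x = 0)) \<and>
     (\<forall>h\<in>L2 M. \<exists>f. solves M T z f h) \<and>
     (\<exists>C. \<forall>(f, u)\<in>T. L2_norm M f \<le> C * L2_norm M (\<lambda>x. u x - z * f x))"
  unfolding resolvent_set_def solves_def by (auto simp: Bex_def)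

lemma resolvent_injective:
  assumes "z \<in> resolvent_set M T" "(f, u) \<in> T" "AE x in M. u x - z * f x = 0"
  shows "AE x in M. f x = 0"
proof -
  have "\<forall>(f, u)\<in>T. (AE x in M. u x - z * f x = 0) \<longrightarrow> (AE x in M. f x = 0)"
    using assms(1) unfolding resolvent_set_iff by (elim conjE)
  from bspec[OF this assms(2)] assms(3) show ?thesis by (simp only: prod.case)
qed

context
  fixes M :: "'a measure" and T :: "'a op_graph"
  assumes lin: "ae_linear M T"
begin

lemma graph_L2: "(f, u) \<in> T \<Longrightarrow> f \<in> L2 M" "(f, u) \<in> T \<Longrightarrow> u \<in> L2 M"
  using lin by (auto simp: ae_linear_def)

lemma solves_L2: "solves M T z f h \<Longrightarrow> f \<in> L2 M"
  using graph_L2 by (auto simp: solves_def)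

lemma solves_lincomb:
  assumes "solves M T z f h" "solves M T z g k"
  shows "solves M T z (\<lambda>x. f x + a * g x) (\<lambda>x. h x + a * k x)"
proof -
  obtain u w where u: "(f, u) \<in> T" "AE x in M. u x - z * f x = h x"
    and w: "(g, w) \<in> T" "AE x in M. w x - z * g x = k x"
    using assms by (auto simp: solves_def)
  obtain v where v: "((\<lambda>x. f x + a * g x), v) \<in> T" "AE x in M. v x = u x + a * w x"
    using lin u(1) w(1) unfolding ae_linear_def by fastforce
  have "AE x in M. v x - z * (f x + a * g x) = h x + a * k x"
    using u(2) w(2) v(2)
  proof eventually_elim
    case (elim x)
    show ?case unfolding elim(3) elim(1)[symmetric] elim(2)[symmetric] by (simp add: algebra_simps)
  qed
  with v(1) show ?thesis by (auto simp: solves_def)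
qed

text \<open>\<open>(T - w) f = (T - z) f + (z - w) f\<close>. Together with
  \<open>solves_lincomb\<close> this plays the role of the resolvent identity.\<close>

lemma solves_shift:
  assumes "solves M T z f h" "AE x in M. k x = h x + (z - w) * f x"
  shows "solves M T w f k"
proof -
  obtain u where u: "(f, u) \<in> T" "AE x in M. u x - z * f x = h x"
    using assms by (auto simp: solves_def)
  have "AE x in M. u x - w * f x = k x"
    using u(2) assms(2)
  proof eventually_elim
    case (elim x)
    show ?case unfolding elim(2) elim(1)[symmetric] by (simp add: algebra_simps)
  qed
  with u(1) show ?thesis by (auto simp: solves_def)
qed

lemma resolvent_bound:
  assumes "z \<in> resolvent_set M T"
  obtains C where "C > 0" "\<And>f h. solves M T z f h \<Longrightarrow> h \<in> L2 M \<Longrightarrow> L2_norm M f \<le> C * L2_norm M h"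
proof -
  obtain C where C: "\<And>f u. (f, u) \<in> T \<Longrightarrow> L2_norm M f \<le> C * L2_norm M (\<lambda>x. u x - z * f x)"
    using assms unfolding resolvent_set_iff by blast
  have "L2_norm M f \<le> max C 1 * L2_norm M h" if s: "solves M T z f h" "h \<in> L2 M" for f h
  proof -
    obtain u where u: "(f, u) \<in> T" "AE x in M. u x - z * f x = h x"
      using s by (auto simp: solves_def)
    have "(\<lambda>x. u x - z * f x) \<in> L2 M" using u(1) graph_L2 by (intro L2_diff L2_scale) auto
    then have "L2_norm M (\<lambda>x. u x - z * f x) = L2_norm M h"
      using s(2) u(2) by (intro L2_norm_cong_AE L2_measurable)
    then have "L2_norm M f \<le> C * L2_norm M h" using C[OF u(1)] by simp
    also have "\<dots> \<le> max C 1 * L2_norm M h" by (intro mult_right_mono) auto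
    finally show ?thesis .
  qed
  then show ?thesis by (intro that[of "max C 1"]) auto
qed

text \<open>The threshold 1/2 serves twice: the perturbation in the a priori bound is absorbed at
  the price of a factor 2, and the Neumann series has ratio 1/2.\<close>

lemma resolvent_set_Neumann:
  assumes z0: "z0 \<in> resolvent_set M T"
    and C: "C > 0" "\<And>f h. solves M T z0 f h \<Longrightarrow> h \<in> L2 M \<Longrightarrow> L2_norm M f \<le> C * L2_norm M h"
    and z: "C * cmod (z - z0) \<le> 1 / 2"
  shows "z \<in> resolvent_set M T"
proof -
  define d where "d = z - z0"
  have bound: "L2_norm M f \<le> 2 * C * L2_norm M h" if s: "solves M T z f h" and h: "h \<in> L2 M" for f h
  proof -
    have f: "f \<in> L2 M" using solves_L2[OF s] .
    have "solves M T z0 f (\<lambda>x. h x + d * f x)" by (rule solves_shift[OF s]) (simp add: d_def)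
    then have "L2_norm M f \<le> C * L2_norm M (\<lambda>x. h x + d * f x)" using f h by (intro C(2) L2_add L2_scale)
    also have "\<dots> \<le> C * (L2_norm M h + cmod d * L2_norm M f)"
      using L2_norm_triangle[OF h L2_scale[OF f, of d]] C(1) by (intro mult_left_mono) (auto simp: L2_norm_scale)
    also have "\<dots> = C * L2_norm M h + C * cmod d * L2_norm M f" by (simp add: algebra_simps)
    also have "\<dots> \<le> C * L2_norm M h + 1 / 2 * L2_norm M f"
      using z by (intro add_left_mono mult_right_mono) (auto simp: d_def)
    finally show ?thesis by simp
  qed
  have ex: "\<exists>f. solves M T z f h" if h: "h \<in> L2 M" for h
  proof -
    have "\<forall>g\<in>L2 M. \<exists>f. solves M T z0 f g" using z0 by (simp add: resolvent_set_iff)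
    then obtain R where R: "\<And>g. g \<in> L2 M \<Longrightarrow> solves M T z0 (R g) g" by metis
    \<comment> \<open>\<open>hs n\<close> stands for \<open>(d R)^n h\<close>. The sum
      \<open>g\<close> of these functions satisfies \<open>g - d R g = h\<close>, so
      \<open>f = R g\<close> solves the equation at \<open>z\<close>.\<close>
    define hs where "hs n = ((\<lambda>g x. d * R g x) ^^ n) h" for n
    have hs_Suc: "hs (Suc n) = (\<lambda>x. d * R (hs n) x)" for n by (simp add: hs_def)
    have hsL: "hs n \<in> L2 M" for n
    proof (induction n)
      case (Suc n)
      then show ?case unfolding hs_Suc by (intro L2_scale solves_L2[OF R])
    qed (simp add: hs_def h)
    have le: "L2_norm M (hs n) \<le> L2_norm M h * (1 / 2) ^ n" for n
    proof (induction n)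
      case (Suc n)
      have "L2_norm M (hs (Suc n)) = cmod d * L2_norm M (R (hs n))" by (simp add: hs_Suc L2_norm_scale)
      also have "\<dots> \<le> cmod d * (C * L2_norm M (hs n))"
        by (intro mult_left_mono C(2) R hsL) auto
      also have "\<dots> = C * cmod d * L2_norm M (hs n)" by simp
      also have "\<dots> \<le> 1 / 2 * (L2_norm M h * (1 / 2) ^ n)"
        using z C(1) Suc by (intro mult_mono) (auto simp: d_def)
      finally show ?case by simp
    qed (simp add: hs_def)
    obtain g where g: "g \<in> L2 M" and lim: "(\<lambda>N. L2_norm M (\<lambda>x. g x - (\<Sum>n<N. hs n x))) \<longlonglongrightarrow> 0"
      by (rule L2_geometric_series[OF hsL _ _ le]) auto
    define f where "f = R g"
    have f: "solves M T z0 f g" unfolding f_def by (rule R[OF g])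
    have fL: "f \<in> L2 M" by (rule solves_L2[OF f])
    \<comment> \<open>\<open>R\<close> picks representatives and need not be linear, so the partial
      sums are followed through the linear relation \<open>solves\<close>.\<close>
    have partial: "solves M T z0 (\<lambda>x. \<Sum>n<Suc N. R (hs n) x) (\<lambda>x. \<Sum>n<Suc N. hs n x)" for N
    proof (induction N)
      case 0
      then show ?case using R[OF hsL[of 0]] by simp
    next
      case (Suc N)
      from solves_lincomb[OF Suc R[OF hsL[of "Suc N"]], of 1] show ?case by simp
    qed
    have dR: "d * (\<Sum>n<N. R (hs n) x) = (\<Sum>n<Suc N. hs n x) - h x" for N x
      unfolding sum.lessThan_Suc_shift by (simp add: hs_Suc sum_distrib_left, simp add: hs_def)
    define G where "G N x = (\<Sum>n<N. hs n x)" for N x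
    have GL: "G N \<in> L2 M" for N
    proof (induction N)
      case 0
      show ?case unfolding G_def using L2_scale[OF h, of 0] by simp
    next
      case (Suc N)
      then show ?case unfolding G_def using L2_add[OF _ hsL] by simp
    qed
    \<comment> \<open>The residual is a tail of the series plus \<open>d (F - f)\<close>, and the
      resolvent bound controls the latter by another tail. The index is one higher in the first tail
      because applying \<open>d R\<close> shifts the series. The left side does not depend on
      \<open>N\<close>, hence vanishes.\<close>
    have est: "L2_norm M (\<lambda>x. g x - d * f x - h x)
        \<le> L2_norm M (\<lambda>x. g x - G (Suc (Suc N)) x) + 1 / 2 * L2_norm M (\<lambda>x. g x - G (Suc N) x)" for N
    proof -
      define F where "F x = (\<Sum>n<Suc N. R (hs n) x)" for x
      have "solves M T z0 (\<lambda>x. F x + (-1) * f x) (\<lambda>x. G (Suc N) x + (-1) * g x)"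
        unfolding F_def G_def by (rule solves_lincomb[OF partial f])
      then have D: "solves M T z0 (\<lambda>x. F x - f x) (\<lambda>x. G (Suc N) x - g x)" by simp
      have "L2_norm M (\<lambda>x. F x - f x) \<le> C * L2_norm M (\<lambda>x. G (Suc N) x - g x)"
        by (rule C(2)[OF D L2_diff[OF GL g]])
      then have "cmod d * L2_norm M (\<lambda>x. F x - f x) \<le> cmod d * (C * L2_norm M (\<lambda>x. G (Suc N) x - g x))"
        by (intro mult_left_mono) auto
      also have "\<dots> = C * cmod d * L2_norm M (\<lambda>x. g x - G (Suc N) x)"
        by (simp add: L2_norm_minus_commute[of M g])
      also have "\<dots> \<le> 1 / 2 * L2_norm M (\<lambda>x. g x - G (Suc N) x)"
        using z by (intro mult_right_mono) (auto simp: d_def)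
      finally have 1: "cmod d * L2_norm M (\<lambda>x. F x - f x) \<le> 1 / 2 * L2_norm M (\<lambda>x. g x - G (Suc N) x)" .
      have "(\<lambda>x. g x - d * f x - h x) = (\<lambda>x. (g x - G (Suc (Suc N)) x) + d * (F x - f x))"
        unfolding G_def F_def by (simp add: fun_eq_iff dR right_diff_distrib del: sum.lessThan_Suc)
      then have "L2_norm M (\<lambda>x. g x - d * f x - h x) \<le> L2_norm M (\<lambda>x. g x - G (Suc (Suc N)) x) + L2_norm M (\<lambda>x. d * (F x - f x))"
        using L2_norm_triangle[OF L2_diff[OF g GL] L2_scale[OF solves_L2[OF D], of d]] by simp
      then show ?thesis using 1 by (simp add: L2_norm_scale)
    qed
    have "(\<lambda>N. L2_norm M (\<lambda>x. g x - G (Suc (Suc N)) x) + 1 / 2 * L2_norm M (\<lambda>x. g x - G (Suc N) x)) \<longlonglongrightarrow> 0 + 1 / 2 * 0"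
      using lim unfolding G_def
      by (intro tendsto_add tendsto_mult tendsto_const LIMSEQ_Suc[OF LIMSEQ_Suc] LIMSEQ_Suc)
    then have "(\<lambda>N. L2_norm M (\<lambda>x. g x - G (Suc (Suc N)) x) + 1 / 2 * L2_norm M (\<lambda>x. g x - G (Suc N) x)) \<longlonglongrightarrow> 0" by simp
    then have "L2_norm M (\<lambda>x. g x - d * f x - h x) \<le> 0"
      using est by (intro LIMSEQ_le_const) auto
    then have "L2_norm M (\<lambda>x. g x - d * f x - h x) = 0" using L2_norm_nonneg order_antisym by blast
    then have "AE x in M. g x - d * f x - h x = 0"
      by (intro L2_norm_eq_0_AE L2_diff L2_scale g fL h)
    then have "AE x in M. h x = g x + (z0 - z) * f x"
    proof eventually_elim
      case (elim x)
      then show ?case by (simp add: d_def algebra_simps)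
    qed
    then have "solves M T z f h" by (rule solves_shift[OF f])
    then show ?thesis by (rule exI[of _ f])
  qed
  have bound': "L2_norm M f \<le> 2 * C * L2_norm M (\<lambda>x. u x - z * f x)" if "(f, u) \<in> T" for f u
    using that graph_L2 by (intro bound L2_diff L2_scale) (auto simp: solves_def)
  have "AE x in M. f x = 0" if fu: "(f, u) \<in> T" "AE x in M. u x - z * f x = 0" for f u
  proof -
    have uf: "(\<lambda>x. u x - z * f x) \<in> L2 M" using fu graph_L2 by (intro L2_diff L2_scale) auto
    have "L2_norm M (\<lambda>x. u x - z * f x) = L2_norm M (\<lambda>x. 0 :: complex)"
      using fu(2) by (intro L2_norm_cong_AE L2_measurable[OF uf]) auto
    also have "\<dots> = 0" by (simp add: L2_norm_def)
    finally have "L2_norm M f \<le> 0" using bound'[OF fu(1)] by simp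
    then have "L2_norm M f = 0" using L2_norm_nonneg order_antisym by blast
    then show ?thesis using fu(1) graph_L2 by (intro L2_norm_eq_0_AE) auto
  qed
  then show ?thesis
    unfolding resolvent_set_iff using ex bound' by blast
qed

lemma open_resolvent_set: "open (resolvent_set M T)"
  unfolding open_contains_ball
proof
  fix z0 assume z0: "z0 \<in> resolvent_set M T"
  obtain C where C: "C > 0" "\<And>f h. solves M T z0 f h \<Longrightarrow> h \<in> L2 M \<Longrightarrow> L2_norm M f \<le> C * L2_norm M h"
    using resolvent_bound[OF z0] by metis
  have "ball z0 (1 / (2 * C)) \<subseteq> resolvent_set M T"
  proof
    fix z assume "z \<in> ball z0 (1 / (2 * C))"
    then have "C * cmod (z - z0) \<le> 1 / 2" using C(1) by (simp add: dist_norm norm_minus_commute field_simps)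
    with z0 C show "z \<in> resolvent_set M T" by (intro resolvent_set_Neumann[of z0 C z]) auto
  qed
  then show "\<exists>e>0. ball z0 e \<subseteq> resolvent_set M T" using C(1) by (intro exI[of _ "1 / (2 * C)"]) auto
qed

text \<open>The derivative at \<open>w\<close> is the pairing of \<open>R(w)\<^sup>2 h\<close>,
  represented by \<open>g\<close>, with \<open>k\<close>. Two applications of the resolvent
  identity, to \<open>D\<close> and to \<open>E\<close>, show that the remainder is quadratic in
  \<open>z - w\<close>. The pairing carries no conjugate.\<close>

lemma resolvent_weakly_holomorphic:
  assumes U: "open U" "U \<subseteq> resolvent_set M T"
    and f: "\<And>z. z \<in> U \<Longrightarrow> solves M T z (f z) h" and h: "h \<in> L2 M" and k: "k \<in> L2 M"
  shows "(\<lambda>z. \<integral>x. f z x * k x \<partial>M) holomorphic_on U"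
proof (rule holomorphic_onI)
  fix w assume w: "w \<in> U"
  then have wres: "w \<in> resolvent_set M T" using U by blast
  obtain C where C: "C > 0" "\<And>f h. solves M T w f h \<Longrightarrow> h \<in> L2 M \<Longrightarrow> L2_norm M f \<le> C * L2_norm M h"
    using resolvent_bound[OF wres] by metis
  have fL: "f z \<in> L2 M" if "z \<in> U" for z using solves_L2[OF f[OF that]] .
  obtain g where g: "solves M T w g (f w)" using wres fL[OF w] by (auto simp: resolvent_set_iff)
  have gL: "g \<in> L2 M" by (rule solves_L2[OF g])
  obtain r where r: "r > 0" "ball w r \<subseteq> U" using U(1) w open_contains_ball by blast
  define K where "K = 2 * C * C * L2_norm M (f w) * L2_norm M k"
  have K0: "K \<ge> 0" using C(1) by (simp add: K_def)
  have est: "cmod ((\<integral>x. f z x * k x \<partial>M) - (\<integral>x. f w x * k x \<partial>M) - (\<integral>x. g x * k x \<partial>M) * (z - w)) \<le> K * (cmod (z - w))\<^sup>2"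
    if z: "cmod (z - w) < min r (1 / (2 * C))" for z
  proof -
    have zU: "z \<in> U" using r(2) z by (auto simp: dist_norm norm_minus_commute)
    define D where "D = (\<lambda>x. f z x - f w x)"
    have DL: "D \<in> L2 M" unfolding D_def by (intro L2_diff fL zU w)
    have "solves M T w (f z) (\<lambda>x. h x + (z - w) * f z x)" by (rule solves_shift[OF f[OF zU]]) simp
    from solves_lincomb[OF this f[OF w], of "-1"]
    have D: "solves M T w D (\<lambda>x. (z - w) * f z x)" by (simp add: D_def)
    have "L2_norm M D \<le> C * L2_norm M (\<lambda>x. (z - w) * f z x)" by (intro C(2)[OF D] L2_scale fL zU)
    then have Dn: "L2_norm M D \<le> C * cmod (z - w) * L2_norm M (f z)" by (simp add: L2_norm_scale mult.assoc)
    have "f z = (\<lambda>x. f w x + D x)" by (simp add: D_def)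
    then have "L2_norm M (f z) \<le> L2_norm M (f w) + L2_norm M D" using L2_norm_triangle[OF fL[OF w] DL] by simp
    \<comment> \<open>The bound on \<open>D\<close> involves \<open>f z\<close> itself; closeness of
      \<open>z\<close> to \<open>w\<close> lets half of that norm be absorbed on the left.\<close>
    also have "\<dots> \<le> L2_norm M (f w) + 1 / 2 * L2_norm M (f z)"
    proof -
      have "C * cmod (z - w) \<le> 1 / 2" using z C(1) by (simp add: field_simps)
      then have "C * cmod (z - w) * L2_norm M (f z) \<le> 1 / 2 * L2_norm M (f z)" by (intro mult_right_mono) auto
      then show ?thesis using Dn by linarith
    qed
    finally have fz: "L2_norm M (f z) \<le> 2 * L2_norm M (f w)" by simp
    define E where "E = (\<lambda>x. D x - (z - w) * g x)"
    have EL: "E \<in> L2 M" unfolding E_def by (intro L2_diff L2_scale DL gL)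
    from solves_lincomb[OF D g, of "- (z - w)"]
    have E: "solves M T w E (\<lambda>x. (z - w) * D x)" by (simp add: E_def D_def algebra_simps)
    have "L2_norm M E \<le> C * L2_norm M (\<lambda>x. (z - w) * D x)" by (intro C(2)[OF E] L2_scale DL)
    also have "\<dots> = C * cmod (z - w) * L2_norm M D" by (simp add: L2_norm_scale)
    also have "\<dots> \<le> C * cmod (z - w) * (C * cmod (z - w) * (2 * L2_norm M (f w)))"
      using C(1) order_trans[OF Dn mult_left_mono[OF fz]] by (intro mult_left_mono) auto
    finally have En: "L2_norm M E \<le> 2 * C * C * L2_norm M (f w) * (cmod (z - w))\<^sup>2"
      by (simp add: power2_eq_square algebra_simps)
    have "(\<integral>x. f z x * k x \<partial>M) - (\<integral>x. f w x * k x \<partial>M) - (\<integral>x. g x * k x \<partial>M) * (z - w)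
        = (\<integral>x. f z x * k x - f w x * k x - (g x * k x) * (z - w) \<partial>M)"
      using L2_mult_integrable[OF fL[OF zU] k] L2_mult_integrable[OF fL[OF w] k] L2_mult_integrable[OF gL k] by simp
    also have "\<dots> = (\<integral>x. E x * k x \<partial>M)" by (intro Bochner_Integration.integral_cong) (auto simp: E_def D_def algebra_simps)
    finally have "cmod ((\<integral>x. f z x * k x \<partial>M) - (\<integral>x. f w x * k x \<partial>M) - (\<integral>x. g x * k x \<partial>M) * (z - w))
        \<le> L2_norm M E * L2_norm M k" using L2_norm_integral_mult_le[OF EL k] by simp
    also have "\<dots> \<le> 2 * C * C * L2_norm M (f w) * (cmod (z - w))\<^sup>2 * L2_norm M k"
      by (intro mult_right_mono En) auto
    finally show ?thesis by (simp add: K_def algebra_simps)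
  qed
  have "((\<lambda>z. \<integral>x. f z x * k x \<partial>M) has_field_derivative (\<integral>x. g x * k x \<partial>M)) (at w)"
    unfolding has_field_derivative_def has_derivative_at_alt
  proof (intro conjI allI impI)
    show "bounded_linear ((*) (\<integral>x. g x * k x \<partial>M))" by (rule bounded_linear_mult_right)
    fix e :: real assume e: "0 < e"
    define \<delta> where "\<delta> = min (min r (1 / (2 * C))) (e / (K + 1))"
    have "\<delta> > 0" using r(1) C(1) e K0 by (simp add: \<delta>_def)
    moreover have "cmod ((\<integral>x. f z x * k x \<partial>M) - (\<integral>x. f w x * k x \<partial>M) - (\<integral>x. g x * k x \<partial>M) * (z - w)) \<le> e * cmod (z - w)"
      if "cmod (z - w) < \<delta>" for z
    proof -
      have "K * cmod (z - w) \<le> e"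
      proof -
        have "(K + 1) * cmod (z - w) \<le> e" using that K0 by (simp add: \<delta>_def field_simps)
        then have "K * cmod (z - w) + cmod (z - w) \<le> e" by (simp add: distrib_right)
        then show ?thesis using norm_ge_zero[of "z - w"] by linarith
      qed
      then have "K * cmod (z - w) * cmod (z - w) \<le> e * cmod (z - w)" by (intro mult_right_mono) auto
      then show ?thesis using est[of z] that by (simp add: \<delta>_def power2_eq_square mult.assoc)
    qed
    ultimately show "\<exists>d>0. \<forall>y. cmod (y - w) < d \<longrightarrow> cmod ((\<integral>x. f y x * k x \<partial>M) - (\<integral>x. f w x * k x \<partial>M)
        - (\<integral>x. g x * k x \<partial>M) * (y - w)) \<le> e * cmod (y - w)" by blast
  qed
  then show "(\<lambda>z. \<integral>x. f z x * k x \<partial>M) field_differentiable at w within U"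
    using field_differentiable_at_within field_differentiable_def by blast
qed

end

text \<open>Completeness of Lebesgue measure, applied to the extensions by zero. It lets almost
  everywhere identities for \<open>tau\<close> transfer measurability.\<close>

lemma borel_measurable_lebesgue_on_cong_AE:
  fixes f g :: "real \<Rightarrow> complex"
  assumes A: "A \<in> sets lebesgue" and f: "f \<in> borel_measurable (lebesgue_on A)"
    and ae: "AE x in lebesgue_on A. f x = g x"
  shows "g \<in> borel_measurable (lebesgue_on A)"
proof -
  have "(\<lambda>x. if x \<in> A then f x else 0) \<in> borel_measurable lebesgue"
    using f A by (rule borel_measurable_if_I)
  moreover have "AE x in lebesgue. x \<in> A \<longrightarrow> f x = g x"
    using ae A by (simp add: AE_restrict_space_iff)
  then have "AE x in lebesgue. (if x \<in> A then f x else 0) = (if x \<in> A then g x else 0)"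
    by eventually_elim simp
  ultimately have "(\<lambda>x. if x \<in> A then g x else 0) \<in> borel_measurable lebesgue"
    by (rule borel_measurable_AE)
  then show ?thesis by (rule borel_measurable_if_D)
qed

context sturm_liouville
begin

subsection \<open>The weighted spaces\<close>

lemma AE_lebesgue_on_mono:
  assumes "A \<in> sets lebesgue" "A \<subseteq> I" "ae_I P"
  shows "AE x in lebesgue_on A. P x"
proof -
  have "AE x in lebesgue. x \<in> I \<longrightarrow> P x" using assms(3) by (simp add: AE_restrict_space_iff)
  then have "AE x in lebesgue. x \<in> A \<longrightarrow> P x" by eventually_elim (use assms(2) in auto)
  then show ?thesis using assms(1) by (simp add: AE_restrict_space_iff)
qed

lemma measurable_r: "A \<subseteq> I \<Longrightarrow> rc \<tau> \<in> borel_measurable (lebesgue_on A)"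
  using sl by (auto simp: sl_expression_def intro: measurable_restrict_mono)

lemma sets_weight [simp]: "sets (weight_measure \<tau> A) = sets (lebesgue_on A)"
  and space_weight [simp]: "space (weight_measure \<tau> A) = A"
  by (simp_all add: weight_measure_def)

lemma measurable_weight [simp]: "borel_measurable (weight_measure \<tau> A) = borel_measurable (lebesgue_on A)"
  by (rule measurable_cong_sets) simp_all

text \<open>The density \<open>r\<close> is positive almost everywhere, so it creates no new null
  sets.\<close>

lemma AE_weight:
  assumes "A \<in> sets lebesgue" "A \<subseteq> I"
  shows "(AE x in weight_measure \<tau> A. P x) \<longleftrightarrow> (AE x in lebesgue_on A. P x)"
proof -
  have "(AE x in weight_measure \<tau> A. P x) \<longleftrightarrow> (AE x in lebesgue_on A. 0 < ennreal (rc \<tau> x) \<longrightarrow> P x)"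
    unfolding weight_measure_def using measurable_r[OF assms(2)] by (intro AE_density) simp
  also have "\<dots> \<longleftrightarrow> (AE x in lebesgue_on A. P x)"
    using AE_lebesgue_on_mono[OF assms ae_r_pos] by (intro eventually_cong) (auto elim: eventually_mono)
  finally show ?thesis .
qed

lemma AE_sl_measure [simp]: "(AE x in sl_measure \<tau>. P x) \<longleftrightarrow> ae_I P"
  by (rule AE_weight) auto

lemma integrable_weight_iff:
  fixes f :: "real \<Rightarrow> 'b::{banach, second_countable_topology}"
  assumes "A \<in> sets lebesgue" "A \<subseteq> I" "f \<in> borel_measurable (lebesgue_on A)"
  shows "integrable (weight_measure \<tau> A) f \<longleftrightarrow> set_integrable lebesgue A (\<lambda>x. rc \<tau> x *\<^sub>R f x)"
proof -
  have "AE x in lebesgue_on A. 0 \<le> rc \<tau> x"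
    using AE_lebesgue_on_mono[OF assms(1,2) ae_r_pos] by eventually_elim simp
  then have "integrable (weight_measure \<tau> A) f \<longleftrightarrow> integrable (lebesgue_on A) (\<lambda>x. rc \<tau> x *\<^sub>R f x)"
    unfolding weight_measure_def using measurable_r assms by (intro integrable_density) auto
  then show ?thesis using assms by (simp add: set_integrable_eq)
qed

lemma L2_weight_iff:
  assumes "A \<in> sets lebesgue" "A \<subseteq> I"
  shows "f \<in> L2 (weight_measure \<tau> A) \<longleftrightarrow> f \<in> borel_measurable (lebesgue_on A) \<and>
    set_integrable lebesgue A (\<lambda>x. rc \<tau> x * (cmod (f x))\<^sup>2)"
proof -
  have "f \<in> borel_measurable (lebesgue_on A) \<Longrightarrow> (\<lambda>x. (cmod (f x))\<^sup>2) \<in> borel_measurable (lebesgue_on A)"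
    by measurable
  then show ?thesis using integrable_weight_iff[OF assms, of "\<lambda>x. (cmod (f x))\<^sup>2"]
    by (auto simp: L2_def)
qed

lemma L2_weight_subset:
  assumes f: "f \<in> L2 (weight_measure \<tau> A)" and A: "A \<in> sets lebesgue" "A \<subseteq> I" and B: "B \<in> sets lebesgue" "B \<subseteq> A"
  shows "f \<in> L2 (weight_measure \<tau> B)"
proof -
  have "f \<in> borel_measurable (lebesgue_on B)"
    using f B(2) by (auto simp: L2_weight_iff[OF A] intro: measurable_restrict_mono)
  moreover have "set_integrable lebesgue B (\<lambda>x. rc \<tau> x * (cmod (f x))\<^sup>2)"
    using f unfolding L2_weight_iff[OF A] by (intro set_integrable_subset[OF _ B]) auto
  ultimately show ?thesis using A B by (subst L2_weight_iff) auto
qed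

lemma measurable_of_continuous:
  fixes f :: "real \<Rightarrow> complex"
  shows "continuous_on I f \<Longrightarrow> f \<in> borel_measurable (lebesgue_on I)"
  by (rule continuous_imp_measurable_on_sets_lebesgue) simp_all

subsection \<open>Behaviour near an endpoint\<close>

lemma end_part_open: "open (end_part \<tau> c x)"
  by (cases c) auto

lemma end_part_sets [simp]: "end_part \<tau> c x \<in> sets lebesgue"
  using end_part_open by auto

lemma ival_iff: "x \<in> I \<longleftrightarrow> lend \<tau> < ereal x \<and> ereal x < rend \<tau>"
  by (simp add: ival_def einterval_def)

lemma end_part_LeftEnd:
  assumes "x \<in> I" shows "end_part \<tau> LeftEnd x = {y \<in> I. y < x}"
proof -
  have "ereal y < rend \<tau>" if "y < x" for y
    using assms that unfolding ival_iff by (meson less_ereal.simps(1) less_trans)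
  then show ?thesis by (auto simp: ival_iff einterval_def)
qed

lemma end_part_RightEnd:
  assumes "x \<in> I" shows "end_part \<tau> RightEnd x = {y \<in> I. x < y}"
proof -
  have "lend \<tau> < ereal y" if "x < y" for y
    using assms that unfolding ival_iff by (meson less_ereal.simps(1) less_trans)
  then show ?thesis by (auto simp: ival_iff einterval_def)
qed

lemma end_part_subset: "x \<in> I \<Longrightarrow> end_part \<tau> c x \<subseteq> I"
  by (cases c) (auto simp: end_part_LeftEnd end_part_RightEnd simp del: end_part.simps)

lemma ival_neighbours:
  assumes "x \<in> I" obtains y z where "y \<in> I" "z \<in> I" "y < x" "x < z"
proof -
  obtain e where e: "e > 0" "ball x e \<subseteq> I" using assms open_ival open_contains_ball by blast
  then have "x - e / 2 \<in> I" "x + e / 2 \<in> I" by (auto simp: dist_real_def subset_iff)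
  then show ?thesis by (rule that) (use e(1) in auto)
qed

lemma end_part_nonempty:
  assumes "x \<in> I" shows "\<exists>y. y \<in> end_part \<tau> c x"
proof -
  obtain y z where "y \<in> I" "z \<in> I" "y < x" "x < z" using ival_neighbours[OF assms] .
  then show ?thesis
    using assms by (cases c) (auto simp: end_part_LeftEnd end_part_RightEnd simp del: end_part.simps)
qed

lemma ival_nonempty: "\<exists>x. x \<in> I"
proof -
  have "lend \<tau> < rend \<tau>" using sl by (simp add: sl_expression_def)
  then obtain x where "lend \<tau> < ereal x" "ereal x < rend \<tau>" using ereal_dense2 by blast
  then show ?thesis by (auto simp: ival_def einterval_def)
qed

lemma end_part_Icc:
  assumes "x0 \<in> I" "x \<in> end_part \<tau> c x0" "y \<in> end_part \<tau> c x0"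
  shows "{x..y} \<subseteq> end_part \<tau> c x0"
  using assms Icc_subset_ival[of x y]
  by (cases c) (auto simp: end_part_LeftEnd end_part_RightEnd simp del: end_part.simps)

lemma eventually_end_part:
  assumes "x \<in> I"
  shows "\<forall>\<^sub>F y in end_filter \<tau> c. y \<in> end_part \<tau> c x"
proof (cases c)
  case LeftEnd
  have "lend \<tau> < ereal x" using assms by (auto simp: ival_def einterval_def)
  then have "\<forall>\<^sub>F y in at_right (lend \<tau>). y \<in> {lend \<tau><..<ereal x}"
    by (rule eventually_at_rightI[rotated]) simp
  then have "\<forall>\<^sub>F y in filtercomap ereal (at_right (lend \<tau>)). ereal y \<in> {lend \<tau><..<ereal x}"
    by (rule eventually_filtercomapI)
  then show ?thesis using LeftEnd by (simp add: einterval_def)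
next
  case RightEnd
  have "ereal x < rend \<tau>" using assms by (auto simp: ival_def einterval_def)
  then have "\<forall>\<^sub>F y in at_left (rend \<tau>). y \<in> {ereal x<..<rend \<tau>}"
    by (rule eventually_at_leftI[rotated]) simp
  then have "\<forall>\<^sub>F y in filtercomap ereal (at_left (rend \<tau>)). ereal y \<in> {ereal x<..<rend \<tau>}"
    by (rule eventually_filtercomapI)
  then show ?thesis using RightEnd by (simp add: einterval_def)
qed

lemma eventually_ival: "\<forall>\<^sub>F y in end_filter \<tau> c. y \<in> I"
proof -
  obtain x where x: "x \<in> I" using ival_nonempty by blast
  from eventually_end_part[OF x] show ?thesis
    by eventually_elim (use end_part_subset[OF x] in blast)
qed

lemma L2_near_lincomb:
  assumes "L2_near \<tau> c f" "L2_near \<tau> c g"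
  shows "L2_near \<tau> c (\<lambda>x. a * f x + b * g x)"
  using assms unfolding L2_near_def by (auto intro: L2_lincomb)

lemma L2_near_cnj: "L2_near \<tau> c f \<Longrightarrow> L2_near \<tau> c (\<lambda>x. cnj (f x))"
  unfolding L2_near_def by (auto intro: L2_cnj)

lemma L2_near_of_L2: "f \<in> L2 (sl_measure \<tau>) \<Longrightarrow> L2_near \<tau> c f"
  unfolding L2_near_def using end_part_subset by (auto intro!: L2_weight_subset[of f I])

lemma L2_near_cong_ae:
  assumes f: "L2_near \<tau> c f" and ae: "ae_I (\<lambda>x. f x = g x)"
  shows "L2_near \<tau> c g"
  unfolding L2_near_def
proof
  fix x assume x: "x \<in> I"
  let ?A = "end_part \<tau> c x"
  have A: "?A \<in> sets lebesgue" "?A \<subseteq> I" using end_part_subset[OF x] by auto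
  have fL: "f \<in> L2 (weight_measure \<tau> ?A)" using f x by (auto simp: L2_near_def)
  have ae': "AE x in lebesgue_on ?A. f x = g x" by (rule AE_lebesgue_on_mono[OF A ae])
  have "g \<in> borel_measurable (lebesgue_on ?A)"
    using L2_measurable[OF fL] by (intro borel_measurable_lebesgue_on_cong_AE[OF A(1) _ ae']) simp
  then show "g \<in> L2 (weight_measure \<tau> ?A)"
    using ae' by (intro L2_cong_AE[OF fL]) (simp_all add: AE_weight[OF A])
qed

lemma L2_sl_measure_cong_ae:
  assumes f: "f \<in> L2 (sl_measure \<tau>)" and ae: "ae_I (\<lambda>x. f x = g x)"
  shows "g \<in> L2 (sl_measure \<tau>)"
  using borel_measurable_lebesgue_on_cong_AE[OF sets_ival _ ae] L2_measurable[OF f] ae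
  by (intro L2_cong_AE[OF f]) auto

lemma L2_of_L2_near:
  assumes f: "f \<in> borel_measurable (lebesgue_on I)" and c: "c \<in> I"
    and f1: "L2_near \<tau> LeftEnd f1" "\<And>x. x \<in> I \<Longrightarrow> x \<le> c \<Longrightarrow> f x = f1 x"
    and f2: "L2_near \<tau> RightEnd f2" "\<And>x. x \<in> I \<Longrightarrow> c < x \<Longrightarrow> f x = f2 x"
  shows "f \<in> L2 (sl_measure \<tau>)"
proof -
  \<comment> \<open>\<open>L2_near\<close> speaks of open end parts; to include the point
    \<open>c\<close> itself the left one is taken up to some \<open>c'\<close> beyond it.\<close>
  obtain c' where c': "c' \<in> I" "c < c'" using ival_neighbours[OF c] by metis
  let ?A = "I \<inter> {..c}" and ?A' = "end_part \<tau> LeftEnd c'" and ?B = "end_part \<tau> RightEnd c"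
  have A': "?A' \<in> sets lebesgue" "?A' \<subseteq> I" and B: "?B \<in> sets lebesgue" "?B \<subseteq> I"
    using end_part_subset c c' by (auto simp del: end_part.simps)
  have A: "?A \<in> sets lebesgue" "?A \<subseteq> I" by auto
  have "?A \<subseteq> ?A'" using c'(2) unfolding end_part_LeftEnd[OF c'(1)] by auto
  then have "f1 \<in> L2 (weight_measure \<tau> ?A)"
    using f1(1) c' A' A by (intro L2_weight_subset[of f1 ?A' ?A]) (auto simp: L2_near_def simp del: end_part.simps)
  then have "set_integrable lebesgue ?A (\<lambda>x. rc \<tau> x * (cmod (f1 x))\<^sup>2)"
    by (simp add: L2_weight_iff[OF A])
  also have "set_integrable lebesgue ?A (\<lambda>x. rc \<tau> x * (cmod (f1 x))\<^sup>2) \<longleftrightarrow> set_integrable lebesgue ?A (\<lambda>x. rc \<tau> x * (cmod (f x))\<^sup>2)"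
    using f1(2) by (intro set_integrable_cong) auto
  finally have 1: "set_integrable lebesgue ?A (\<lambda>x. rc \<tau> x * (cmod (f x))\<^sup>2)" .
  have "f2 \<in> L2 (weight_measure \<tau> ?B)" using f2(1) c by (auto simp: L2_near_def simp del: end_part.simps)
  then have "set_integrable lebesgue ?B (\<lambda>x. rc \<tau> x * (cmod (f2 x))\<^sup>2)"
    by (simp add: L2_weight_iff[OF B] del: end_part.simps)
  also have "set_integrable lebesgue ?B (\<lambda>x. rc \<tau> x * (cmod (f2 x))\<^sup>2) \<longleftrightarrow> set_integrable lebesgue ?B (\<lambda>x. rc \<tau> x * (cmod (f x))\<^sup>2)"
    using f2(2) by (intro set_integrable_cong) (auto simp: end_part_RightEnd[OF c] simp del: end_part.simps)
  finally have 2: "set_integrable lebesgue ?B (\<lambda>x. rc \<tau> x * (cmod (f x))\<^sup>2)" .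
  have "?A \<union> ?B = I" unfolding end_part_RightEnd[OF c] by auto
  then have "set_integrable lebesgue I (\<lambda>x. rc \<tau> x * (cmod (f x))\<^sup>2)"
    using set_integrable_Un[OF 1 2 A(1) B(1)] by simp
  then show ?thesis using f by (simp add: L2_weight_iff)
qed

text \<open>One-sided version of \<open>dom_max\<close>: a solution square integrable near one
  endpoint belongs here without having to be square integrable near the other.\<close>

definition regular_near :: "endpoint \<Rightarrow> (real \<Rightarrow> complex) \<Rightarrow> bool" where
  "regular_near c f \<longleftrightarrow> f \<in> D_tau \<tau> \<and> L2_near \<tau> c f \<and> L2_near \<tau> c (tau \<tau> f)"

lemma regular_near_dom_max: "f \<in> dom_max \<tau> \<Longrightarrow> regular_near c f"
  by (auto simp: dom_max_def regular_near_def intro: L2_near_of_L2)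

lemma sys_solution: "solution \<tau> z u \<Longrightarrow> sys u (quasi_deriv \<tau> u) (\<lambda>x. z * u x)"
  by (rule sys_cong_ae[OF sys_of_D_tau]) (auto simp: solution_def)

lemma regular_near_solution:
  assumes "solution \<tau> z u" "L2_near \<tau> c u"
  shows "regular_near c u"
proof -
  have "L2_near \<tau> c (\<lambda>x. z * u x)" using L2_near_lincomb[OF assms(2,2), of z 0] by simp
  then have "L2_near \<tau> c (tau \<tau> u)"
    by (rule L2_near_cong_ae) (use assms(1) in \<open>auto simp: solution_def\<close>)
  then show ?thesis using assms by (auto simp: regular_near_def solution_def)
qed

lemma regular_near_cnj:
  assumes "regular_near c f"
  shows "regular_near c (\<lambda>x. cnj (f x))"
proof -
  have f: "f \<in> D_tau \<tau>" using assms by (simp add: regular_near_def)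
  note s = sys_imp_D_tau[OF sys_cnj[OF sys_of_D_tau[OF f]]]
  have "L2_near \<tau> c (tau \<tau> (\<lambda>x. cnj (f x)))"
    by (rule L2_near_cong_ae[OF L2_near_cnj[of c "tau \<tau> f"]])
       (use assms s(3) in \<open>auto simp: regular_near_def elim: eventually_mono\<close>)
  then show ?thesis using s(1) assms by (auto simp: regular_near_def intro: L2_near_cnj)
qed

lemma wronskian_cnj:
  assumes "f \<in> D_tau \<tau>" "g \<in> D_tau \<tau>" "x \<in> I"
  shows "wronskian \<tau> (\<lambda>x. cnj (f x)) (\<lambda>x. cnj (g x)) x = cnj (wronskian \<tau> f g x)"
  using sys_imp_D_tau(2)[OF sys_cnj[OF sys_of_D_tau[OF assms(1)]] assms(3)]
    sys_imp_D_tau(2)[OF sys_cnj[OF sys_of_D_tau[OF assms(2)]] assms(3)]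
  by (simp add: wronskian_def)

lemma wronskian_lincomb:
  assumes "f \<in> D_tau \<tau>" "g \<in> D_tau \<tau>" "x \<in> I"
  shows "wronskian \<tau> (\<lambda>x. a * f x + b * g x) k x = a * wronskian \<tau> f k x + b * wronskian \<tau> g k x"
  using sys_imp_D_tau(2)[OF sys_lincomb[OF sys_of_D_tau[OF assms(1)] sys_of_D_tau[OF assms(2)]] assms(3)]
  by (simp add: wronskian_def algebra_simps)

text \<open>By the Lagrange identity, increments of the Wronskian are integrals of a function
  integrable near the endpoint. Boundedness in place of convergence is enough, because these
  Wronskians only occur as factors next to ones that tend to zero.\<close>

lemma wronskian_bounded:
  assumes f: "regular_near c f" and g: "regular_near c g"
  obtains B where "\<forall>\<^sub>F x in end_filter \<tau> c. norm (wronskian \<tau> f g x) \<le> B"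
proof -
  obtain x1 where x1: "x1 \<in> I" using ival_nonempty by blast
  let ?J = "end_part \<tau> c x1"
  have J: "?J \<in> sets lebesgue" "?J \<subseteq> I" using end_part_subset[OF x1] by auto
  obtain x0 where x0: "x0 \<in> ?J" using end_part_nonempty[OF x1] by blast
  define k where "k x = g x * tau \<tau> f x - f x * tau \<tau> g x" for x
  have L: "f \<in> L2 (weight_measure \<tau> ?J)" "g \<in> L2 (weight_measure \<tau> ?J)"
    "tau \<tau> f \<in> L2 (weight_measure \<tau> ?J)" "tau \<tau> g \<in> L2 (weight_measure \<tau> ?J)"
    using f g x1 by (auto simp: regular_near_def L2_near_def)
  have int: "integrable (weight_measure \<tau> ?J) k"
    unfolding k_def using L by (intro Bochner_Integration.integrable_diff L2_mult_integrable)
  then have "k \<in> borel_measurable (lebesgue_on ?J)"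
    using borel_measurable_integrable by fastforce
  then have "(\<lambda>x. rc \<tau> x *\<^sub>R k x) absolutely_integrable_on ?J"
    using int by (simp add: integrable_weight_iff[OF J])
  then have kJ: "(\<lambda>x. norm (rc \<tau> x *\<^sub>R k x)) integrable_on ?J"
    by (simp add: absolutely_integrable_on_def)
  define B where "B = norm (wronskian \<tau> f g x0) + integral ?J (\<lambda>x. norm (rc \<tau> x *\<^sub>R k x))"
  have s: "sys f (quasi_deriv \<tau> f) (tau \<tau> f)" "sys g (quasi_deriv \<tau> g) (tau \<tau> g)"
    using f g by (auto simp: regular_near_def intro: sys_of_D_tau)
  have step: "norm (wronskian \<tau> f g d - wronskian \<tau> f g e) \<le> integral ?J (\<lambda>x. norm (rc \<tau> x *\<^sub>R k x))"
    if de: "d \<in> ?J" "e \<in> ?J" "e \<le> d" for d e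
  proof -
    have sub: "{e..d} \<subseteq> ?J" using end_part_Icc[OF x1 de(2,1)] .
    have "((\<lambda>x. rc \<tau> x *\<^sub>R k x) has_integral (wronskian \<tau> f g d - wronskian \<tau> f g e)) {e..d}"
      using sys_lagrange[OF s de(3)] sub J(2) by (simp add: wronskian_def k_def scaleR_conv_of_real)
    moreover have "(\<lambda>x. norm (rc \<tau> x *\<^sub>R k x)) integrable_on {e..d}"
      using kJ sub by (rule integrable_on_subinterval)
    ultimately have "norm (integral {e..d} (\<lambda>x. rc \<tau> x *\<^sub>R k x)) \<le> integral {e..d} (\<lambda>x. norm (rc \<tau> x *\<^sub>R k x))"
      and "integral {e..d} (\<lambda>x. rc \<tau> x *\<^sub>R k x) = wronskian \<tau> f g d - wronskian \<tau> f g e"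
      by (auto intro!: Henstock_Kurzweil_Integration.integral_norm_bound_integral integral_unique
          simp del: norm_scaleR dest: has_integral_integrable)
    then have "norm (wronskian \<tau> f g d - wronskian \<tau> f g e) \<le> integral {e..d} (\<lambda>x. norm (rc \<tau> x *\<^sub>R k x))"
      by simp
    also have "\<dots> \<le> integral ?J (\<lambda>x. norm (rc \<tau> x *\<^sub>R k x))"
      using sub kJ by (intro integral_subset_le integrable_on_subinterval[OF kJ sub]) auto
    finally show ?thesis .
  qed
  have "norm (wronskian \<tau> f g x) \<le> B" if x: "x \<in> ?J" for x
  proof -
    have "norm (wronskian \<tau> f g x - wronskian \<tau> f g x0) \<le> integral ?J (\<lambda>x. norm (rc \<tau> x *\<^sub>R k x))"
      using step[OF x x0] step[OF x0 x] by (cases "x0 \<le> x") (auto simp: norm_minus_commute)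
    then show ?thesis
      unfolding B_def using norm_triangle_sub[of "wronskian \<tau> f g x" "wronskian \<tau> f g x0"] by linarith
  qed
  then have "\<forall>\<^sub>F x in end_filter \<tau> c. norm (wronskian \<tau> f g x) \<le> B"
    using eventually_end_part[OF x1, of c] by (auto elim: eventually_mono)
  then show ?thesis by (rule that)
qed

lemma wronskian_at_lincomb:
  assumes "f \<in> D_tau \<tau>" "g \<in> D_tau \<tau>" "wronskian_at \<tau> c f k 0" "wronskian_at \<tau> c g k 0"
  shows "wronskian_at \<tau> c (\<lambda>x. a * f x + b * g x) k 0"
proof -
  have "((\<lambda>x. a * wronskian \<tau> f k x + b * wronskian \<tau> g k x) \<longlongrightarrow> a * 0 + b * 0) (end_filter \<tau> c)"
    using assms(3,4) unfolding wronskian_at_def by (intro tendsto_intros)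
  moreover have "\<forall>\<^sub>F x in end_filter \<tau> c. a * wronskian \<tau> f k x + b * wronskian \<tau> g k x = wronskian \<tau> (\<lambda>x. a * f x + b * g x) k x"
    using eventually_ival by eventually_elim (simp add: wronskian_lincomb[OF assms(1,2)])
  ultimately show ?thesis unfolding wronskian_at_def by (simp add: tendsto_cong)
qed

text \<open>The boundary condition does not change when \<open>v\<close> is replaced by its conjugate: by the
  Pluecker identity for \<open>u\<close>, \<open>v\<close>, its conjugate and a function \<open>h\<close> not satisfying the condition.\<close>

lemma wronskian_at_cnj:
  assumes v: "boundary_function \<tau> c v" and u: "regular_near c u" and bc: "wronskian_at \<tau> c u (\<lambda>x. cnj (v x)) 0"
  shows "wronskian_at \<tau> c (\<lambda>x. cnj (u x)) (\<lambda>x. cnj (v x)) 0"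
proof -
  let ?F = "end_filter \<tau> c" and ?v' = "\<lambda>x. cnj (v x)"
  obtain h w where h: "h \<in> dom_max \<tau>" "w \<noteq> 0" "(wronskian \<tau> h ?v' \<longlongrightarrow> w) ?F"
    and v: "v \<in> dom_max \<tau>" "(wronskian \<tau> v ?v' \<longlongrightarrow> 0) ?F"
    using v by (auto simp: boundary_function_def wronskian_at_def)
  have rv: "regular_near c v" and rh: "regular_near c h" using v(1) h(1) by (auto intro: regular_near_dom_max)
  obtain B1 where B1: "\<forall>\<^sub>F x in ?F. norm (wronskian \<tau> h v x) \<le> B1" using wronskian_bounded[OF rh rv] .
  obtain B2 where B2: "\<forall>\<^sub>F x in ?F. norm (wronskian \<tau> u h x) \<le> B2" using wronskian_bounded[OF u rh] .
  have "((\<lambda>x. wronskian \<tau> u ?v' x * wronskian \<tau> h v x) \<longlongrightarrow> 0) ?F"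
    using bc B1 unfolding wronskian_at_def by (rule lim_null_mult_right_bounded)
  moreover have "((\<lambda>x. wronskian \<tau> u h x * wronskian \<tau> v ?v' x) \<longlongrightarrow> 0) ?F"
    using B2 v(2) by (rule lim_null_mult_left_bounded)
  ultimately have "((\<lambda>x. (wronskian \<tau> u ?v' x * wronskian \<tau> h v x + wronskian \<tau> u h x * wronskian \<tau> v ?v' x) / wronskian \<tau> h ?v' x) \<longlongrightarrow> (0 + 0) / w) ?F"
    using h(2,3) by (intro tendsto_divide tendsto_add)
  then have "((\<lambda>x. (wronskian \<tau> u ?v' x * wronskian \<tau> h v x + wronskian \<tau> u h x * wronskian \<tau> v ?v' x) / wronskian \<tau> h ?v' x) \<longlongrightarrow> 0) ?F"
    by simp
  moreover have "\<forall>\<^sub>F x in ?F. (wronskian \<tau> u ?v' x * wronskian \<tau> h v x + wronskian \<tau> u h x * wronskian \<tau> v ?v' x) / wronskian \<tau> h ?v' x = wronskian \<tau> u v x"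
    using tendsto_imp_eventually_ne[OF h(3,2)]
  proof eventually_elim
    case (elim x)
    have "wronskian \<tau> u ?v' x * wronskian \<tau> h v x + wronskian \<tau> u h x * wronskian \<tau> v ?v' x = wronskian \<tau> u v x * wronskian \<tau> h ?v' x"
      unfolding wronskian_def by (simp add: algebra_simps)
    then show ?case using elim by simp
  qed
  ultimately have "(wronskian \<tau> u v \<longlongrightarrow> 0) ?F" by (simp add: tendsto_cong)
  then have "((\<lambda>x. cnj (wronskian \<tau> u v x)) \<longlongrightarrow> cnj 0) ?F" by (rule tendsto_cnj)
  moreover have "\<forall>\<^sub>F x in ?F. cnj (wronskian \<tau> u v x) = wronskian \<tau> (\<lambda>x. cnj (u x)) ?v' x"
    using eventually_ival
    by eventually_elim (use u rv in \<open>simp add: wronskian_cnj regular_near_def\<close>)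
  ultimately show ?thesis unfolding wronskian_at_def by (simp add: tendsto_cong)
qed

end

context sturm_liouville
begin

subsection \<open>Separated restrictions\<close>

lemma solution_D_tau: "solution \<tau> z u \<Longrightarrow> u \<in> D_tau \<tau>"
  by (simp add: solution_def)

lemma D_tau_continuous: "f \<in> D_tau \<tau> \<Longrightarrow> continuous_on I f"
  using AC_loc_continuous_on[OF _ open_ival] by (auto simp: D_tau_def)

lemma D_tau_measurable: "f \<in> D_tau \<tau> \<Longrightarrow> f \<in> borel_measurable (lebesgue_on I)"
  by (intro measurable_of_continuous D_tau_continuous)

lemma solution_lincomb:
  assumes "solution \<tau> z f" "solution \<tau> z g"
  shows "solution \<tau> z (\<lambda>x. a * f x + b * g x)"
proof -
  note s = sys_imp_D_tau[OF sys_lincomb[OF sys_solution[OF assms(1)] sys_solution[OF assms(2)], of a b]]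
  have "ae_I (\<lambda>x. tau \<tau> (\<lambda>x. a * f x + b * g x) x - z * (a * f x + b * g x) = 0)"
    using s(3) by eventually_elim (simp add: algebra_simps)
  then show ?thesis using s(1) by (simp add: solution_def)
qed

lemma boundary_cond_lincomb:
  assumes "f \<in> D_tau \<tau>" "g \<in> D_tau \<tau>" "boundary_cond \<tau> v c f" "boundary_cond \<tau> v c g"
  shows "boundary_cond \<tau> v c (\<lambda>x. a * f x + b * g x)"
  using assms by (auto simp: boundary_cond_def intro: wronskian_at_lincomb)

lemma in_dom_near_lincomb:
  assumes "f \<in> D_tau \<tau>" "g \<in> D_tau \<tau>" "in_dom_near \<tau> v c f" "in_dom_near \<tau> v c g"
  shows "in_dom_near \<tau> v c (\<lambda>x. a * f x + b * g x)"
  using assms by (auto simp: in_dom_near_def intro: L2_near_lincomb boundary_cond_lincomb)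

lemma boundary_cond_cnj:
  assumes "\<And>c. limit_circle \<tau> c \<Longrightarrow> boundary_function \<tau> c (v c)"
    and "regular_near c f" "boundary_cond \<tau> v c f"
  shows "boundary_cond \<tau> v c (\<lambda>x. cnj (f x))"
  using assms by (auto simp: boundary_cond_def intro: wronskian_at_cnj)

lemma mem_separated_restriction:
  "(f, u) \<in> separated_restriction \<tau> v \<longleftrightarrow> f \<in> dom_max \<tau> \<and> u = tau \<tau> f \<and> (\<forall>c. boundary_cond \<tau> v c f)"
  by (auto simp: separated_restriction_def T_max_def)

lemma ae_linear_separated_restriction: "ae_linear (sl_measure \<tau>) (separated_restriction \<tau> v)"
  unfolding ae_linear_def
proof (intro conjI)
  show "separated_restriction \<tau> v \<subseteq> L2 (sl_measure \<tau>) \<times> L2 (sl_measure \<tau>)"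
    by (auto simp: separated_restriction_def T_max_def dom_max_def)
  have "\<exists>k. ((\<lambda>x. f x + a * g x), k) \<in> separated_restriction \<tau> v \<and> (AE x in sl_measure \<tau>. k x = u x + a * w x)"
    if "(f, u) \<in> separated_restriction \<tau> v" "(g, w) \<in> separated_restriction \<tau> v" for f u g w a
  proof -
    have f: "f \<in> D_tau \<tau>" "f \<in> L2 (sl_measure \<tau>)" "tau \<tau> f \<in> L2 (sl_measure \<tau>)" "u = tau \<tau> f" "\<And>c. boundary_cond \<tau> v c f"
      and g: "g \<in> D_tau \<tau>" "g \<in> L2 (sl_measure \<tau>)" "tau \<tau> g \<in> L2 (sl_measure \<tau>)" "w = tau \<tau> g" "\<And>c. boundary_cond \<tau> v c g"
      using that by (auto simp: mem_separated_restriction dom_max_def)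
    let ?k = "\<lambda>x. 1 * f x + a * g x"
    note s = sys_imp_D_tau[OF sys_lincomb[OF sys_of_D_tau[OF f(1)] sys_of_D_tau[OF g(1)], of 1 a]]
    have "ae_I (\<lambda>x. 1 * tau \<tau> f x + a * tau \<tau> g x = tau \<tau> ?k x)"
      using s(3) by eventually_elim simp
    then have "tau \<tau> ?k \<in> L2 (sl_measure \<tau>)"
      by (rule L2_sl_measure_cong_ae[OF L2_lincomb[OF f(3) g(3)]])
    then have "?k \<in> dom_max \<tau>"
      using s(1) L2_lincomb[OF f(2) g(2), of 1 a] by (simp add: dom_max_def)
    moreover have "boundary_cond \<tau> v c ?k" for c
      by (intro boundary_cond_lincomb f g)
    ultimately have "(?k, tau \<tau> ?k) \<in> separated_restriction \<tau> v"
      by (simp add: mem_separated_restriction)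
    moreover have "AE x in sl_measure \<tau>. tau \<tau> ?k x = u x + a * w x"
      using s(3) f(4) g(4) by simp
    ultimately show ?thesis by auto
  qed
  then show "\<forall>(f, u)\<in>separated_restriction \<tau> v. \<forall>(g, w)\<in>separated_restriction \<tau> v. \<forall>a.
    \<exists>k. ((\<lambda>x. f x + a * g x), k) \<in> separated_restriction \<tau> v \<and> (AE x in sl_measure \<tau>. k x = u x + a * w x)"
    by blast
qed

lemma eigenfunction_eq_0:
  assumes z: "z \<in> resolvent_set (sl_measure \<tau>) (separated_restriction \<tau> v)"
    and u: "solution \<tau> z u" "in_dom_near \<tau> v LeftEnd u" "in_dom_near \<tau> v RightEnd u"
    and x: "x \<in> I"
  shows "u x = 0"
proof -
  have D: "u \<in> D_tau \<tau>" and ae: "ae_I (\<lambda>x. tau \<tau> u x - z * u x = 0)" using u(1) by (auto simp: solution_def)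
  have uL: "u \<in> L2 (sl_measure \<tau>)"
    using u(2,3) by (intro L2_of_L2_near[OF D_tau_measurable[OF D] x]) (auto simp: in_dom_near_def)
  then have "tau \<tau> u \<in> L2 (sl_measure \<tau>)"
    by (rule L2_sl_measure_cong_ae[OF L2_scale[of u _ z]]) (use ae in auto)
  then have "u \<in> dom_max \<tau>" using uL D by (simp add: dom_max_def)
  moreover have "boundary_cond \<tau> v c u" for c using u(2,3) by (cases c) (auto simp: in_dom_near_def)
  ultimately have "(u, tau \<tau> u) \<in> separated_restriction \<tau> v" by (simp add: mem_separated_restriction)
  then have "AE x in sl_measure \<tau>. u x = 0"
    by (rule resolvent_injective[OF z]) (use ae in simp)
  then show "u x = 0"
    by (intro AE_eq_imp_eq_on_open[OF open_ival D_tau_continuous[OF D] continuous_on_const _ x]) simp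
qed

section \<open>Invariance of the separated restriction under complex conjugation\<close>

lemma separated_restriction_cnj:
  assumes v: "\<And>c. limit_circle \<tau> c \<Longrightarrow> boundary_function \<tau> c (v c)"
    and fu: "(f, u) \<in> separated_restriction \<tau> v"
  obtains w where "((\<lambda>x. cnj (f x)), w) \<in> separated_restriction \<tau> v" "ae_I (\<lambda>x. w x = cnj (u x))"
proof -
  have f: "f \<in> dom_max \<tau>" "u = tau \<tau> f" "\<And>c. boundary_cond \<tau> v c f"
    using fu by (auto simp: mem_separated_restriction)
  then have D: "f \<in> D_tau \<tau>" by (simp add: dom_max_def)
  note s = sys_imp_D_tau[OF sys_cnj[OF sys_of_D_tau[OF D]]]
  have "ae_I (\<lambda>x. cnj (tau \<tau> f x) = tau \<tau> (\<lambda>x. cnj (f x)) x)"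
    using s(3) by eventually_elim simp
  moreover have fL: "f \<in> L2 (sl_measure \<tau>)" "tau \<tau> f \<in> L2 (sl_measure \<tau>)" using f(1) by (simp_all add: dom_max_def)
  ultimately have "tau \<tau> (\<lambda>x. cnj (f x)) \<in> L2 (sl_measure \<tau>)"
    by (intro L2_sl_measure_cong_ae[OF L2_cnj[OF fL(2)]])
  then have "(\<lambda>x. cnj (f x)) \<in> dom_max \<tau>" using s(1) L2_cnj[OF fL(1)] by (simp add: dom_max_def)
  then have "((\<lambda>x. cnj (f x)), tau \<tau> (\<lambda>x. cnj (f x))) \<in> separated_restriction \<tau> v"
    using boundary_cond_cnj[OF v regular_near_dom_max[OF f(1)] f(3)] by (simp add: mem_separated_restriction)
  then show ?thesis by (rule that) (use s(3) f(2) in simp)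
qed

text \<open>Up to null sets, conjugation maps the graph to itself and preserves norms, and it turns
  \<open>S - z\<close> into \<open>S - cnj z\<close>; each of the three conditions carries over. It
  is needed so that the defining property of \<open>m\<close> is available at
  \<open>cnj z\<close>.\<close>

lemma cnj_resolvent_set:
  assumes v: "\<And>c. limit_circle \<tau> c \<Longrightarrow> boundary_function \<tau> c (v c)"
    and z: "z \<in> resolvent_set (sl_measure \<tau>) (separated_restriction \<tau> v)"
  shows "cnj z \<in> resolvent_set (sl_measure \<tau>) (separated_restriction \<tau> v)"
proof -
  let ?M = "sl_measure \<tau>" and ?S = "separated_restriction \<tau> v"
  have SL: "f \<in> L2 ?M" "u \<in> L2 ?M" if "(f, u) \<in> ?S" for f u
    using that by (auto simp: mem_separated_restriction dom_max_def)
  note Z = z[unfolded resolvent_set_iff]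
  show ?thesis
    unfolding resolvent_set_iff
  proof (intro conjI)
    have "AE x in ?M. f x = 0" if fu: "(f, u) \<in> ?S" "AE x in ?M. u x - cnj z * f x = 0" for f u
    proof -
      obtain w where w: "((\<lambda>x. cnj (f x)), w) \<in> ?S" "ae_I (\<lambda>x. w x = cnj (u x))"
        using separated_restriction_cnj[OF v fu(1)] .
      have "ae_I (\<lambda>x. u x - cnj z * f x = 0)" using fu(2) by simp
      with w(2) have "ae_I (\<lambda>x. w x - z * cnj (f x) = 0)"
      proof eventually_elim
        case (elim x)
        then show ?case by (metis complex_cnj_cnj complex_cnj_diff complex_cnj_mult complex_cnj_zero)
      qed
      then have "AE x in ?M. cnj (f x) = 0" by (intro resolvent_injective[OF z w(1)]) simp
      then show ?thesis by simp
    qed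
    then show "\<forall>(f, u)\<in>?S. (AE x in ?M. u x - cnj z * f x = 0) \<longrightarrow> (AE x in ?M. f x = 0)" by blast
    show "\<forall>h\<in>L2 ?M. \<exists>f. solves ?M ?S (cnj z) f h"
    proof
      fix h assume "h \<in> L2 ?M"
      then obtain f where "solves ?M ?S z f (\<lambda>x. cnj (h x))" using Z L2_cnj by blast
      then obtain u where u: "(f, u) \<in> ?S" "ae_I (\<lambda>x. u x - z * f x = cnj (h x))" by (auto simp: solves_def)
      obtain w where w: "((\<lambda>x. cnj (f x)), w) \<in> ?S" "ae_I (\<lambda>x. w x = cnj (u x))"
        using separated_restriction_cnj[OF v u(1)] .
      have "ae_I (\<lambda>x. w x - cnj z * cnj (f x) = h x)"
        using u(2) w(2)
      proof eventually_elim
        case (elim x)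
        then show ?case by (metis complex_cnj_cnj complex_cnj_diff complex_cnj_mult)
      qed
      then have "solves ?M ?S (cnj z) (\<lambda>x. cnj (f x)) h" using w(1) by (auto simp: solves_def)
      then show "\<exists>f. solves ?M ?S (cnj z) f h" by blast
    qed
    obtain C where C: "\<And>f u. (f, u) \<in> ?S \<Longrightarrow> L2_norm ?M f \<le> C * L2_norm ?M (\<lambda>x. u x - z * f x)"
      using Z by blast
    have cnj_norm: "L2_norm ?M (\<lambda>x. cnj (f x)) = L2_norm ?M f" for f by (simp add: L2_norm_def)
    have "L2_norm ?M f \<le> C * L2_norm ?M (\<lambda>x. u x - cnj z * f x)" if fu: "(f, u) \<in> ?S" for f u
    proof -
      obtain w where w: "((\<lambda>x. cnj (f x)), w) \<in> ?S" "ae_I (\<lambda>x. w x = cnj (u x))"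
        using separated_restriction_cnj[OF v fu] .
      have eq: "L2_norm ?M (\<lambda>x. w x - z * cnj (f x)) = L2_norm ?M (\<lambda>x. cnj (u x - cnj z * f x))"
      proof (rule L2_norm_cong_AE)
        show "AE x in ?M. w x - z * cnj (f x) = cnj (u x - cnj z * f x)" using w(2) by simp
        show "(\<lambda>x. w x - z * cnj (f x)) \<in> borel_measurable ?M"
          by (intro L2_measurable L2_diff L2_scale SL[OF w(1)])
        show "(\<lambda>x. cnj (u x - cnj z * f x)) \<in> borel_measurable ?M"
          by (intro L2_measurable L2_cnj L2_diff L2_scale SL[OF fu])
      qed
      show ?thesis
        using C[OF w(1)] unfolding eq cnj_norm[of f] cnj_norm[of "\<lambda>x. u x - cnj z * f x"] .
    qed
    then show "\<exists>C. \<forall>(f, u)\<in>?S. L2_norm ?M f \<le> C * L2_norm ?M (\<lambda>x. u x - cnj z * f x)"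
      by (intro exI[of _ C]) auto
  qed
qed

text \<open>Membership in the domain is local: the boundary condition at an endpoint sees only the
  piece adjacent to it, and at the junction the function and its quasi-derivative must be
  continuous.\<close>

lemma glue_mem_separated_restriction:
  assumes f1: "sys f1 q1 h1" "in_dom_near \<tau> v LeftEnd f1" "L2_near \<tau> LeftEnd h1" "h1 \<in> borel_measurable (lebesgue_on I)"
    and f2: "sys f2 q2 h2" "in_dom_near \<tau> v RightEnd f2" "L2_near \<tau> RightEnd h2" "h2 \<in> borel_measurable (lebesgue_on I)"
    and c: "c \<in> I" "f1 c = f2 c" "q1 c = q2 c"
  defines "f \<equiv> \<lambda>x. if x \<le> c then f1 x else f2 x"
  shows "(f, tau \<tau> f) \<in> separated_restriction \<tau> v" "ae_I (\<lambda>x. tau \<tau> f x = (if x \<le> c then h1 x else h2 x))"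
proof -
  let ?h = "\<lambda>x. if x \<le> c then h1 x else h2 x"
  have s: "sys f (\<lambda>x. if x \<le> c then q1 x else q2 x) ?h"
    unfolding f_def by (rule sys_glue[OF f1(1) f2(1) c])
  note f = sys_imp_D_tau[OF s]
  show ae: "ae_I (\<lambda>x. tau \<tau> f x = ?h x)" by (rule f(3))
  have fL: "f \<in> L2 (sl_measure \<tau>)"
    by (rule L2_of_L2_near[OF D_tau_measurable[OF f(1)] c(1), of f1 f2])
       (use f1(2) f2(2) in \<open>auto simp: in_dom_near_def f_def\<close>)
  have "?h \<in> borel_measurable (lebesgue_on I)"
  proof (rule measurable_If[OF f1(4) f2(4)])
    show "{x \<in> space (lebesgue_on I). x \<le> c} \<in> sets (lebesgue_on I)"
      by (auto simp: sets_restrict_space intro!: image_eqI[of _ _ "{..c}"])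
  qed
  then have "?h \<in> L2 (sl_measure \<tau>)"
    by (rule L2_of_L2_near[OF _ c(1), of _ h1 h2]) (use f1(3) f2(3) in auto)
  then have "tau \<tau> f \<in> L2 (sl_measure \<tau>)"
    by (rule L2_sl_measure_cong_ae) (use ae in \<open>auto elim: eventually_mono\<close>)
  then have dom: "f \<in> dom_max \<tau>" using fL f(1) by (simp add: dom_max_def)
  have W1: "wronskian \<tau> f k x = wronskian \<tau> f1 k x" if "x \<in> I" "x < c" for k x
    using that f(2)[OF that(1)] sys_imp_D_tau(2)[OF f1(1) that(1)] by (simp add: wronskian_def f_def)
  have W2: "wronskian \<tau> f k x = wronskian \<tau> f2 k x" if "x \<in> I" "c < x" for k x
    using that f(2)[OF that(1)] sys_imp_D_tau(2)[OF f2(1) that(1)] by (simp add: wronskian_def f_def)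
  have "boundary_cond \<tau> v e f" for e
  proof (cases e)
    case LeftEnd
    have ev: "\<forall>\<^sub>F x in end_filter \<tau> LeftEnd. wronskian \<tau> f k x = wronskian \<tau> f1 k x" for k
      using eventually_end_part[OF c(1), of LeftEnd]
      by eventually_elim (use W1 in \<open>auto simp: end_part_LeftEnd[OF c(1)] simp del: end_part.simps\<close>)
    show ?thesis using f1(2)
      unfolding LeftEnd in_dom_near_def boundary_cond_def wronskian_at_def tendsto_cong[OF ev] by blast
  next
    case RightEnd
    have ev: "\<forall>\<^sub>F x in end_filter \<tau> RightEnd. wronskian \<tau> f k x = wronskian \<tau> f2 k x" for k
      using eventually_end_part[OF c(1), of RightEnd]
      by eventually_elim (use W2 in \<open>auto simp: end_part_RightEnd[OF c(1)] simp del: end_part.simps\<close>)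
    show ?thesis using f2(2)
      unfolding RightEnd in_dom_near_def boundary_cond_def wronskian_at_def tendsto_cong[OF ev] by blast
  qed
  then show "(f, tau \<tau> f) \<in> separated_restriction \<tau> v" using dom by (simp add: mem_separated_restriction)
qed

end

subsection \<open>Real entire functions\<close>

text \<open>Schwarz reflection: \<open>F\<close> and its reflection are both entire and agree on the
  real axis, which accumulates at 0.\<close>

lemma real_entire_cnj:
  assumes "real_entire F"
  shows "F (cnj z) = cnj (F z)"
proof -
  have F: "F holomorphic_on UNIV" and R: "\<And>z. z \<in> \<real> \<Longrightarrow> F z \<in> \<real>" using assms by (auto simp: real_entire_def)
  have "(cnj \<circ> F \<circ> cnj) holomorphic_on UNIV"
    by (rule holomorphic_on_compose_cnj_cnj) (auto intro: holomorphic_on_subset[OF F])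
  then have hol: "(\<lambda>z. F z - (cnj \<circ> F \<circ> cnj) z) holomorphic_on UNIV" using F by (intro holomorphic_on_diff)
  have real: "F z - (cnj \<circ> F \<circ> cnj) z = 0" if "z \<in> \<real>" for z
    using that R[OF that] by (simp add: Reals_cnj_iff)
  have lim: "(0::complex) islimpt \<real>"
    unfolding islimpt_approachable
  proof (intro allI impI)
    fix e :: real assume "0 < e"
    then show "\<exists>x'\<in>\<real>. x' \<noteq> 0 \<and> dist x' (0::complex) < e"
      by (intro bexI[of _ "complex_of_real (e / 2)"]) auto
  qed
  have "F (cnj z) - (cnj \<circ> F \<circ> cnj) (cnj z) = 0"
    by (rule analytic_continuation[OF hol open_UNIV connected_UNIV subset_UNIV UNIV_I lim real UNIV_I])
  then show ?thesis by simp
qed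

subsection \<open>The singular Weyl--Titchmarsh--Kodaira function\<close>

locale singular_weyl = sturm_liouville +
  fixes v :: "endpoint \<Rightarrow> real \<Rightarrow> complex" and \<theta> \<phi> :: "complex \<Rightarrow> real \<Rightarrow> complex" and m :: "complex \<Rightarrow> complex"
  assumes boundary: "\<And>c. limit_circle \<tau> c \<Longrightarrow> boundary_function \<tau> c (v c)"
    and system: "real_entire_fundamental_system \<tau> \<theta> \<phi>"
    and W_eq_1: "\<And>z x. x \<in> ival \<tau> \<Longrightarrow> wronskian \<tau> (\<theta> z) (\<phi> z) x = 1"
    and phi_left: "\<And>z. in_dom_near \<tau> v LeftEnd (\<phi> z)"
    and psi_right: "\<And>z. z \<in> resolvent_set (sl_measure \<tau>) (separated_restriction \<tau> v) \<Longrightarrow>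
           in_dom_near \<tau> v RightEnd (\<lambda>x. \<theta> z x + m z * \<phi> z x)"
begin

abbreviation "S \<equiv> separated_restriction \<tau> v"
abbreviation "\<rho> \<equiv> resolvent_set (sl_measure \<tau>) S"

text \<open>The factor 1 gives the body the shape expected by the lemmas on linear
  combinations.\<close>

definition \<psi> :: "complex \<Rightarrow> real \<Rightarrow> complex" where "\<psi> z = (\<lambda>x. 1 * \<theta> z x + m z * \<phi> z x)"

lemma sol_theta: "solution \<tau> z (\<theta> z)" and sol_phi: "solution \<tau> z (\<phi> z)"
  using system by (auto simp: real_entire_fundamental_system_def)

lemma sol_psi: "solution \<tau> z (\<psi> z)"
  unfolding \<psi>_def by (rule solution_lincomb[OF sol_theta sol_phi])

lemma psi_right': "z \<in> \<rho> \<Longrightarrow> in_dom_near \<tau> v RightEnd (\<psi> z)"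
  using psi_right by (simp add: \<psi>_def)

lemma phi_not_0: "\<exists>x\<in>I. \<phi> z x \<noteq> 0"
proof (rule ccontr)
  assume "\<not> ?thesis"
  then have "\<forall>x\<in>I. 0 * \<theta> z x + 1 * \<phi> z x = 0" by simp
  moreover have "(\<forall>x\<in>I. c * \<theta> z x + d * \<phi> z x = 0) \<longrightarrow> c = 0 \<and> d = 0" for c d
    using system unfolding real_entire_fundamental_system_def by blast
  ultimately show False by (metis zero_neq_one)
qed

lemma entire:
  assumes "x \<in> I"
  shows "real_entire (\<lambda>z. \<theta> z x)" "real_entire (\<lambda>z. \<phi> z x)"
    "real_entire (\<lambda>z. quasi_deriv \<tau> (\<theta> z) x)" "real_entire (\<lambda>z. quasi_deriv \<tau> (\<phi> z) x)"
  using system assms by (auto simp: real_entire_fundamental_system_def)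

section \<open>Reflection symmetry of \<open>m\<close>\<close>

lemma m_cnj:
  assumes z: "z \<in> \<rho>"
  shows "m z = cnj (m (cnj z))"
proof -
  have cz: "cnj z \<in> \<rho>" using z by (intro cnj_resolvent_set boundary)
  have refl: "cnj (\<theta> (cnj z) x) = \<theta> z x" "cnj (\<phi> (cnj z) x) = \<phi> z x" if "x \<in> I" for x
    using real_entire_cnj[OF entire(1)[OF that], of z] real_entire_cnj[OF entire(2)[OF that], of z] by simp_all
  \<comment> \<open>On \<open>I\<close> this reflection is \<theta> at \<open>z\<close> plus
    \<open>cnj (m (cnj z))\<close> times \<phi> at \<open>z\<close>, so its difference from
    \<open>\<psi> z\<close> is \<open>\<kappa>\<close> times \<open>\<phi> z\<close>.\<close>
  define g where "g = (\<lambda>x. cnj (\<psi> (cnj z) x))"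
  define \<kappa> where "\<kappa> = m z - cnj (m (cnj z))"
  have reg: "regular_near c (\<psi> (cnj z))" if "L2_near \<tau> c (\<psi> (cnj z))" for c
    by (rule regular_near_solution[OF sol_psi that])
  have chi: "g \<in> D_tau \<tau>" "in_dom_near \<tau> v RightEnd g"
  proof -
    have "in_dom_near \<tau> v RightEnd (\<psi> (cnj z))" by (rule psi_right'[OF cz])
    then have *: "L2_near \<tau> RightEnd (\<psi> (cnj z))" "boundary_cond \<tau> v RightEnd (\<psi> (cnj z))"
      by (auto simp: in_dom_near_def)
    show "g \<in> D_tau \<tau>" using regular_near_cnj[OF reg[OF *(1)]] by (simp add: g_def regular_near_def)
    show "in_dom_near \<tau> v RightEnd g"
      using L2_near_cnj[OF *(1)] boundary_cond_cnj[OF boundary reg[OF *(1)] *(2)]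
      by (simp add: in_dom_near_def g_def)
  qed
  have D: "\<psi> z \<in> D_tau \<tau>" using sol_psi solution_D_tau by blast
  have diff: "1 * \<psi> z x + (-1) * g x = \<kappa> * \<phi> z x" if "x \<in> I" for x
    using refl[OF that] by (simp add: \<psi>_def g_def \<kappa>_def algebra_simps)
  define u where "u = (\<lambda>x. \<kappa> * \<phi> z x + 0 * \<phi> z x)"
  have sol_u: "solution \<tau> z u" unfolding u_def by (rule solution_lincomb[OF sol_phi sol_phi])
  have "in_dom_near \<tau> v LeftEnd u"
    unfolding u_def by (rule in_dom_near_lincomb) (use phi_left sol_phi solution_D_tau in blast)+
  moreover have "in_dom_near \<tau> v RightEnd u"
  proof -
    let ?d = "\<lambda>x. 1 * \<psi> z x + (-1) * g x"
    have dom: "in_dom_near \<tau> v RightEnd ?d"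
      by (rule in_dom_near_lincomb[OF D chi(1) psi_right'[OF z] chi(2)])
    have eq: "?d x = u x" if "x \<in> I" for x using diff[OF that] by (simp add: u_def)
    have s: "sys ?d (\<lambda>x. 1 * quasi_deriv \<tau> (\<psi> z) x + (-1) * quasi_deriv \<tau> g x) (\<lambda>x. 1 * tau \<tau> (\<psi> z) x + (-1) * tau \<tau> g x)"
      by (rule sys_lincomb[OF sys_of_D_tau[OF D] sys_of_D_tau[OF chi(1)]])
    \<comment> \<open>\<open>?d\<close> and \<open>u\<close> are known to agree on \<open>I\<close>
      only, while \<open>quasi_deriv\<close> is a choice depending on the whole function; uniqueness
      for the first-order system reconciles the two on \<open>I\<close>.\<close>
    have "quasi_deriv \<tau> ?d x = quasi_deriv \<tau> u x" if "x \<in> I" for x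
    proof -
      have "sys u (quasi_deriv \<tau> ?d) (tau \<tau> ?d)"
        using sys_cong[OF sys_of_D_tau[OF sys_imp_D_tau(1)[OF s]] eq] .
      from sys_imp_D_tau(2)[OF this that] show ?thesis by simp
    qed
    then have "wronskian \<tau> ?d k x = wronskian \<tau> u k x" if "x \<in> I" for k x
      using eq[OF that] that by (simp add: wronskian_def)
    then have ev: "\<forall>\<^sub>F x in end_filter \<tau> RightEnd. wronskian \<tau> ?d k x = wronskian \<tau> u k x" for k
      using eventually_ival[of RightEnd] by (auto elim: eventually_mono)
    have "L2_near \<tau> RightEnd u"
    proof (rule L2_near_cong_ae)
      show "L2_near \<tau> RightEnd ?d" using dom by (simp add: in_dom_near_def)
      show "ae_I (\<lambda>x. ?d x = u x)" using ae_in_ival by eventually_elim (rule eq)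
    qed
    moreover have "boundary_cond \<tau> v RightEnd u"
      using dom unfolding in_dom_near_def boundary_cond_def wronskian_at_def tendsto_cong[OF ev] by blast
    ultimately show ?thesis by (simp add: in_dom_near_def)
  qed
  ultimately have "u x = 0" if "x \<in> I" for x
    using eigenfunction_eq_0[OF z sol_u _ _ that] by blast
  moreover obtain x where "x \<in> I" "\<phi> z x \<noteq> 0" using phi_not_0 by blast
  ultimately have "\<kappa> = 0" by (auto simp: u_def)
  then show ?thesis by (simp add: \<kappa>_def)
qed

section \<open>The resolvent applied to a cut-off solution\<close>

lemma open_rho: "open \<rho>"
  by (rule open_resolvent_set[OF ae_linear_separated_restriction])

text \<open>The resolvent applied to \<open>\<phi> w\<close> on \<open>(a,c]\<close>, extended by zero: to the left of \<open>c\<close> a particular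
  solution is \<open>\<phi> w / (w - z)\<close>, and the coefficients are determined by continuity at \<open>c\<close>.\<close>

definition left_part :: "real \<Rightarrow> complex \<Rightarrow> real \<Rightarrow> complex" where
  "left_part c w x = (if x \<le> c then \<phi> w x else 0)"

definition resolvent_left :: "real \<Rightarrow> complex \<Rightarrow> complex \<Rightarrow> real \<Rightarrow> complex" where
  "resolvent_left c w z x =
     (if x \<le> c then 1 / (w - z) * \<phi> w x + wronskian \<tau> (\<phi> w) (\<psi> z) c / (w - z) * \<phi> z x
      else wronskian \<tau> (\<phi> w) (\<phi> z) c / (w - z) * \<psi> z x)"

lemma L2_near_const_mult: "L2_near \<tau> e f \<Longrightarrow> L2_near \<tau> e (\<lambda>x. a * f x)"
  using L2_near_lincomb[of e f f a 0] by simp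

lemma phi_L2_left: "L2_near \<tau> LeftEnd (\<phi> z)"
  using phi_left by (simp add: in_dom_near_def)

lemma wronskian_psi_phi: "x \<in> I \<Longrightarrow> wronskian \<tau> (\<psi> z) (\<phi> z) x = 1"
  unfolding \<psi>_def
  by (subst wronskian_lincomb[OF solution_D_tau[OF sol_theta] solution_D_tau[OF sol_phi]])
     (simp_all add: W_eq_1, simp add: wronskian_def)

lemma left_part_L2:
  assumes c: "c \<in> I" and z: "z \<in> \<rho>"
  shows "left_part c w \<in> L2 (sl_measure \<tau>)"
\<comment> \<open>The zero function to the right of \<open>c\<close> is presented as a multiple of
  \<open>\<psi> z\<close>, whose square integrability near the right end is known.\<close>
proof (rule L2_of_L2_near[OF _ c, of _ "\<phi> w" "\<lambda>x. 0 * \<psi> z x"])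
  show "left_part c w \<in> borel_measurable (lebesgue_on I)"
    unfolding left_part_def
  proof (rule measurable_If[OF D_tau_measurable[OF solution_D_tau[OF sol_phi]] borel_measurable_const])
    show "{x \<in> space (lebesgue_on I). x \<le> c} \<in> sets (lebesgue_on I)"
      by (auto simp: sets_restrict_space intro!: image_eqI[of _ _ "{..c}"])
  qed
  show "L2_near \<tau> RightEnd (\<lambda>x. 0 * \<psi> z x)"
    using psi_right'[OF z] by (intro L2_near_const_mult) (simp add: in_dom_near_def)
qed (auto simp: left_part_def phi_L2_left)

lemma solves_resolvent_left:
  assumes c: "c \<in> I" and z: "z \<in> \<rho>" "z \<noteq> w"
  shows "solves (sl_measure \<tau>) S z (resolvent_left c w z) (left_part c w)"
proof -
  define \<alpha> where "\<alpha> = wronskian \<tau> (\<phi> w) (\<psi> z) c / (w - z)"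
  define \<beta> where "\<beta> = wronskian \<tau> (\<phi> w) (\<phi> z) c / (w - z)"
  let ?f1 = "\<lambda>x. 1 / (w - z) * \<phi> w x + \<alpha> * \<phi> z x" and ?f2 = "\<lambda>x. \<beta> * \<psi> z x + 0 * \<psi> z x"
  let ?q1 = "\<lambda>x. 1 / (w - z) * quasi_deriv \<tau> (\<phi> w) x + \<alpha> * quasi_deriv \<tau> (\<phi> z) x"
  let ?q2 = "\<lambda>x. \<beta> * quasi_deriv \<tau> (\<psi> z) x + 0 * quasi_deriv \<tau> (\<psi> z) x"
  let ?h1 = "\<lambda>x. 1 / (w - z) * (w * \<phi> w x) + \<alpha> * (z * \<phi> z x)"
  let ?h2 = "\<lambda>x. \<beta> * (z * \<psi> z x) + 0 * (z * \<psi> z x)"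
  have D: "\<phi> y \<in> D_tau \<tau>" "\<psi> y \<in> D_tau \<tau>" for y using solution_D_tau sol_phi sol_psi by blast+
  have meas [measurable]: "\<phi> y \<in> borel_measurable (lebesgue_on I)" "\<psi> y \<in> borel_measurable (lebesgue_on I)" for y
    using D_tau_measurable D by blast+
  have psiL: "L2_near \<tau> RightEnd (\<psi> z)" using psi_right'[OF z(1)] by (simp add: in_dom_near_def)
  have wz: "w - z \<noteq> 0" using z(2) by simp
  have one: "\<psi> z c * quasi_deriv \<tau> (\<phi> z) c - quasi_deriv \<tau> (\<psi> z) c * \<phi> z c = 1"
    using wronskian_psi_phi[OF c, of z] by (simp add: wronskian_def)
  have eq: "(w - z) * \<alpha> = wronskian \<tau> (\<phi> w) (\<psi> z) c" "(w - z) * \<beta> = wronskian \<tau> (\<phi> w) (\<phi> z) c"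
    using wz by (simp_all add: \<alpha>_def \<beta>_def)
  have cancel: "(w - z) * (1 / (w - z) * s + \<alpha> * t) = s + ((w - z) * \<alpha>) * t" for s t
    using wz by (simp add: distrib_left)
  \<comment> \<open>Multiplying by \<open>w - z\<close> clears the denominators. Inserting
    \<open>W(\<psi> z, \<phi> z) = 1\<close> as a factor of \<open>\<phi> w c\<close> turns the
    matching condition into a three-term Pluecker identity; the same is done below for the
    quasi-derivatives.\<close>
  have "(w - z) * ?f1 c = (w - z) * ?f2 c"
  proof -
    have "(w - z) * ?f1 c = \<phi> w c * (\<psi> z c * quasi_deriv \<tau> (\<phi> z) c - quasi_deriv \<tau> (\<psi> z) c * \<phi> z c) + ((w - z) * \<alpha>) * \<phi> z c"
      unfolding one cancel by simp
    also have "\<dots> = ((w - z) * \<beta>) * \<psi> z c"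
      unfolding eq wronskian_def by (simp add: algebra_simps)
    finally show ?thesis by simp
  qed
  then have c1: "?f1 c = ?f2 c" using wz by simp
  have "(w - z) * ?q1 c = (w - z) * ?q2 c"
  proof -
    have "(w - z) * ?q1 c = quasi_deriv \<tau> (\<phi> w) c * (\<psi> z c * quasi_deriv \<tau> (\<phi> z) c - quasi_deriv \<tau> (\<psi> z) c * \<phi> z c)
        + ((w - z) * \<alpha>) * quasi_deriv \<tau> (\<phi> z) c"
      unfolding one cancel by simp
    also have "\<dots> = ((w - z) * \<beta>) * quasi_deriv \<tau> (\<psi> z) c"
      unfolding eq wronskian_def by (simp add: algebra_simps)
    finally show ?thesis by simp
  qed
  then have c2: "?q1 c = ?q2 c" using wz by simp
  have s1: "sys ?f1 ?q1 ?h1" by (rule sys_lincomb[OF sys_solution[OF sol_phi] sys_solution[OF sol_phi]])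
  have s2: "sys ?f2 ?q2 ?h2" by (rule sys_lincomb[OF sys_solution[OF sol_psi] sys_solution[OF sol_psi]])
  have d1: "in_dom_near \<tau> v LeftEnd ?f1" by (rule in_dom_near_lincomb[OF D(1) D(1) phi_left phi_left])
  have d2: "in_dom_near \<tau> v RightEnd ?f2"
    by (rule in_dom_near_lincomb[OF D(2) D(2) psi_right'[OF z(1)] psi_right'[OF z(1)]])
  have l1: "L2_near \<tau> LeftEnd ?h1"
    by (rule L2_near_lincomb[OF L2_near_const_mult[OF phi_L2_left] L2_near_const_mult[OF phi_L2_left]])
  have l2: "L2_near \<tau> RightEnd ?h2"
    by (rule L2_near_lincomb[OF L2_near_const_mult[OF psiL] L2_near_const_mult[OF psiL]])
  have m1: "?h1 \<in> borel_measurable (lebesgue_on I)" and m2: "?h2 \<in> borel_measurable (lebesgue_on I)"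
    by measurable
  note glue = glue_mem_separated_restriction[OF s1 d1 l1 m1 s2 d2 l2 m2 c c1 c2]
  have feq: "(\<lambda>x. if x \<le> c then ?f1 x else ?f2 x) = resolvent_left c w z"
    by (simp add: fun_eq_iff resolvent_left_def \<alpha>_def \<beta>_def)
  have "ae_I (\<lambda>x. tau \<tau> (resolvent_left c w z) x - z * resolvent_left c w z x = left_part c w x)"
    using glue(2) unfolding feq
  proof eventually_elim
    case (elim x)
    have "(w / (w - z) - z / (w - z)) * \<phi> w x = \<phi> w x" using wz by (simp flip: diff_divide_distrib)
    then show ?case unfolding elim
      by (auto simp: resolvent_left_def left_part_def \<alpha>_def \<beta>_def algebra_simps)
  qed
  then show ?thesis using glue(1) unfolding feq solves_def by auto
qed

end

section \<open>Holomorphy of \<open>m\<close> from a closed form of a resolvent pairing\<close>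

context singular_weyl
begin

text \<open>The lower cut keeps the test function where the resolvent is a pure multiple of
  \<open>\<psi> z\<close>; the upper cut is there because \<open>\<phi> w\<close> need not be square
  integrable near the right end.\<close>

definition window :: "real \<Rightarrow> real \<Rightarrow> complex \<Rightarrow> real \<Rightarrow> complex" where
  "window c d w x = (if x \<le> d then if c < x then \<phi> w x else 0 else 0)"

lemma window_L2:
  assumes d: "d \<in> I" and z: "z \<in> \<rho>"
  shows "window c d w \<in> L2 (sl_measure \<tau>)"
proof (rule L2_dominated[OF _ L2_integrable[OF left_part_L2[OF d z]]])
  have "{x \<in> space (lebesgue_on I). x \<le> d} \<in> sets (lebesgue_on I)"
    by (auto simp: sets_restrict_space intro!: image_eqI[of _ _ "{..d}"])
  moreover have "{x \<in> space (lebesgue_on I). c < x} \<in> sets (lebesgue_on I)"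
    by (auto simp: sets_restrict_space intro!: image_eqI[of _ _ "{c<..}"])
  ultimately have "window c d w \<in> borel_measurable (lebesgue_on I)"
    unfolding window_def
    using D_tau_measurable[OF solution_D_tau[OF sol_phi]] by (intro measurable_If borel_measurable_const)
  then show "window c d w \<in> borel_measurable (sl_measure \<tau>)" by simp
  show "AE x in sl_measure \<tau>. (cmod (window c d w x))\<^sup>2 \<le> (cmod (left_part d w x))\<^sup>2"
    by (intro AE_I2) (simp add: window_def left_part_def)
qed

text \<open>On the window the integrand is a constant times \<open>r \<psi> z \<phi> w\<close>. The
  Lagrange identity integrates it exactly and contributes the second factor
  \<open>1 / (z - w)\<close>.\<close>

lemma integral_resolvent_left:
  assumes cd: "c \<in> I" "d \<in> I" "c < d" and z: "z \<in> \<rho>" "z \<noteq> w"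
  shows "(\<integral>x. resolvent_left c w z x * window c d w x \<partial>sl_measure \<tau>)
    = wronskian \<tau> (\<phi> z) (\<phi> w) c / (z - w) * (1 / (z - w) * (wronskian \<tau> (\<psi> z) (\<phi> w) d - wronskian \<tau> (\<psi> z) (\<phi> w) c))"
    (is "?lhs = ?rhs")
proof -
  define \<beta> where "\<beta> = wronskian \<tau> (\<phi> z) (\<phi> w) c / (z - w)"
  let ?k = "\<lambda>x. resolvent_left c w z x * window c d w x"
  have L: "resolvent_left c w z \<in> L2 (sl_measure \<tau>)"
    by (rule solves_L2[OF ae_linear_separated_restriction solves_resolvent_left[OF cd(1) z]])
  have int: "integrable (sl_measure \<tau>) ?k" by (rule L2_mult_integrable[OF L window_L2[OF cd(2) z(1)]])
  then have meas: "?k \<in> borel_measurable (lebesgue_on I)" using borel_measurable_integrable by fastforce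
  have lhs: "?lhs = (\<integral>x. rc \<tau> x *\<^sub>R ?k x \<partial>lebesgue_on I)"
    unfolding weight_measure_def
    by (rule integral_density[OF meas measurable_r]) (use ae_r_pos in \<open>auto elim: eventually_mono\<close>)
  have "integrable (lebesgue_on I) (\<lambda>x. rc \<tau> x *\<^sub>R ?k x)"
    using int integrable_weight_iff[OF sets_ival order_refl meas] by (simp add: set_integrable_eq)
  then have 1: "((\<lambda>x. rc \<tau> x *\<^sub>R ?k x) has_integral ?lhs) I"
    unfolding lhs by (rule has_integral_integral_lebesgue_on) simp
  have sub: "{c..d} \<subseteq> I" by (rule Icc_subset_ival[OF cd(1,2)])
  have "((\<lambda>x. of_real (rc \<tau> x) * (\<phi> w x * (z * \<psi> z x) - \<psi> z x * (w * \<phi> w x))) has_integral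
      (wronskian \<tau> (\<psi> z) (\<phi> w) d - wronskian \<tau> (\<psi> z) (\<phi> w) c)) {c..d}"
    unfolding wronskian_def
    by (rule sys_lagrange[OF sys_solution[OF sol_psi] sys_solution[OF sol_phi] less_imp_le[OF cd(3)] sub])
  then have "((\<lambda>x. \<beta> * (1 / (z - w) * (of_real (rc \<tau> x) * (\<phi> w x * (z * \<psi> z x) - \<psi> z x * (w * \<phi> w x))))) has_integral ?rhs) {c..d}"
    unfolding \<beta>_def[symmetric] by (intro has_integral_mult_right)
  then have 2: "((\<lambda>x. if x \<in> {c..d} then \<beta> * (1 / (z - w) * (of_real (rc \<tau> x) * (\<phi> w x * (z * \<psi> z x) - \<psi> z x * (w * \<phi> w x)))) else 0) has_integral ?rhs) I"
    by (subst has_integral_restrict[OF sub])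
  have "((\<lambda>x. rc \<tau> x *\<^sub>R ?k x) has_integral ?rhs) I"
  proof (rule has_integral_spike[OF _ _ 2])
    \<comment> \<open>The window excludes \<open>c\<close>, the integration interval
      \<open>{c..d}\<close> contains it.\<close>
    show "negligible {c}" by simp
    fix x assume x: "x \<in> I - {c}"
    \<comment> \<open>Exchanging the two solutions and reversing the denominator produce two signs
      that cancel.\<close>
    have "wronskian \<tau> (\<phi> w) (\<phi> z) c / (w - z) = \<beta>"
      unfolding \<beta>_def wronskian_def using z(2) by (simp add: field_simps)
    moreover have "\<phi> w x * (z * \<psi> z x) - \<psi> z x * (w * \<phi> w x) = (z - w) * (\<psi> z x * \<phi> w x)"
      by (simp add: algebra_simps)
    ultimately show "rc \<tau> x *\<^sub>R ?k x = (if x \<in> {c..d} then \<beta> * (1 / (z - w) * (of_real (rc \<tau> x) * (\<phi> w x * (z * \<psi> z x) - \<psi> z x * (w * \<phi> w x)))) else 0)"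
      using x z(2) by (auto simp: resolvent_left_def window_def scaleR_conv_of_real)
  qed
  from has_integral_unique[OF 1 this] show ?thesis .
qed

text \<open>If the Wronskian were constant, its derivative
  \<open>(z - w) r \<phi> z \<phi> w\<close> would vanish almost everywhere; as
  \<open>r > 0\<close>, continuity would force the product of the two solutions to vanish at
  \<open>x0\<close>.\<close>

lemma wronskian_nonconstant:
  assumes x0: "x0 \<in> I" "\<phi> z x0 \<noteq> 0" "\<phi> w x0 \<noteq> 0" and zw: "z \<noteq> w"
  obtains c d where "c \<in> I" "d \<in> I" "c < d" "wronskian \<tau> (\<phi> z) (\<phi> w) c \<noteq> 0"
    "wronskian \<tau> (\<phi> z) (\<phi> w) c \<noteq> wronskian \<tau> (\<phi> z) (\<phi> w) d"
proof -
  define W where "W = wronskian \<tau> (\<phi> z) (\<phi> w)"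
  have Weq: "W = (\<lambda>x. \<phi> z x * quasi_deriv \<tau> (\<phi> w) x - quasi_deriv \<tau> (\<phi> z) x * \<phi> w x)"
    by (simp add: W_def wronskian_def fun_eq_iff)
  note sw = sys_wronskian[OF sys_solution[OF sol_phi[of z]] sys_solution[OF sol_phi[of w]], folded Weq]
  have cont: "continuous_on I W" by (rule AC_loc_continuous_on[OF sw(1) open_ival])
  have "\<exists>x1\<in>I. \<exists>x2\<in>I. x1 < x2 \<and> W x1 \<noteq> W x2"
  proof (rule ccontr)
    assume "\<not> ?thesis"
    then have const: "W x = W x0" if "x \<in> I" for x
      using that x0(1) by (metis linorder_neqE)
    have der: "vector_derivative W (at x) = 0" if "x \<in> I" for x
    proof (rule vector_derivative_at)
      show "(W has_vector_derivative 0) (at x)"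
        by (rule has_vector_derivative_transform_within_open[OF has_vector_derivative_const[of "W x0"] open_ival that])
           (simp add: const)
    qed
    have "ae_I (\<lambda>x. \<phi> z x * \<phi> w x = 0)"
      using sw(2) ae_r_pos ae_in_ival
    proof eventually_elim
      case (elim x)
      have "\<phi> w x * (z * \<phi> z x) - \<phi> z x * (w * \<phi> w x) = (z - w) * (\<phi> z x * \<phi> w x)"
        by (simp add: algebra_simps)
      then show ?case using elim der[OF elim(3)] zw by simp
    qed
    then have "\<phi> z x0 * \<phi> w x0 = 0"
      by (intro AE_eq_imp_eq_on_open[OF open_ival _ continuous_on_const _ x0(1)] continuous_on_mult
          D_tau_continuous solution_D_tau[OF sol_phi])
    then show False using x0 by simp
  qed
  then obtain x1 x2 where x: "x1 \<in> I" "x2 \<in> I" "x1 < x2" "W x1 \<noteq> W x2" by blast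
  show ?thesis
  proof (cases "W x1 = 0")
    case False
    then show ?thesis using that[of x1 x2] x by (simp add: W_def)
  next
    case True
    have sub: "{x1..x2} \<subseteq> I" by (rule Icc_subset_ival[OF x(1,2)])
    have "continuous_on {x1..x2} (\<lambda>x. cmod (W x))"
      by (intro continuous_on_norm continuous_on_subset[OF cont sub])
    \<comment> \<open>When the Wronskian vanishes at the left point, a point in between where its
      modulus is half of that at \<open>x2\<close> replaces it: the value there is neither 0 nor
      \<open>W x2\<close>.\<close>
    then obtain c where c: "x1 \<le> c" "c \<le> x2" "cmod (W c) = cmod (W x2) / 2"
      using IVT'[of "\<lambda>x. cmod (W x)" x1 "cmod (W x2) / 2" x2] True x(3) by auto
    have "W x2 \<noteq> 0" using True x(4) by simp
    then have "W c \<noteq> 0" "W c \<noteq> W x2" using c(3) by auto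
    moreover have "c < x2" using c(2) \<open>W c \<noteq> W x2\<close> by (cases "c = x2") auto
    moreover have "c \<in> I" using sub c by auto
    ultimately show ?thesis using that[of c x2] x by (simp add: W_def)
  qed
qed

lemma wronskian_holomorphic:
  assumes "x \<in> I"
  shows "(\<lambda>z. wronskian \<tau> (\<phi> z) k x) holomorphic_on UNIV" "(\<lambda>z. wronskian \<tau> (\<theta> z) k x) holomorphic_on UNIV"
  using entire[OF assms] unfolding wronskian_def real_entire_def by (auto intro!: holomorphic_intros)

lemma m_holomorphic_near:
  assumes z0: "z0 \<in> \<rho>"
  obtains N where "open N" "z0 \<in> N" "N \<subseteq> \<rho>" "m holomorphic_on N"
proof -
  obtain x0 where x0: "x0 \<in> I" "\<phi> z0 x0 \<noteq> 0" using phi_not_0 by blast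
  have "continuous_on UNIV (\<lambda>z. \<phi> z x0)"
    using entire(2)[OF x0(1)] by (auto simp: real_entire_def intro: holomorphic_on_imp_continuous_on)
  then have "open {z. \<phi> z x0 \<noteq> 0}" by (intro open_Collect_neq continuous_on_const)
  then obtain e where e: "e > 0" "ball z0 e \<subseteq> {z. \<phi> z x0 \<noteq> 0}"
    using x0(2) open_contains_ball by blast
  \<comment> \<open>Any \<open>w \<noteq> z0\<close> in the ball would do: \<open>\<phi> w\<close>
    and \<open>\<phi> z0\<close> are then both non-zero at \<open>x0\<close>.\<close>
  define w where "w = z0 + of_real (e / 2)"
  have "w \<in> ball z0 e" using e(1) by (simp add: w_def dist_norm)
  then have w: "\<phi> w x0 \<noteq> 0" using e(2) by blast
  have "z0 \<noteq> w" using e(1) by (simp add: w_def)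
  obtain c d where cd: "c \<in> I" "d \<in> I" "c < d" "wronskian \<tau> (\<phi> z0) (\<phi> w) c \<noteq> 0"
    "wronskian \<tau> (\<phi> z0) (\<phi> w) c \<noteq> wronskian \<tau> (\<phi> z0) (\<phi> w) d"
    using wronskian_nonconstant[OF x0 w \<open>z0 \<noteq> w\<close>] .
  define P where "P x z = wronskian \<tau> (\<phi> z) (\<phi> w) x" for x z
  define Q where "Q x z = wronskian \<tau> (\<theta> z) (\<phi> w) x" for x z
  have hol: "P x holomorphic_on A" "Q x holomorphic_on A" if "x \<in> I" for x A
    using wronskian_holomorphic[OF that, of "\<phi> w"] holomorphic_on_subset[OF _ subset_UNIV]
    unfolding P_def[abs_def] Q_def[abs_def] by blast+
  have cont: "continuous_on UNIV (P x)" if "x \<in> I" for x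
    using hol(1)[OF that] by (rule holomorphic_on_imp_continuous_on)
  \<comment> \<open>The three inequalities exclude the zeros of the denominators met when the
    formula for \<open>F\<close> is solved for \<open>m z\<close>; at \<open>z0\<close> they hold by
    the choice of \<open>w\<close>, \<open>c\<close> and \<open>d\<close>.\<close>
  define N where "N = \<rho> \<inter> {z. z \<noteq> w} \<inter> {z. P c z \<noteq> 0} \<inter> {z. P c z \<noteq> P d z}"
  have N: "open N" unfolding N_def
    by (intro open_Int open_rho open_Collect_neq cont cd continuous_on_const continuous_on_id)
  have z0N: "z0 \<in> N" using z0 \<open>z0 \<noteq> w\<close> cd(4,5) by (simp add: N_def P_def)
  have N\<rho>: "N \<subseteq> \<rho>" by (auto simp: N_def)
  define F where "F z = (\<integral>x. resolvent_left c w z x * window c d w x \<partial>sl_measure \<tau>)" for z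
  have F: "F holomorphic_on N"
    unfolding F_def[abs_def]
  proof (rule resolvent_weakly_holomorphic[OF ae_linear_separated_restriction N N\<rho>])
    show "solves (sl_measure \<tau>) S z (resolvent_left c w z) (left_part c w)" if "z \<in> N" for z
      using that by (intro solves_resolvent_left cd) (auto simp: N_def)
  qed (rule left_part_L2[OF cd(1) z0], rule window_L2[OF cd(2) z0])
  have m_eq: "m z = (F z * (z - w)\<^sup>2 / P c z - (Q d z - Q c z)) / (P d z - P c z)" if z: "z \<in> N" for z
  proof -
    have nz: "z - w \<noteq> 0" "P c z \<noteq> 0" "P d z - P c z \<noteq> 0" "z \<in> \<rho>" "z \<noteq> w" using z by (auto simp: N_def)
    have Wpsi: "wronskian \<tau> (\<psi> z) (\<phi> w) x = Q x z + m z * P x z" if "x \<in> I" for x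
      unfolding \<psi>_def P_def Q_def
      by (subst wronskian_lincomb[OF solution_D_tau[OF sol_theta] solution_D_tau[OF sol_phi] that]) simp
    have "F z = P c z / (z - w) * (1 / (z - w) * ((Q d z + m z * P d z) - (Q c z + m z * P c z)))"
      unfolding F_def integral_resolvent_left[OF cd(1,2,3) nz(4,5)] Wpsi[OF cd(1)] Wpsi[OF cd(2)] P_def ..
    moreover have "P c z / (z - w) * (1 / (z - w) * r) * (z - w)\<^sup>2 / P c z = r" for r
      using nz(1,2) by (simp add: power2_eq_square)
    ultimately have "F z * (z - w)\<^sup>2 / P c z = (Q d z + m z * P d z) - (Q c z + m z * P c z)" by simp
    then have "F z * (z - w)\<^sup>2 / P c z = (Q d z - Q c z) + m z * (P d z - P c z)"
      by (simp add: algebra_simps)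
    then show ?thesis using nz(3) by simp
  qed
  have "(\<lambda>z. (F z * (z - w)\<^sup>2 / P c z - (Q d z - Q c z)) / (P d z - P c z)) holomorphic_on N"
    by (intro holomorphic_intros F hol cd) (auto simp: N_def)
  then have "m holomorphic_on N"
    by (rule holomorphic_transform) (simp add: m_eq)
  with N z0N N\<rho> show ?thesis by (rule that)
qed

lemma m_analytic: "m analytic_on \<rho>"
proof -
  have "m analytic_on {z}" if z: "z \<in> \<rho>" for z
  proof -
    obtain N where "open N" "z \<in> N" "m holomorphic_on N" using m_holomorphic_near[OF z] by metis
    then have "m analytic_on N" by (simp add: analytic_on_open)
    then show ?thesis by (rule analytic_on_subset) (use \<open>z \<in> N\<close> in simp)
  qed
  then show ?thesis using analytic_on_analytic_at by blast
qed

end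

theorem theorem8p2:
  fixes \<tau> :: sl_data
    and v :: "endpoint \<Rightarrow> real \<Rightarrow> complex"
    and S :: "real op_graph"
    and \<theta> \<phi> :: "complex \<Rightarrow> real \<Rightarrow> complex"
    and m :: "complex \<Rightarrow> complex"
  assumes "sl_expression \<tau>"
    and "\<And>c. limit_circle \<tau> c \<Longrightarrow> boundary_function \<tau> c (v c)"
    and "S = separated_restriction \<tau> v"
    and "self_adjoint (sl_measure \<tau>) S"
    and "real_entire_fundamental_system \<tau> \<theta> \<phi>"
    and "\<And>z x. x \<in> ival \<tau> \<Longrightarrow> wronskian \<tau> (\<theta> z) (\<phi> z) x = 1"
    and "\<And>z. in_dom_near \<tau> v LeftEnd (\<phi> z)"
    and "\<And>z. z \<in> resolvent_set (sl_measure \<tau>) S \<Longrightarrow>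
           in_dom_near \<tau> v RightEnd (\<lambda>x. \<theta> z x + m z * \<phi> z x)"
  shows "m analytic_on resolvent_set (sl_measure \<tau>) S \<and>
         (\<forall>z \<in> resolvent_set (sl_measure \<tau>) S. m z = cnj (m (cnj z)))"
proof -
  interpret singular_weyl \<tau> v \<theta> \<phi> m
    by unfold_locales (use assms in simp_all)
  show ?thesis using m_analytic m_cnj unfolding assms(3) by blast
qed

end
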